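(* Let $g_1,g_2,\dots$ be real-valued exchangeable random variables on a probability space $(\Omega,\mathcal F,\mathbb P)$ with tail $\sigma$-algebra $\mathcal T_*=\bigcap_{n}\sigma(g_n,g_{n+1},\dots)$. For $\varepsilon>0$, $t>0$, $N\in\mathbb N$ define $\Delta_t=\mathbb E(g_1\mathbf 1_{\{|g_1|\le t\}}\mid\mathcal T_* )$; $T_t(\varepsilon)=t\,\mathbb P(|g_1|>\varepsilon t\mid\mathcal T_* )$; $\Sigma_t(\varepsilon)=\frac1t\mathbb E(g_1^2\mathbf 1_{\{|g_1|\le\varepsilon t\}}\mid\mathcal T_* )$; $V_t(\varepsilon)=\frac1t\mathrm{Var}(g_1\mathbf 1_{\{|g_1|\le\varepsilon t\}}\mid\mathcal T_* )$; $R_t(\varepsilon)=\frac1t\mathbb E\big((|g_1|\wedge\varepsilon t)^2\mid\mathcal T_*\big)$. The following are equivalent: (i) there exist real-valued $\mathcal T_*$-measurable $D_1,D_2,\dots$ such that for each $\varepsilon>0$, $\mathbb P\big(\big|\frac1N\sum_{n=1}^N g_n-D_N\big|>\varepsilon\big)\to0$ as $N\to\infty$; (i)$'$ there exist real-valued $\mathcal T_*$-measurable $D_1,D_2,\dots$ such that for each $\varepsilon>0$, $\mathbb P\big(\big|\frac1N\sum_{n=1}^N g_n-D_N\big|>\varepsilon\,\big|\,\mathcal T_*\big)\to0$ in $\mathbb P$-probability as $N\to\infty$; (ii) for every $\varepsilon>0$, both $T_t(\varepsilon)\to0$ and $\Sigma_t(\varepsilon)\to0$ in $\mathbb P$-probability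 as $t\to\infty$; (ii)$'$ for every $\varepsilon>0$, both $T_t(\varepsilon)\to0$ and $V_t(\varepsilon)\to0$ in $\mathbb P$-probability as $t\to\infty$; (ii)$''$ for every $\varepsilon>0$, $R_t(\varepsilon)\to0$ in $\mathbb P$-probability as $t\to\infty$; (iii) for every $\varepsilon>0$, $\frac1M\int_0^M T_t(\varepsilon)\,dt\to0$ in $\mathbb P$-probability as $M\to\infty$; (iii)$'$ for every $\varepsilon>0$, $M\int_M^\infty\frac{\Sigma_t(\varepsilon)}{t^2}dt\to0$ in $\mathbb P$-probability as $M\to\infty$; (iii)$''$ for every $\varepsilon>0$, $M\int_M^\infty\frac{V_t(\varepsilon)}{t^2}dt\to0$ in $\mathbb P$-probability as $M\to\infty$. Moreover, when any (hence all) of (ii)–(iii)$''$ hold, then (i) and (i)$'$ hold with $D_N=\Delta_N$; and $\mathcal T_*$-measurable correctors $D_N$ for which (i) or (i)$'$ holds satisfy $D_N/\sqrt N\to0$ in $\mathbb P$-probability. *)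

theory Defs
  imports "HOL-Probability.Probability"
begin

definition exchangeable :: "'a measure \<Rightarrow> (nat \<Rightarrow> 'a \<Rightarrow> real) \<Rightarrow> bool" where
  "exchangeable M g \<longleftrightarrow>
     (\<forall>n::nat. \<forall>\<pi>. \<pi> permutes {..<n} \<longrightarrow>
        distr M (PiM {..<n} (\<lambda>_. borel)) (\<lambda>\<omega>. \<lambda>i\<in>{..<n}. g (\<pi> i) \<omega>)
      = distr M (PiM {..<n} (\<lambda>_. borel)) (\<lambda>\<omega>. \<lambda>i\<in>{..<n}. g i \<omega>))"

definition tail_sigma :: "'a measure \<Rightarrow> (nat \<Rightarrow> 'a \<Rightarrow> real) \<Rightarrow> 'a measure" where
  "tail_sigma M g = sigma (space M)
     (\<Inter>n. sigma_sets (space M) (\<Union>i\<in>{n..}. {g i -` B \<inter> space M | B. B \<in> sets borel}))"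

definition is_cond_distr :: "'a measure \<Rightarrow> 'a measure \<Rightarrow> ('a \<Rightarrow> real) \<Rightarrow> ('a \<Rightarrow> real measure) \<Rightarrow> bool" where
  "is_cond_distr M F X \<kappa> \<longleftrightarrow>
     (\<forall>\<omega>\<in>space M. prob_space (\<kappa> \<omega>) \<and> sets (\<kappa> \<omega>) = sets borel) \<and>
     (\<forall>B\<in>sets borel. (\<lambda>\<omega>. measure (\<kappa> \<omega>) B) \<in> borel_measurable F) \<and>
     (\<forall>A\<in>sets F. \<forall>B\<in>sets borel.
        measure M (A \<inter> (X -` B \<inter> space M)) = (LINT \<omega>:A|M. measure (\<kappa> \<omega>) B))"

definition conv_in_prob :: "'a measure \<Rightarrow> 'i filter \<Rightarrow> ('i \<Rightarrow> 'a \<Rightarrow> real) \<Rightarrow> ('a \<Rightarrow> real) \<Rightarrow> bool" where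
  "conv_in_prob M F X Y \<longleftrightarrow>
     (\<forall>t. X t \<in> borel_measurable M) \<and>
     (\<forall>\<epsilon>>0. ((\<lambda>t. measure M {\<omega>\<in>space M. \<epsilon> < \<bar>X t \<omega> - Y \<omega>\<bar>}) \<longlongrightarrow> 0) F)"

text \<open>The quantities of the theorem, computed from a regular conditional
  distribution kappa of g_1 given the tail sigma-algebra.\<close>
definition Delta :: "('a \<Rightarrow> real measure) \<Rightarrow> real \<Rightarrow> 'a \<Rightarrow> real" where
  "Delta \<kappa> t \<omega> = (\<integral>x. x * indicator {x. \<bar>x\<bar> \<le> t} x \<partial>(\<kappa> \<omega>))"

definition Tq :: "('a \<Rightarrow> real measure) \<Rightarrow> real \<Rightarrow> real \<Rightarrow> 'a \<Rightarrow> real" where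
  "Tq \<kappa> \<epsilon> t \<omega> = t * measure (\<kappa> \<omega>) {x. \<bar>x\<bar> > \<epsilon> * t}"

definition Sigq :: "('a \<Rightarrow> real measure) \<Rightarrow> real \<Rightarrow> real \<Rightarrow> 'a \<Rightarrow> real" where
  "Sigq \<kappa> \<epsilon> t \<omega> = (1 / t) * (\<integral>x. (x * indicator {x. \<bar>x\<bar> \<le> \<epsilon> * t} x)\<^sup>2 \<partial>(\<kappa> \<omega>))"

definition Vq :: "('a \<Rightarrow> real measure) \<Rightarrow> real \<Rightarrow> real \<Rightarrow> 'a \<Rightarrow> real" where
  "Vq \<kappa> \<epsilon> t \<omega> = (1 / t) *
     ((\<integral>x. (x * indicator {x. \<bar>x\<bar> \<le> \<epsilon> * t} x)\<^sup>2 \<partial>(\<kappa> \<omega>))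
      - (\<integral>x. x * indicator {x. \<bar>x\<bar> \<le> \<epsilon> * t} x \<partial>(\<kappa> \<omega>))\<^sup>2)"

definition Rq :: "('a \<Rightarrow> real measure) \<Rightarrow> real \<Rightarrow> real \<Rightarrow> 'a \<Rightarrow> real" where
  "Rq \<kappa> \<epsilon> t \<omega> = (1 / t) * (\<integral>x. (min \<bar>x\<bar> (\<epsilon> * t))\<^sup>2 \<partial>(\<kappa> \<omega>))"

text \<open>Conditions (i) and (i)' for a given corrector sequence D (indices shifted: g 0 = g_1).\<close>
definition cond_i :: "'a measure \<Rightarrow> (nat \<Rightarrow> 'a \<Rightarrow> real) \<Rightarrow> (nat \<Rightarrow> 'a \<Rightarrow> real) \<Rightarrow> bool" where
  "cond_i M g D \<longleftrightarrow> (\<forall>\<epsilon>>0.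
     ((\<lambda>N. measure M {\<omega>\<in>space M. \<epsilon> < \<bar>(\<Sum>n<N. g n \<omega>) / real N - D N \<omega>\<bar>}) \<longlongrightarrow> 0) sequentially)"

definition cond_i' :: "'a measure \<Rightarrow> (nat \<Rightarrow> 'a \<Rightarrow> real) \<Rightarrow> (nat \<Rightarrow> 'a \<Rightarrow> real) \<Rightarrow> bool" where
  "cond_i' M g D \<longleftrightarrow> (\<forall>\<epsilon>>0.
     conv_in_prob M sequentially
       (\<lambda>N. real_cond_exp M (tail_sigma M g)
          (indicator {\<omega>\<in>space M. \<epsilon> < \<bar>(\<Sum>n<N. g n \<omega>) / real N - D N \<omega>\<bar>}))
       (\<lambda>_. 0))"

end

theory Submission
  imports Defs "HOL-Combinatorics.Permutations" "HOL-Real_Asymp.Real_Asymp"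
begin

text \<open>Given the tail the sequence is conditionally i.i.d. with law \<open>\<kappa>\<close> (de Finetti): by
  exchangeability a bounded function of \<open>g k\<close> may be replaced, when tested against the tail and the
  past, by averages over later indices; these converge along \<open>4\<^sup>j\<close> to a tail measurable limit, which
  must then be the \<open>\<kappa>\<close>-integral. Tonelli's theorem expresses the integral conditions through \<open>Rq\<close>, since
  \<open>(1/m) \<integral>\<^sub>0\<^sup>m Tq = Rq / (2 \<epsilon>\<^sup>2)\<close>, \<open>m \<integral>\<^sub>m\<^sup>\<infinity> Sigq / t\<^sup>2 = Rq / 2\<close> and \<open>Rq = Sigq + \<epsilon>\<^sup>2 Tq\<close>, while the squared
  truncated mean costs at most a fixed proportion of \<open>Sigq\<close> up to a term of order \<open>1/t\<close>. Sufficiency is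
  conditional truncation and Chebyshev. For necessity, a corrector only rotates the conditional
  characteristic function, so \<open>\<bar>\<phi>(\<theta>/N)\<bar>\<^sup>N\<close> tends to one in mean, uniformly for \<open>\<theta>\<close> in \<open>[0,1]\<close>; averaging over
  \<open>\<theta>\<close> controls the clipped second moment of the symmetrised conditional law, and a median argument
  removes the symmetrisation.\<close>

section \<open>Convergence in probability to zero\<close>

text \<open>The obstacle in the necessity half is that the correctors are arbitrary tail measurable
  functions, so no centring is known beforehand. Moduli of conditional characteristic functions
  erase them, but see only the difference of two conditionally independent copies. Going back costs
  a term A^2/N, harmless because the level A of the conditional law is random yet does not depend on
  N; the same level pays for replacing second moments by variances. The conditional law is carried
  as a kernel rather than as separate conditional expectations, because the integral conditions need
  all real t at one fixed outcome. Powers of four enter because an exchangeable average of n terms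
  lies within order n^(-1/2), in mean square, of every longer one: along 4^j these errors are
  summable, and since only some tail measurable limit is wanted, a subsequence suffices. The claim
  on D_N / sqrt N comes from Jensen's inequality, which bounds the squared truncated mean divided by
  N by \<Sigma>_N, and from the fact that any two valid correctors differ by a quantity tending to
  zero in probability.\<close>

lemma conv_in_prob_measurable: "conv_in_prob M F X Y \<Longrightarrow> X t \<in> borel_measurable M"
  by (simp add: conv_in_prob_def)

context prob_space
begin

lemma conv_in_prob_zero_compose:
  assumes "conv_in_prob M F X (\<lambda>_. 0)" "filterlim h F G"
  shows "conv_in_prob M G (\<lambda>s. X (h s)) (\<lambda>_. 0)"
  using assms unfolding conv_in_prob_def
  by (auto intro: filterlim_compose[of _ "nhds 0" F h G])

text \<open>Measurability of \<open>Y\<close> is a separate hypothesis because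
  \<open>conv_in_prob\<close> demands it at every index, while domination is only eventual: the
  relations between the truncated quantities are available for positive levels.\<close>

lemma conv_in_prob_zero_dominated:
  assumes X: "conv_in_prob M F X (\<lambda>_. 0)" and Y: "\<And>t. Y t \<in> borel_measurable M"
    and le: "\<forall>\<^sub>F t in F. \<forall>\<omega>\<in>space M. \<bar>Y t \<omega>\<bar> \<le> \<bar>X t \<omega>\<bar>"
  shows "conv_in_prob M F Y (\<lambda>_. 0)"
  unfolding conv_in_prob_def
proof (intro conjI allI impI)
  fix \<epsilon> :: real assume "\<epsilon> > 0"
  note [measurable] = Y conv_in_prob_measurable[OF X]
  have lim: "((\<lambda>t. measure M {\<omega>\<in>space M. \<epsilon> < \<bar>X t \<omega> - 0\<bar>}) \<longlongrightarrow> 0) F"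
    using X \<open>\<epsilon> > 0\<close> unfolding conv_in_prob_def by blast
  show "((\<lambda>t. measure M {\<omega>\<in>space M. \<epsilon> < \<bar>Y t \<omega> - 0\<bar>}) \<longlongrightarrow> 0) F"
  proof (rule tendsto_sandwich[OF _ _ tendsto_const lim])
    show "\<forall>\<^sub>F t in F. measure M {\<omega>\<in>space M. \<epsilon> < \<bar>Y t \<omega> - 0\<bar>}
        \<le> measure M {\<omega>\<in>space M. \<epsilon> < \<bar>X t \<omega> - 0\<bar>}"
      using le by eventually_elim (auto intro!: finite_measure_mono)
  qed simp
qed (rule Y)

lemma conv_in_prob_zero_add:
  assumes X: "conv_in_prob M F X (\<lambda>_. 0)" and Y: "conv_in_prob M F Y (\<lambda>_. 0)"
  shows "conv_in_prob M F (\<lambda>t \<omega>. X t \<omega> + Y t \<omega>) (\<lambda>_. 0)"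
  unfolding conv_in_prob_def
proof (intro conjI allI impI)
  note [measurable] = conv_in_prob_measurable[OF Y] conv_in_prob_measurable[OF X]
  show "(\<lambda>\<omega>. X t \<omega> + Y t \<omega>) \<in> borel_measurable M" for t by measurable
  fix \<epsilon> :: real assume "\<epsilon> > 0"
  then have "\<epsilon> / 2 > 0" by simp
  then have lim: "((\<lambda>t. measure M {\<omega>\<in>space M. \<epsilon> / 2 < \<bar>X t \<omega> - 0\<bar>}
      + measure M {\<omega>\<in>space M. \<epsilon> / 2 < \<bar>Y t \<omega> - 0\<bar>}) \<longlongrightarrow> 0 + 0) F"
    using X Y unfolding conv_in_prob_def by (intro tendsto_add) blast+
  show "((\<lambda>t. measure M {\<omega>\<in>space M. \<epsilon> < \<bar>X t \<omega> + Y t \<omega> - 0\<bar>}) \<longlongrightarrow> 0) F"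
  proof (rule tendsto_sandwich[OF _ _ tendsto_const lim[simplified add_0]])
    have "measure M {\<omega>\<in>space M. \<epsilon> < \<bar>X t \<omega> + Y t \<omega> - 0\<bar>}
        \<le> measure M ({\<omega>\<in>space M. \<epsilon> / 2 < \<bar>X t \<omega> - 0\<bar>} \<union> {\<omega>\<in>space M. \<epsilon> / 2 < \<bar>Y t \<omega> - 0\<bar>})" for t
      by (rule finite_measure_mono) auto
    moreover have "measure M ({\<omega>\<in>space M. \<epsilon> / 2 < \<bar>X t \<omega> - 0\<bar>} \<union> {\<omega>\<in>space M. \<epsilon> / 2 < \<bar>Y t \<omega> - 0\<bar>})
      \<le> measure M {\<omega>\<in>space M. \<epsilon> / 2 < \<bar>X t \<omega> - 0\<bar>} + measure M {\<omega>\<in>space M. \<epsilon> / 2 < \<bar>Y t \<omega> - 0\<bar>}" for t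
      by (rule measure_Un_le) auto
    ultimately show "\<forall>\<^sub>F t in F. measure M {\<omega>\<in>space M. \<epsilon> < \<bar>X t \<omega> + Y t \<omega> - 0\<bar>}
        \<le> measure M {\<omega>\<in>space M. \<epsilon> / 2 < \<bar>X t \<omega> - 0\<bar>} + measure M {\<omega>\<in>space M. \<epsilon> / 2 < \<bar>Y t \<omega> - 0\<bar>}"
      by (intro always_eventually allI) (rule order_trans)
  qed simp
qed

lemma conv_in_prob_zero_cmult:
  assumes X: "conv_in_prob M F X (\<lambda>_. 0)"
  shows "conv_in_prob M F (\<lambda>t \<omega>. c * X t \<omega>) (\<lambda>_. 0)"
proof (cases "c = 0")
  case True
  then show ?thesis by (simp add: conv_in_prob_def)
next
  case False
  show ?thesis unfolding conv_in_prob_def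
  proof (intro conjI allI impI)
    note [measurable] = conv_in_prob_measurable[OF X]
    show "(\<lambda>\<omega>. c * X t \<omega>) \<in> borel_measurable M" for t by measurable
    fix \<epsilon> :: real assume "\<epsilon> > 0"
    then have "((\<lambda>t. measure M {\<omega>\<in>space M. \<epsilon> / \<bar>c\<bar> < \<bar>X t \<omega> - 0\<bar>}) \<longlongrightarrow> 0) F"
      using X False unfolding conv_in_prob_def by simp
    then show "((\<lambda>t. measure M {\<omega>\<in>space M. \<epsilon> < \<bar>c * X t \<omega> - 0\<bar>}) \<longlongrightarrow> 0) F"
      using False by (simp add: abs_mult divide_less_eq mult.commute)
  qed
qed

text \<open>Dominated convergence applied to the indicators of the deviation events. It serves for a
  fixed random variable divided by \<open>t\<close>, where no moment is available.\<close>

lemma conv_in_prob_zero_pointwise: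
  fixes X :: "real \<Rightarrow> 'a \<Rightarrow> real"
  assumes [measurable]: "\<And>t. X t \<in> borel_measurable M"
    and lim: "\<And>\<omega>. \<omega> \<in> space M \<Longrightarrow> ((\<lambda>t. X t \<omega>) \<longlongrightarrow> 0) at_top"
  shows "conv_in_prob M at_top X (\<lambda>_. 0)"
  unfolding conv_in_prob_def
proof (intro conjI allI impI)
  fix \<epsilon> :: real assume "\<epsilon> > 0"
  let ?A = "\<lambda>t. {\<omega>\<in>space M. \<epsilon> < \<bar>X t \<omega> - 0\<bar>}"
  have "((\<lambda>t. \<integral>\<omega>. indicator (?A t) \<omega> \<partial>M) \<longlongrightarrow> (\<integral>\<omega>. (0::real) \<partial>M)) at_top"
  proof (rule integral_dominated_convergence_at_top[where w = "\<lambda>_. 1"])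
    show "AE \<omega> in M. ((\<lambda>t. indicator (?A t) \<omega> :: real) \<longlongrightarrow> 0) at_top"
    proof (rule AE_I2)
      fix \<omega> assume "\<omega> \<in> space M"
      have "\<forall>\<^sub>F t in at_top. \<bar>X t \<omega>\<bar> < \<epsilon>"
        using order_tendstoD(2)[OF tendsto_rabs_zero[OF lim[OF \<open>\<omega> \<in> space M\<close>]] \<open>\<epsilon> > 0\<close>] .
      then have "\<forall>\<^sub>F t in at_top. indicator (?A t) \<omega> = (0::real)"
        by eventually_elim (simp add: indicator_def)
      then show "((\<lambda>t. indicator (?A t) \<omega> :: real) \<longlongrightarrow> 0) at_top"
        by (rule tendsto_eventually)
    qed
  qed (auto intro!: always_eventually)
  then show "((\<lambda>t. measure M (?A t)) \<longlongrightarrow> 0) at_top" by (simp add: Int_absorb2)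
qed fact

text \<open>Markov's inequality. Nonnegativity is asked almost everywhere only, since it is applied
  to versions of conditional probabilities.\<close>

lemma conv_in_prob_zero_expectation:
  fixes X :: "'i \<Rightarrow> 'a \<Rightarrow> real"
  assumes int: "\<And>t. integrable M (X t)" and nonneg: "\<And>t. AE \<omega> in M. 0 \<le> X t \<omega>"
    and lim: "((\<lambda>t. expectation (X t)) \<longlongrightarrow> 0) F"
  shows "conv_in_prob M F X (\<lambda>_. 0)"
  unfolding conv_in_prob_def
proof (intro conjI allI impI)
  show [measurable]: "X t \<in> borel_measurable M" for t using int by auto
  fix \<epsilon> :: real assume "\<epsilon> > 0"
  have "((\<lambda>t. expectation (X t) / \<epsilon>) \<longlongrightarrow> 0 / \<epsilon>) F"
    by (intro tendsto_divide lim tendsto_const) (use \<open>\<epsilon> > 0\<close> in auto)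
  then have lim': "((\<lambda>t. expectation (X t) / \<epsilon>) \<longlongrightarrow> 0) F" by simp
  have "measure M {\<omega>\<in>space M. \<epsilon> < \<bar>X t \<omega> - 0\<bar>} \<le> expectation (X t) / \<epsilon>" for t
  proof -
    have "measure M {\<omega>\<in>space M. \<epsilon> < \<bar>X t \<omega> - 0\<bar>} \<le> measure M {\<omega>\<in>space M. \<epsilon> \<le> X t \<omega>}"
      using nonneg[of t] by (intro finite_measure_mono_AE) auto
    also have "\<dots> \<le> expectation (X t) / \<epsilon>"
      by (rule integral_Markov_inequality_measure[OF int _ nonneg \<open>\<epsilon> > 0\<close>, where A = "{}"]) simp
    finally show ?thesis .
  qed
  then show "((\<lambda>t. measure M {\<omega>\<in>space M. \<epsilon> < \<bar>X t \<omega> - 0\<bar>}) \<longlongrightarrow> 0) F"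
    by (intro tendsto_sandwich[OF _ _ tendsto_const lim']) auto
qed

text \<open>Split at \<open>e / 2\<close>: below it the integrand contributes at most
  \<open>e / 2\<close>, above it the bound 1 turns the contribution into a probability.\<close>

lemma expectation_tendsto_zero_if_conv_in_prob:
  fixes X :: "'i \<Rightarrow> 'a \<Rightarrow> real"
  assumes X: "conv_in_prob M F X (\<lambda>_. 0)" and bnd: "\<And>t. AE \<omega> in M. \<bar>X t \<omega>\<bar> \<le> 1"
  shows "((\<lambda>t. expectation (X t)) \<longlongrightarrow> 0) F"
proof (rule tendstoI)
  fix e :: real assume "e > 0"
  note [measurable] = conv_in_prob_measurable[OF X]
  have int: "integrable M (X t)" for t
    by (rule integrable_const_bound[of _ 1]) (use bnd in auto)
  have "((\<lambda>t. measure M {\<omega>\<in>space M. e / 2 < \<bar>X t \<omega> - 0\<bar>}) \<longlongrightarrow> 0) F"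
    using X half_gt_zero[OF \<open>e > 0\<close>] unfolding conv_in_prob_def by blast
  then have "\<forall>\<^sub>F t in F. measure M {\<omega>\<in>space M. e / 2 < \<bar>X t \<omega> - 0\<bar>} < e / 2"
    using \<open>e > 0\<close> by (intro order_tendstoD) auto
  then show "\<forall>\<^sub>F t in F. dist (expectation (X t)) 0 < e"
  proof eventually_elim
    fix t
    let ?A = "{\<omega>\<in>space M. e / 2 < \<bar>X t \<omega> - 0\<bar>}"
    assume *: "measure M ?A < e / 2"
    have int_A: "integrable M (indicator ?A :: _ \<Rightarrow> real)"
      by (intro integrable_real_indicator) (measurable, simp add: emeasure_eq_measure)
    have "\<bar>expectation (X t)\<bar> \<le> expectation (\<lambda>\<omega>. \<bar>X t \<omega>\<bar>)"
      by (rule integral_abs_bound)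
    also have "\<dots> \<le> expectation (\<lambda>\<omega>. e / 2 + indicator ?A \<omega>)"
    proof (rule integral_mono_AE)
      show "AE \<omega> in M. \<bar>X t \<omega>\<bar> \<le> e / 2 + indicator ?A \<omega>"
        using bnd[of t] AE_space by eventually_elim (use \<open>e > 0\<close> in \<open>auto simp: indicator_def\<close>)
      show "integrable M (\<lambda>\<omega>. e / 2 + indicator ?A \<omega>)"
        using int_A by simp
    qed (use int in auto)
    also have "\<dots> = e / 2 + measure M ?A"
      using int_A by (subst Bochner_Integration.integral_add) (auto simp: prob_space Int_absorb2)
    finally show "dist (expectation (X t)) 0 < e" using * by simp
  qed
qed

end

section \<open>Exchangeability and the tail \<open>\<sigma>\<close>-algebra\<close>

text \<open>Pushing \<open>L x\<close> forward along \<open>y\<close> to \<open>(x, y)\<close> moves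
  the dependence on \<open>x\<close> from the integrand into the measure; the result is a kernel on
  the product, against which a single fixed function is integrated.\<close>

lemma lebesgue_integral_measurable_subprob_algebra2:
  fixes f :: "'a \<Rightarrow> 'b \<Rightarrow> 'c :: {banach, second_countable_topology}"
  assumes f[measurable]: "(\<lambda>(x, y). f x y) \<in> borel_measurable (M \<Otimes>\<^sub>M N)"
  assumes N[measurable]: "L \<in> measurable M (subprob_algebra N)"
  shows "(\<lambda>x. integral\<^sup>L (L x) (f x)) \<in> borel_measurable M"
proof -
  note integral_measurable_subprob_algebra[measurable]
  note measurable_distr2[measurable]
  have "(\<lambda>x. integral\<^sup>L (distr (L x) (M \<Otimes>\<^sub>M N) (\<lambda>y. (x, y))) (\<lambda>(x, y). f x y)) \<in> borel_measurable M"
    by measurable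
  then show "(\<lambda>x. integral\<^sup>L (L x) (f x)) \<in> borel_measurable M"
  proof (rule measurable_cong[THEN iffD1, rotated])
    fix x assume x: "x \<in> space M"
    have "(\<lambda>y. (x, y)) \<in> measurable (L x) (M \<Otimes>\<^sub>M N)"
      using measurable_Pair1'[OF x, of N] by (simp add: measurable_cong_sets[OF sets_kernel[OF N x] refl])
    then show "integral\<^sup>L (distr (L x) (M \<Otimes>\<^sub>M N) (\<lambda>y. (x, y))) (\<lambda>(x, y). f x y) = integral\<^sup>L (L x) (f x)"
      by (subst integral_distr[OF _ f]) simp_all
  qed
qed

section \<open>Sigma-algebras generated by sets of indices\<close>

definition generated_by :: "'a measure \<Rightarrow> (nat \<Rightarrow> 'a \<Rightarrow> real) \<Rightarrow> nat set \<Rightarrow> 'a measure" where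
  "generated_by M g I = sigma (space M) (\<Union>i\<in>I. {g i -` B \<inter> space M | B. B \<in> sets borel})"

text \<open>This contains both the tail and \<open>g 0, \<dots>, g (k - 1)\<close>. Being an intersection, it lies, for every \<open>m \<ge> k\<close>,
  in the \<open>\<sigma>\<close>-algebra generated by indices other than \<open>k, \<dots>, m\<close>, so these may be exchanged.\<close>

definition tail_after :: "'a measure \<Rightarrow> (nat \<Rightarrow> 'a \<Rightarrow> real) \<Rightarrow> nat \<Rightarrow> 'a measure" where
  "tail_after M g k = sigma (space M) (\<Inter>m. sets (generated_by M g ({..<k} \<union> {m..})))"

lemma space_generated_by [simp]: "space (generated_by M g I) = space M"
  by (simp add: generated_by_def space_measure_of_conv)

lemma generators_subset_Pow: "(\<Union>i\<in>I. {g i -` B \<inter> space M | B. B \<in> sets borel}) \<subseteq> Pow (space M)"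
  by auto

lemma sets_generated_by:
  "sets (generated_by M g I) = sigma_sets (space M) (\<Union>i\<in>I. {g i -` B \<inter> space M | B. B \<in> sets borel})"
  unfolding generated_by_def by (rule sets_measure_of[OF generators_subset_Pow])

lemma sets_generated_by_mono: "I \<subseteq> J \<Longrightarrow> sets (generated_by M g I) \<subseteq> sets (generated_by M g J)"
  unfolding sets_generated_by by (rule sigma_sets_mono'[OF UN_mono[OF _ order_refl]])

lemma measurable_generated_by:
  assumes "i \<in> I"
  shows "g i \<in> borel_measurable (generated_by M g I)"
proof (rule measurableI)
  fix B :: "real set" assume "B \<in> sets borel"
  then have "g i -` B \<inter> space M \<in> (\<Union>i\<in>I. {g i -` B \<inter> space M | B. B \<in> sets borel})"
    using assms by (intro UN_I CollectI exI conjI) (assumption, rule refl, assumption)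
  then show "g i -` B \<inter> space (generated_by M g I) \<in> sets (generated_by M g I)"
    unfolding space_generated_by sets_generated_by by (rule sigma_sets.Basic)
qed simp

lemma space_tail_after [simp]: "space (tail_after M g k) = space M"
  by (simp add: tail_after_def space_measure_of_conv)

text \<open>An intersection of sigma-algebras is one already, so the \<open>sigma\<close> in the
  definition adds nothing and membership can be tested for each \<open>m\<close> separately.\<close>

lemma sets_tail_after: "sets (tail_after M g k) = (\<Inter>m. sets (generated_by M g ({..<k} \<union> {m..})))"
proof -
  let ?C = "\<Inter>m. sets (generated_by M g ({..<k} \<union> {m..}))"
  have Pow: "?C \<subseteq> Pow (space M)"
  proof
    fix A assume "A \<in> ?C"
    then have "A \<in> sets (generated_by M g ({..<k} \<union> {0..}))" by (rule INT_D) simp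
    then show "A \<in> Pow (space M)" using sets.sets_into_space by fastforce
  qed
  have "sigma_algebra (space M) ?C"
    unfolding sigma_algebra_iff2
  proof (intro conjI ballI allI impI INT_I)
    fix A m assume "A \<in> ?C"
    then have "A \<in> sets (generated_by M g ({..<k} \<union> {m..}))" by blast
    from sets.compl_sets[OF this] show "space M - A \<in> sets (generated_by M g ({..<k} \<union> {m..}))" by simp
  next
    fix A :: "nat \<Rightarrow> 'a set" and m assume "range A \<subseteq> ?C"
    then have "range A \<subseteq> sets (generated_by M g ({..<k} \<union> {m..}))" by blast
    then show "\<Union> (range A) \<in> sets (generated_by M g ({..<k} \<union> {m..}))" by auto
  qed (use Pow in auto)
  then have "sigma_sets (space M) ?C = ?C" by (rule sigma_algebra.sigma_sets_eq)
  with Pow show ?thesis by (simp add: tail_after_def)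
qed

lemma tail_after_0: "tail_after M g 0 = tail_sigma M g"
  by (simp add: tail_after_def tail_sigma_def sets_generated_by)

lemma sets_tail_after_mono: "k \<le> l \<Longrightarrow> sets (tail_after M g k) \<subseteq> sets (tail_after M g l)"
proof -
  assume "k \<le> l"
  then have "sets (generated_by M g ({..<k} \<union> {m..})) \<subseteq> sets (generated_by M g ({..<l} \<union> {m..}))" for m
    by (intro sets_generated_by_mono) auto
  then show ?thesis unfolding sets_tail_after by blast
qed

lemma measurable_tail_after: "i < k \<Longrightarrow> g i \<in> borel_measurable (tail_after M g k)"
proof (rule measurableI)
  fix B :: "real set" assume "i < k" "B \<in> sets borel"
  then have "g i -` B \<inter> space M \<in> sets (generated_by M g ({..<k} \<union> {m..}))" for m
    using measurable_sets[OF measurable_generated_by[of i "{..<k} \<union> {m..}" g M]] by simp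
  then show "g i -` B \<inter> space (tail_after M g k) \<in> sets (tail_after M g k)"
    by (simp add: sets_tail_after)
qed simp

section \<open>Exchanging two indices\<close>

locale exchangeable_sequence = prob_space M for M :: "'a measure" +
  fixes g :: "nat \<Rightarrow> 'a \<Rightarrow> real"
  assumes g_measurable [measurable]: "\<And>n. g n \<in> borel_measurable M"
    and exchangeable: "exchangeable M g"
begin

lemma subalgebra_generated_by: "subalgebra M (generated_by M g I)"
proof -
  have "(\<Union>i\<in>I. {g i -` B \<inter> space M | B. B \<in> sets borel}) \<subseteq> sets M" by auto
  then show ?thesis
    unfolding subalgebra_def sets_generated_by by (simp add: sets.sigma_sets_subset)
qed

lemma subalgebra_tail_after: "subalgebra M (tail_after M g k)"
proof -
  have "sets (tail_after M g k) \<subseteq> sets (generated_by M g ({..<k} \<union> {0..}))"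
    unfolding sets_tail_after by (rule INT_lower) simp
  also have "\<dots> \<subseteq> sets M" using subalgebra_generated_by by (simp add: subalgebra_def)
  finally show ?thesis by (simp add: subalgebra_def)
qed

lemma tail_after_measurable_imp: "X \<in> measurable (tail_after M g k) N \<Longrightarrow> X \<in> measurable M N"
  by (rule measurable_from_subalg[OF subalgebra_tail_after])

text \<open>Exchangeability speaks of finite initial blocks. Finite-dimensional cylinders determine
  a law on the infinite product, and a block containing \<open>J\<close>, \<open>k\<close> and
  \<open>m\<close> turns the transposition into a permutation of that block.\<close>

lemma distr_transpose:
  fixes k m :: nat
  defines "p \<equiv> Transposition.transpose k m"
  shows "distr M (PiM UNIV (\<lambda>_. borel)) (\<lambda>\<omega> i. g (p i) \<omega>) = distr M (PiM UNIV (\<lambda>_. borel)) (\<lambda>\<omega> i. g i \<omega>)"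
proof (rule measure_eqI_PiM_infinite)
  fix A :: "nat \<Rightarrow> real set" and J assume J: "finite J" "J \<subseteq> UNIV" and "\<And>i. i \<in> J \<Longrightarrow> A i \<in> sets borel"
  then have A[measurable]: "\<And>i. i \<in> J \<Longrightarrow> A i \<in> sets borel" by auto
  have [measurable]: "J \<in> sets (count_space UNIV)" by simp
  obtain n where n: "J \<union> {k, m} \<subseteq> {..<n}"
    using J finite_nat_set_iff_bounded[of "J \<union> {k, m}"] by auto
  have p: "p permutes {..<n}" unfolding p_def by (rule permutes_swap_id) (use n in auto)
  let ?B = "Pi\<^sub>E {..<n} (\<lambda>i. if i \<in> J then A i else UNIV)"
  have B: "?B \<in> sets (PiM {..<n} (\<lambda>_. borel))"
    by (rule sets_PiM_I_finite) auto
  have eq: "emeasure (distr M (PiM UNIV (\<lambda>_. borel)) (\<lambda>\<omega> i. g (q i) \<omega>)) (prod_emb UNIV (\<lambda>_. borel) J (Pi\<^sub>E J A))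
    = emeasure (distr M (PiM {..<n} (\<lambda>_. borel)) (\<lambda>\<omega>. \<lambda>i\<in>{..<n}. g (q i) \<omega>)) ?B" for q :: "nat \<Rightarrow> nat"
  proof -
    have "(\<lambda>\<omega>. \<lambda>i\<in>{..<n}. g (q i) \<omega>) \<in> measurable M (PiM {..<n} (\<lambda>_. borel))" by measurable
    moreover have "(\<lambda>\<omega> i. g (q i) \<omega>) \<in> measurable M (PiM UNIV (\<lambda>_. borel))"
      by (rule measurable_PiM_single') auto
    moreover have "prod_emb UNIV (\<lambda>_. borel) J (Pi\<^sub>E J A) \<in> sets (PiM UNIV (\<lambda>_. borel))"
      using J by (intro sets_PiM_I) auto
    ultimately show ?thesis using B n
      by (subst (1 2) emeasure_distr) (auto simp: prod_emb_def PiE_iff subset_iff split: if_splits intro!: arg_cong[where f = "emeasure M"])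
  qed
  show "emeasure (distr M (PiM UNIV (\<lambda>_. borel)) (\<lambda>\<omega> i. g (p i) \<omega>)) (prod_emb UNIV (\<lambda>_. borel) J (Pi\<^sub>E J A))
    = emeasure (distr M (PiM UNIV (\<lambda>_. borel)) (\<lambda>\<omega> i. g i \<omega>)) (prod_emb UNIV (\<lambda>_. borel) J (Pi\<^sub>E J A))"
    unfolding eq[of p] eq[of "\<lambda>i. i"]
    by (rule arg_cong[where f = "\<lambda>N. emeasure N ?B"]) (use exchangeable p in \<open>simp add: exchangeable_def\<close>)
next
  show "finite_measure (distr M (PiM UNIV (\<lambda>_. borel)) (\<lambda>\<omega> i. g (p i) \<omega>))"
    by (intro finite_measure_distr measurable_PiM_single') auto
qed simp_all

text \<open>The transposition of \<open>k\<close> and \<open>m\<close> fixes every index in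
  \<open>I\<close>, so an event generated by \<open>I\<close> is described by the same set of
  sequences before and after it; invariance of the law then moves \<open>C\<close> from coordinate
  \<open>k\<close> to coordinate \<open>m\<close>.\<close>

lemma prob_generated_by_exchange:
  assumes A: "A \<in> sets (generated_by M g I)" and km: "k \<notin> I" "m \<notin> I" and C[measurable]: "C \<in> sets borel"
  shows "prob (A \<inter> (g k -` C \<inter> space M)) = prob (A \<inter> (g m -` C \<inter> space M))"
proof -
  define p where "p = Transposition.transpose k m"
  have p: "p i = i" if "i \<in> I" for i using that km by (metis p_def transpose_apply_other)
  let ?P = "PiM UNIV (\<lambda>_::nat. borel :: real measure)"
  have meas: "(\<lambda>\<omega> i. g (q i) \<omega>) \<in> measurable M ?P" for q :: "nat \<Rightarrow> nat"
    by (rule measurable_PiM_single') auto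
  have "A \<in> sigma_sets (space M) (\<Union>i\<in>I. {g i -` B \<inter> space M | B. B \<in> sets borel})"
    using A by (simp add: sets_generated_by)
  \<comment> \<open>One and the same \<open>B\<close> has to describe \<open>A\<close> for both
    sequences, so both equations are carried through the induction over the generated
    sigma-algebra.\<close>
  then have "\<exists>B\<in>sets ?P. A = {\<omega>\<in>space M. (\<lambda>i. g i \<omega>) \<in> B} \<and> A = {\<omega>\<in>space M. (\<lambda>i. g (p i) \<omega>) \<in> B}"
  proof induction
    case (Basic a)
    then obtain i B where "i \<in> I" "B \<in> sets borel" "a = g i -` B \<inter> space M" by auto
    moreover from \<open>B \<in> sets borel\<close> have "{x \<in> space ?P. x i \<in> B} \<in> sets ?P" by measurable
    ultimately show ?case
      by (intro bexI[of _ "{x \<in> space ?P. x i \<in> B}"]) (auto simp: p space_PiM)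
  next
    case Empty
    then show ?case by (intro bexI[of _ "{}"]) auto
  next
    case (Compl a)
    from Compl.IH obtain B where B: "B\<in>sets ?P" and a: "a = {\<omega>\<in>space M. (\<lambda>i. g i \<omega>) \<in> B}" "a = {\<omega>\<in>space M. (\<lambda>i. g (p i) \<omega>) \<in> B}"
      by blast
    show ?case
    proof (intro bexI[of _ "space ?P - B"] conjI)
      show "space M - a = {\<omega>\<in>space M. (\<lambda>i. g i \<omega>) \<in> space ?P - B}" by (subst a(1)) (auto simp: space_PiM)
      show "space M - a = {\<omega>\<in>space M. (\<lambda>i. g (p i) \<omega>) \<in> space ?P - B}" by (subst a(2)) (auto simp: space_PiM)
    qed (use B in \<open>rule sets.compl_sets\<close>)
  next
    case (Union a)
    have "\<forall>i. \<exists>B. B \<in> sets ?P \<and> a i = {\<omega>\<in>space M. (\<lambda>i. g i \<omega>) \<in> B} \<and> a i = {\<omega>\<in>space M. (\<lambda>i. g (p i) \<omega>) \<in> B}"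
      using Union.IH unfolding Bex_def by (rule allI)
    from choice[OF this] obtain B where B: "\<And>i. B i \<in> sets ?P" "\<And>i. a i = {\<omega>\<in>space M. (\<lambda>i. g i \<omega>) \<in> B i}"
      "\<And>i. a i = {\<omega>\<in>space M. (\<lambda>i. g (p i) \<omega>) \<in> B i}"
      by blast
    show ?case
    proof (intro bexI[of _ "\<Union>i. B i"] conjI)
      show "(\<Union>i. a i) = {\<omega>\<in>space M. (\<lambda>i. g i \<omega>) \<in> (\<Union>i. B i)}" unfolding B(2) by blast
      show "(\<Union>i. a i) = {\<omega>\<in>space M. (\<lambda>i. g (p i) \<omega>) \<in> (\<Union>i. B i)}" unfolding B(3) by blast
    qed (use B(1) in auto)
  qed
  then obtain B where B: "B \<in> sets ?P" "A = {\<omega>\<in>space M. (\<lambda>i. g i \<omega>) \<in> B}" "A = {\<omega>\<in>space M. (\<lambda>i. g (p i) \<omega>) \<in> B}"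
    by auto
  let ?D = "B \<inter> {x \<in> space ?P. x k \<in> C}"
  have D: "?D \<in> sets ?P" using B(1) by measurable
  have "prob (A \<inter> (g k -` C \<inter> space M)) = measure (distr M ?P (\<lambda>\<omega> i. g i \<omega>)) ?D"
    using meas[of "\<lambda>i. i"] D by (subst measure_distr) (auto simp: B(2) space_PiM intro!: arg_cong[where f = prob])
  also have "\<dots> = measure (distr M ?P (\<lambda>\<omega> i. g (p i) \<omega>)) ?D"
    unfolding p_def distr_transpose ..
  also have "\<dots> = prob (A \<inter> (g m -` C \<inter> space M))"
    using meas[of p] D by (subst measure_distr) (auto simp: B(3) space_PiM p_def intro!: arg_cong[where f = prob])
  finally show ?thesis .
qed

text \<open>Equal integrals over every set of the generated sigma-algebra make the conditional
  expectations of \<open>f (g k)\<close> and \<open>f (g m)\<close> agree almost everywhere; a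
  bounded weight \<open>Z\<close> can then be multiplied in.\<close>

lemma expectation_generated_by_exchange:
  fixes f :: "real \<Rightarrow> real"
  assumes Z: "Z \<in> borel_measurable (generated_by M g I)" "\<And>\<omega>. \<omega> \<in> space M \<Longrightarrow> \<bar>Z \<omega>\<bar> \<le> B"
    and km: "k \<notin> I" "m \<notin> I"
    and f[measurable]: "f \<in> borel_measurable borel" and fB: "\<And>x. \<bar>f x\<bar> \<le> C"
  shows "expectation (\<lambda>\<omega>. Z \<omega> * f (g k \<omega>)) = expectation (\<lambda>\<omega>. Z \<omega> * f (g m \<omega>))"
proof -
  let ?G = "generated_by M g I"
  interpret finite_measure_subalgebra M ?G
    by standard (rule subalgebra_generated_by)
  have [measurable]: "Z \<in> borel_measurable M" by (rule measurable_from_subalg[OF subalg Z(1)])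
  have int: "integrable M (\<lambda>\<omega>. f (g i \<omega>))" for i
    by (rule integrable_const_bound[of _ C]) (use fB in auto)
  have intZ: "integrable M (\<lambda>\<omega>. Z \<omega> * f (g i \<omega>))" for i
  proof (rule integrable_const_bound[of _ "B * C"])
    have "\<bar>Z \<omega>\<bar> * \<bar>f (g i \<omega>)\<bar> \<le> B * C" if "\<omega> \<in> space M" for \<omega>
      using Z(2)[OF that] fB[of "g i \<omega>"] by (intro mult_mono) auto
    then show "AE \<omega> in M. norm (Z \<omega> * f (g i \<omega>)) \<le> B * C" by (simp add: abs_mult)
  qed measurable
  have set_eq: "(\<integral>\<omega>\<in>A. f (g k \<omega>) \<partial>M) = (\<integral>\<omega>\<in>A. f (g m \<omega>) \<partial>M)" if A: "A \<in> sets ?G" for A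
  proof -
    have [measurable]: "A \<in> sets M" using A subalg by (auto simp: subalgebra_def)
    \<comment> \<open>The law of \<open>g i\<close> under \<open>M\<close> restricted to
      \<open>A\<close>; equality of these measures for \<open>k\<close> and \<open>m\<close>
      transfers the exchange from sets to the function \<open>f\<close>.\<close>
    let ?N = "\<lambda>i. distr (density M (indicator A)) borel (g i)"
    have "?N k = ?N m"
    proof (rule measure_eqI)
      fix C :: "real set" assume "C \<in> sets (?N k)"
      then have [measurable]: "C \<in> sets borel" by simp
      have "emeasure (?N i) C = prob (A \<inter> (g i -` C \<inter> space M))" for i
      proof -
        have "emeasure (?N i) C = emeasure (density M (indicator A)) (g i -` C \<inter> space M)"
          by (subst emeasure_distr) auto
        also have "\<dots> = (\<integral>\<^sup>+x. indicator (A \<inter> (g i -` C \<inter> space M)) x \<partial>M)"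
          by (subst emeasure_density) (simp_all add: indicator_inter_arith[abs_def] del: nn_integral_indicator)
        also have "\<dots> = emeasure M (A \<inter> (g i -` C \<inter> space M))"
          by (rule nn_integral_indicator) measurable
        finally show ?thesis by (simp add: emeasure_eq_measure)
      qed
      then show "emeasure (?N k) C = emeasure (?N m) C"
        using prob_generated_by_exchange[OF A km \<open>C \<in> sets borel\<close>] by simp
    qed simp
    moreover have "(\<integral>\<omega>\<in>A. f (g i \<omega>) \<partial>M) = (\<integral>x. f x \<partial>?N i)" for i
    proof -
      have "(\<integral>x. f x \<partial>?N i) = (\<integral>\<omega>. f (g i \<omega>) \<partial>density M (\<lambda>x. ennreal (indicator A x)))"
        by (subst integral_distr) (auto simp: ennreal_indicator)
      also have "\<dots> = (\<integral>\<omega>\<in>A. f (g i \<omega>) \<partial>M)"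
        unfolding set_lebesgue_integral_def by (subst integral_density) auto
      finally show ?thesis ..
    qed
    ultimately show ?thesis by simp
  qed
  have "AE \<omega> in M. real_cond_exp M ?G (\<lambda>\<omega>. f (g k \<omega>)) \<omega> = real_cond_exp M ?G (\<lambda>\<omega>. f (g m \<omega>)) \<omega>"
  proof (rule real_cond_exp_charact)
    fix A assume "A \<in> sets ?G"
    then show "(\<integral>\<omega>\<in>A. f (g k \<omega>) \<partial>M) = (\<integral>\<omega>\<in>A. real_cond_exp M ?G (\<lambda>\<omega>. f (g m \<omega>)) \<omega> \<partial>M)"
      using real_cond_exp_intA[OF int[of m]] set_eq by simp
  qed (use int in auto)
  then have "expectation (\<lambda>\<omega>. Z \<omega> * real_cond_exp M ?G (\<lambda>\<omega>. f (g k \<omega>)) \<omega>)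
      = expectation (\<lambda>\<omega>. Z \<omega> * real_cond_exp M ?G (\<lambda>\<omega>. f (g m \<omega>)) \<omega>)"
    by (intro integral_cong_AE) (auto intro: borel_measurable_times)
  then show ?thesis
    using real_cond_exp_intg(2)[OF intZ[of k] Z(1)] real_cond_exp_intg(2)[OF intZ[of m] Z(1)] by simp
qed

end

section \<open>Conditional independence given the tail\<close>

text \<open>The second part holds without convergence, since \<open>lim\<close> depends only on
  which values are limits. It makes the later limit of averages shift invariant at every point,
  hence measurable for the tail itself and not merely up to null sets.\<close>

lemma lim_transform_eq:
  fixes X Y :: "nat \<Rightarrow> 'a :: real_normed_vector"
  assumes "(\<lambda>n. X n - Y n) \<longlonglongrightarrow> 0"
  shows "X \<longlonglongrightarrow> L \<longleftrightarrow> Y \<longlonglongrightarrow> L" "lim X = lim Y"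
proof -
  have *: "X \<longlonglongrightarrow> L \<longleftrightarrow> Y \<longlonglongrightarrow> L" for L
    using Lim_transform[OF _ assms, of L] Lim_transform2[OF _ assms, of L] by blast
  then show "X \<longlonglongrightarrow> L \<longleftrightarrow> Y \<longlonglongrightarrow> L" .
  from * show "lim X = lim Y" by (simp add: lim_def)
qed

text \<open>Each unit shift changes the sum by two boundary terms only.\<close>

lemma abs_sum_shift_diff_le:
  fixes y :: "nat \<Rightarrow> real"
  assumes "\<And>i. \<bar>y i\<bar> \<le> C"
  shows "\<bar>(\<Sum>i<n. y (k + i)) - (\<Sum>i<n. y i)\<bar> \<le> 2 * real k * C"
proof (induction k)
  case (Suc k)
  have "(\<Sum>i<n. y (Suc k + i)) - (\<Sum>i<n. y (k + i)) = (\<Sum>i<n. y (k + Suc i) - y (k + i))"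
    by (simp add: sum_subtractf)
  also have "\<dots> = y (k + n) - y k"
    using sum_lessThan_telescope[of "\<lambda>i. y (k + i)" n] by simp
  finally have "\<bar>(\<Sum>i<n. y (Suc k + i)) - (\<Sum>i<n. y (k + i))\<bar> \<le> 2 * C"
    using assms[of "k + n"] assms[of k] by linarith
  with Suc show ?case by (simp add: algebra_simps)
qed simp

section \<open>Averages along powers of four and their tail measurable limit\<close>

context exchangeable_sequence
begin

context
  fixes f :: "real \<Rightarrow> real" and C :: real
  assumes f_measurable [measurable]: "f \<in> borel_measurable borel" and f_bounded: "\<And>x. \<bar>f x\<bar> \<le> C"
begin

lemma abs_mult_bounded: "\<bar>f x * f y\<bar> \<le> C * C"
  unfolding abs_mult using f_bounded[of x] f_bounded[of y] by (intro mult_mono) auto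

lemma integrable_bounded_mult: "integrable M (\<lambda>\<omega>. f (g i \<omega>) * f (g j \<omega>))"
  by (rule integrable_const_bound[of _ "C * C"]) (simp_all add: abs_mult_bounded)

lemma expectation_mult_eq:
  "expectation (\<lambda>\<omega>. f (g i \<omega>) * f (g j \<omega>)) =
    expectation (\<lambda>\<omega>. f (g 0 \<omega>) * f (g 1 \<omega>)) + (if i = j then
      expectation (\<lambda>\<omega>. f (g 0 \<omega>) * f (g 0 \<omega>)) - expectation (\<lambda>\<omega>. f (g 0 \<omega>) * f (g 1 \<omega>)) else 0)"
proof (cases "i = j")
  case True
  have "expectation (\<lambda>\<omega>. 1 * (\<lambda>x. f x * f x) (g i \<omega>)) = expectation (\<lambda>\<omega>. 1 * (\<lambda>x. f x * f x) (g 0 \<omega>))"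
    by (rule expectation_generated_by_exchange[where I = "{}" and B = 1 and C = "C * C"])
       (simp_all only: abs_mult_bounded, simp_all)
  then show ?thesis using True by simp
next
  case False
  let ?b = "\<lambda>i j. expectation (\<lambda>\<omega>. f (g i \<omega>) * f (g j \<omega>))"
  have b: "?b i j = ?b i l" if "j \<noteq> i" "l \<noteq> i" for i j l
    using that f_bounded measurable_generated_by[of i "{i}" g M]
    by (intro expectation_generated_by_exchange[where I = "{i}" and B = C and C = C]
      measurable_compose[OF _ f_measurable]) auto
  have sym: "?b i j = ?b j i" for i j by (simp add: mult.commute)
  \<comment> \<open>Exchange moves one index while the other is held fixed. The auxiliary
    \<open>l\<close> differs from both \<open>i\<close> and \<open>0\<close>, so no intermediate
    pair falls onto the diagonal.\<close>
  define l where "l = i + j + 2"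
  have "?b i j = ?b i l" using False by (intro b) (auto simp: l_def)
  also have "\<dots> = ?b l i" by (rule sym)
  also have "\<dots> = ?b l 0" by (rule b) (auto simp: l_def)
  also have "\<dots> = ?b 0 l" by (rule sym)
  also have "\<dots> = ?b 0 1" by (rule b) (auto simp: l_def)
  finally show ?thesis using False by simp
qed

text \<open>The quadratic form of a matrix with \<open>a\<close> on the diagonal and
  \<open>b\<close> off it; its first term disappears for weights summing to zero.\<close>

lemma expectation_square_linear_combination:
  defines "a \<equiv> expectation (\<lambda>\<omega>. f (g 0 \<omega>) * f (g 0 \<omega>))"
    and "b \<equiv> expectation (\<lambda>\<omega>. f (g 0 \<omega>) * f (g 1 \<omega>))"
  shows "expectation (\<lambda>\<omega>. (\<Sum>i<N. c i * f (g i \<omega>))\<^sup>2) = b * (\<Sum>i<N. c i)\<^sup>2 + (a - b) * (\<Sum>i<N. (c i)\<^sup>2)"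
proof -
  have "(\<Sum>i<N. c i * f (g i \<omega>))\<^sup>2 = (\<Sum>i<N. \<Sum>j<N. c i * c j * (f (g i \<omega>) * f (g j \<omega>)))" for \<omega>
    by (simp add: power2_eq_square sum_product algebra_simps)
  then have "expectation (\<lambda>\<omega>. (\<Sum>i<N. c i * f (g i \<omega>))\<^sup>2)
      = (\<Sum>i<N. \<Sum>j<N. c i * c j * expectation (\<lambda>\<omega>. f (g i \<omega>) * f (g j \<omega>)))"
    using integrable_bounded_mult by simp
  also have "\<dots> = (\<Sum>i<N. \<Sum>j<N. c i * c j * b + (if i = j then (a - b) * (c i * c j) else 0))"
    by (intro sum.cong refl, subst expectation_mult_eq) (simp add: a_def b_def algebra_simps)
  also have "\<dots> = b * (\<Sum>i<N. c i)\<^sup>2 + (a - b) * (\<Sum>i<N. (c i)\<^sup>2)"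
    by (simp add: sum.distrib power2_eq_square sum_product sum_distrib_left sum_subtractf algebra_simps)
  finally show ?thesis .
qed

definition "average n \<omega> = (\<Sum>i<n. f (g i \<omega>)) / real n"

lemma average_measurable [measurable]: "average n \<in> borel_measurable M"
  unfolding average_def[abs_def] by measurable

lemma abs_average_shift_le: "\<bar>(\<Sum>i<n. f (g (k + i) \<omega>)) / real n\<bar> \<le> C"
proof -
  have "\<bar>\<Sum>i<n. f (g (k + i) \<omega>)\<bar> \<le> (\<Sum>i<n. C)"
    by (intro order_trans[OF sum_abs] sum_mono f_bounded)
  moreover have "C \<ge> 0" using f_bounded[of 0] by linarith
  ultimately show ?thesis by (cases "n = 0") (simp_all add: abs_divide divide_le_eq mult.commute)
qed

text \<open>The difference of two averages has weights summing to zero, so only the diagonal excess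
  \<open>a - b\<close> survives, multiplied by the total of the squared weights, which is
  \<open>1 / n - 1 / m\<close>.\<close>

lemma expectation_average_diff_square_le:
  assumes "0 < n" "n \<le> m"
  shows "expectation (\<lambda>\<omega>. (average m \<omega> - average n \<omega>)\<^sup>2) \<le> 2 * C\<^sup>2 / real n"
proof -
  let ?a = "expectation (\<lambda>\<omega>. f (g 0 \<omega>) * f (g 0 \<omega>))" and ?b = "expectation (\<lambda>\<omega>. f (g 0 \<omega>) * f (g 1 \<omega>))"
  define c where "c i = 1 / real m + (if i < n then - 1 / real n else 0)" for i
  have restrict: "(\<Sum>i<m. if i < n then h i else 0) = (\<Sum>i<n. h i)" for h :: "nat \<Rightarrow> real"
    using \<open>n \<le> m\<close> by (intro sum.mono_neutral_cong_right) auto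
  have "average m \<omega> - average n \<omega> = (\<Sum>i<m. c i * f (g i \<omega>))" for \<omega>
  proof -
    have "(\<Sum>i<m. c i * f (g i \<omega>)) = (\<Sum>i<m. f (g i \<omega>) / real m + (if i < n then - f (g i \<omega>) / real n else 0))"
      by (intro sum.cong) (auto simp: c_def algebra_simps)
    also have "\<dots> = average m \<omega> - average n \<omega>"
      unfolding sum.distrib restrict by (simp add: average_def sum_divide_distrib sum_negf)
    finally show ?thesis ..
  qed
  moreover have "(\<Sum>i<m. c i) = 0"
    unfolding c_def sum.distrib restrict using assms by simp
  moreover have "(\<Sum>i<m. (c i)\<^sup>2) \<le> 1 / real n"
  proof -
    have "(c i)\<^sup>2 = (1 / real m)\<^sup>2 + (if i < n then (1 / real n)\<^sup>2 - 2 / (real m * real n) else 0)" for i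
      using assms by (simp add: c_def power2_eq_square field_simps)
    then have "(\<Sum>i<m. (c i)\<^sup>2) = real m * (1 / real m)\<^sup>2 + real n * ((1 / real n)\<^sup>2 - 2 / (real m * real n))"
      by (simp add: sum.distrib restrict)
    also have "\<dots> = 1 / real n - 1 / real m"
      using assms by (simp add: power2_eq_square field_simps)
    finally show ?thesis by simp
  qed
  moreover have "?a - ?b \<le> 2 * C\<^sup>2"
  proof -
    have "\<bar>expectation (\<lambda>\<omega>. f (g i \<omega>) * f (g j \<omega>))\<bar> \<le> C\<^sup>2" for i j
      using abs_mult_bounded unfolding power2_eq_square
      by (intro order_trans[OF integral_abs_bound] integral_le_const)
         (auto intro!: integrable_bounded_mult Bochner_Integration.integrable_abs)
    from this[of 0 0] this[of 0 1] show ?thesis by linarith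
  qed
  then have "(?a - ?b) * x \<le> 2 * C\<^sup>2 * (1 / real n)" if "0 \<le> x" "x \<le> 1 / real n" for x
    using that by (intro mult_mono) auto
  ultimately show ?thesis
    by (simp add: expectation_square_linear_combination sum_nonneg)
qed

text \<open>Squared increments have mean of order 4^(-j), hence absolute increments have mean of
  order 2^(-j). Their series has finite expectation, so it converges absolutely almost everywhere
  and the averages telescope.\<close>

lemma AE_average_convergent: "AE \<omega> in M. convergent (\<lambda>j. average (4 ^ j) \<omega>)"
proof -
  define U where "U j \<omega> = average (4 ^ Suc j) \<omega> - average (4 ^ j) \<omega>" for j \<omega>
  have [measurable]: "U j \<in> borel_measurable M" for j unfolding U_def by measurable
  have C0: "C \<ge> 0" using f_bounded[of 0] by linarith
  have U_le: "\<bar>U j \<omega>\<bar> \<le> 2 * C" for j \<omega>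
    using abs_average_shift_le[of 0 \<omega> "4 ^ Suc j"] abs_average_shift_le[of 0 \<omega> "4 ^ j"]
    unfolding U_def average_def add_0 by linarith
  have "(U j \<omega>)\<^sup>2 \<le> (2 * C)\<^sup>2" for j \<omega>
    using U_le C0 by (subst abs_le_square_iff[symmetric]) simp
  then have int: "integrable M (U j)" "integrable M (\<lambda>\<omega>. (U j \<omega>)\<^sup>2)" for j
    using U_le by (auto intro: integrable_const_bound[of _ "2 * C"] integrable_const_bound[of _ "(2 * C)\<^sup>2"])
  let ?K = "(1 + 2 * C\<^sup>2) / 2"
  have E: "expectation (\<lambda>\<omega>. \<bar>U j \<omega>\<bar>) \<le> ?K * (1 / 2) ^ j" for j
  proof -
    \<comment> \<open>The choice 2^(-j) balances the inequality
      \<open>2 * \<bar>u\<bar> * d \<le> u\<^sup>2 + d\<^sup>2\<close> after division by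
      \<open>2 * d\<close>: with a second moment of order 4^(-j), both terms are of order
      2^(-j).\<close>
    let ?d = "(1 / 2 :: real) ^ j"
    have "expectation (\<lambda>\<omega>. \<bar>U j \<omega>\<bar>) \<le> expectation (\<lambda>\<omega>. ?d / 2 + (U j \<omega>)\<^sup>2 * (1 / (2 * ?d)))"
    proof (rule integral_mono)
      fix \<omega>
      have "0 \<le> (\<bar>U j \<omega>\<bar> - ?d)\<^sup>2" by simp
      then have "2 * \<bar>U j \<omega>\<bar> * ?d \<le> (U j \<omega>)\<^sup>2 + ?d\<^sup>2" by (simp add: power2_diff)
      then have "2 * \<bar>U j \<omega>\<bar> * ?d / (2 * ?d) \<le> ((U j \<omega>)\<^sup>2 + ?d\<^sup>2) / (2 * ?d)"
        by (rule divide_right_mono) simp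
      then show "\<bar>U j \<omega>\<bar> \<le> ?d / 2 + (U j \<omega>)\<^sup>2 * (1 / (2 * ?d))"
        by (simp add: add_divide_distrib power2_eq_square)
    qed (use int in auto)
    also have "\<dots> = ?d / 2 + expectation (\<lambda>\<omega>. (U j \<omega>)\<^sup>2) * (1 / (2 * ?d))"
      using int by (simp add: prob_space)
    also have "\<dots> \<le> ?d / 2 + 2 * C\<^sup>2 / real (4 ^ j) * (1 / (2 * ?d))"
      unfolding U_def by (intro add_left_mono mult_right_mono expectation_average_diff_square_le) auto
    also have "\<dots> = ?K * ?d"
    proof -
      have "real (4 ^ j) = 2 ^ j * 2 ^ j" by (simp flip: power_mult_distrib)
      then show ?thesis by (simp add: power_one_over field_simps)
    qed
    finally show ?thesis .
  qed
  have "(\<integral>\<^sup>+\<omega>. (\<Sum>j. ennreal \<bar>U j \<omega>\<bar>) \<partial>M) = (\<Sum>j. \<integral>\<^sup>+\<omega>. ennreal \<bar>U j \<omega>\<bar> \<partial>M)"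
    by (rule nn_integral_suminf) measurable
  also have "\<dots> \<le> (\<Sum>j. ennreal (?K * (1 / 2) ^ j))"
    using int E by (intro suminf_le) (auto simp: nn_integral_eq_integral intro!: ennreal_leI)
  also have "\<dots> < \<infinity>"
    by (subst suminf_ennreal2) (auto simp: C0 intro!: summable_mult summable_geometric)
  finally have "(\<integral>\<^sup>+\<omega>. (\<Sum>j. ennreal \<bar>U j \<omega>\<bar>) \<partial>M) \<noteq> \<infinity>" by simp
  then have "AE \<omega> in M. (\<Sum>j. ennreal \<bar>U j \<omega>\<bar>) \<noteq> \<infinity>"
    by (intro nn_integral_noteq_infinite) auto
  then show ?thesis
  proof eventually_elim
    fix \<omega> assume "(\<Sum>j. ennreal \<bar>U j \<omega>\<bar>) \<noteq> \<infinity>"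
    then have "summable (\<lambda>j. \<bar>U j \<omega>\<bar>)"
      by (intro summable_suminf_not_top) auto
    then have "summable (\<lambda>j. U j \<omega>)" by (rule summable_rabs_cancel)
    then have "convergent (\<lambda>n. average (4 ^ 0) \<omega> + (\<Sum>j<n. U j \<omega>))"
      by (intro convergent_add convergent_const) (simp add: summable_iff_convergent)
    then show "convergent (\<lambda>j. average (4 ^ j) \<omega>)"
      unfolding U_def sum_lessThan_telescope[of "\<lambda>j. average (4 ^ j) \<omega>"] by simp
  qed
qed

lemma shifted_average_diff_tendsto_0:
  "(\<lambda>j. (\<Sum>i<4 ^ j. f (g (k + i) \<omega>)) / real (4 ^ j) - average (4 ^ j) \<omega>) \<longlonglongrightarrow> 0"
proof (rule tendsto_rabs_zero_cancel, rule tendsto_sandwich[OF _ _ tendsto_const])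
  have "\<bar>(\<Sum>i<4 ^ j. f (g (k + i) \<omega>)) / real (4 ^ j) - average (4 ^ j) \<omega>\<bar> \<le> 2 * real k * C * (1 / 4) ^ j" for j
  proof -
    have "\<bar>(\<Sum>i<4 ^ j. f (g (k + i) \<omega>)) / real (4 ^ j) - average (4 ^ j) \<omega>\<bar>
        = \<bar>(\<Sum>i<4 ^ j. f (g (k + i) \<omega>)) - (\<Sum>i<4 ^ j. f (g i \<omega>))\<bar> / 4 ^ j"
      by (simp add: average_def flip: diff_divide_distrib)
    also have "\<dots> \<le> 2 * real k * C / 4 ^ j"
      by (intro divide_right_mono abs_sum_shift_diff_le f_bounded) auto
    finally show ?thesis by (simp add: power_one_over)
  qed
  then show "\<forall>\<^sub>F j in sequentially. \<bar>(\<Sum>i<4 ^ j. f (g (k + i) \<omega>)) / real (4 ^ j) - average (4 ^ j) \<omega>\<bar>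
      \<le> 2 * real k * C * (1 / 4) ^ j"
    by simp
  have "(\<lambda>j. 2 * real k * C * (1 / 4) ^ j) \<longlonglongrightarrow> 2 * real k * C * 0"
    by (intro tendsto_mult tendsto_const LIMSEQ_power_zero) simp
  then show "(\<lambda>j. 2 * real k * C * (1 / 4) ^ j) \<longlonglongrightarrow> 0" by simp
qed simp

definition "average_limit \<omega> = lim (\<lambda>j. average (4 ^ j) \<omega>)"

lemma average_limit_shift: "average_limit \<omega> = lim (\<lambda>j. (\<Sum>i<4 ^ j. f (g (k + i) \<omega>)) / real (4 ^ j))"
  unfolding average_limit_def by (rule lim_transform_eq(2)[OF shifted_average_diff_tendsto_0, symmetric])

text \<open>For every \<open>m\<close> the limit can be computed from the variables with index at
  least \<open>m\<close>, so it is measurable for each of the sigma-algebras whose intersection is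
  the tail.\<close>

lemma average_limit_measurable: "average_limit \<in> borel_measurable (tail_sigma M g)"
proof (rule measurableI)
  fix B :: "real set" assume B: "B \<in> sets borel"
  have "average_limit -` B \<inter> space M \<in> sets (generated_by M g ({..<0} \<union> {m..}))" for m
  proof -
    have [measurable]: "g (m + i) \<in> borel_measurable (generated_by M g ({..<0} \<union> {m..}))" for i
      by (rule measurable_generated_by) simp
    have "average_limit \<in> borel_measurable (generated_by M g ({..<0} \<union> {m..}))"
      unfolding average_limit_shift[of _ m, abs_def] by measurable
    from measurable_sets[OF this B] show ?thesis by simp
  qed
  then show "average_limit -` B \<inter> space (tail_sigma M g) \<in> sets (tail_sigma M g)"
    unfolding tail_after_0[symmetric] sets_tail_after space_tail_after by blast
qed simp

lemma expectation_average_limit: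
  assumes Z: "Z \<in> borel_measurable (tail_after M g k)" "\<And>\<omega>. \<omega> \<in> space M \<Longrightarrow> \<bar>Z \<omega>\<bar> \<le> B"
  shows "integrable M (\<lambda>\<omega>. Z \<omega> * average_limit \<omega>)"
    and "expectation (\<lambda>\<omega>. Z \<omega> * f (g k \<omega>)) = expectation (\<lambda>\<omega>. Z \<omega> * average_limit \<omega>)"
proof -
  have Z_M[measurable]: "Z \<in> borel_measurable M" by (rule tail_after_measurable_imp[OF Z(1)])
  have [measurable]: "average_limit \<in> borel_measurable M"
    using average_limit_measurable unfolding tail_after_0[symmetric] by (rule tail_after_measurable_imp)
  let ?A = "\<lambda>j \<omega>. (\<Sum>i<4 ^ j. f (g (k + i) \<omega>)) / real (4 ^ j)"
  have bnd: "\<bar>Z \<omega> * y\<bar> \<le> B * C" if "\<omega> \<in> space M" "\<bar>y\<bar> \<le> C" for \<omega> y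
    using Z(2)[OF that(1)] that(2) by (simp add: abs_mult) (intro mult_mono, auto)
  have intf: "integrable M (\<lambda>\<omega>. Z \<omega> * f (g i \<omega>))" for i
    by (rule integrable_const_bound[of _ "B * C"]) (use bnd f_bounded in auto)
  have exch: "expectation (\<lambda>\<omega>. Z \<omega> * f (g (k + i) \<omega>)) = expectation (\<lambda>\<omega>. Z \<omega> * f (g k \<omega>))" for i
  proof (rule expectation_generated_by_exchange[OF _ Z(2) _ _ f_measurable f_bounded])
    \<comment> \<open>Starting the later indices at \<open>k + i + 1\<close> leaves both
      \<open>k\<close> and \<open>k + i\<close> out of the index set, which is what the exchange
      requires.\<close>
    have "sets (tail_after M g k) \<subseteq> sets (generated_by M g ({..<k} \<union> {k + i + 1..}))"
      unfolding sets_tail_after by (rule INT_lower) simp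
    then show "Z \<in> borel_measurable (generated_by M g ({..<k} \<union> {k + i + 1..}))"
      using Z(1) by (intro measurable_from_subalg[OF _ Z(1)]) (simp add: subalgebra_def)
  qed auto
  have A_eq: "expectation (\<lambda>\<omega>. Z \<omega> * ?A j \<omega>) = expectation (\<lambda>\<omega>. Z \<omega> * f (g k \<omega>))" for j
  proof -
    have "expectation (\<lambda>\<omega>. Z \<omega> * ?A j \<omega>) = expectation (\<lambda>\<omega>. (\<Sum>i<4 ^ j. Z \<omega> * f (g (k + i) \<omega>)) / real (4 ^ j))"
      by (simp add: sum_distrib_left)
    also have "\<dots> = (\<Sum>i<4 ^ j. expectation (\<lambda>\<omega>. Z \<omega> * f (g (k + i) \<omega>))) / real (4 ^ j)"
      using intf by simp
    also have "\<dots> = expectation (\<lambda>\<omega>. Z \<omega> * f (g k \<omega>))" unfolding exch by simp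
    finally show ?thesis .
  qed
  have lim: "AE \<omega> in M. (\<lambda>j. Z \<omega> * ?A j \<omega>) \<longlonglongrightarrow> Z \<omega> * average_limit \<omega>"
    using AE_average_convergent
  proof eventually_elim
    fix \<omega> assume "convergent (\<lambda>j. average (4 ^ j) \<omega>)"
    then have "(\<lambda>j. average (4 ^ j) \<omega>) \<longlonglongrightarrow> average_limit \<omega>"
      unfolding average_limit_def by (simp add: convergent_LIMSEQ_iff)
    then have "(\<lambda>j. ?A j \<omega>) \<longlonglongrightarrow> average_limit \<omega>"
      using lim_transform_eq(1)[OF shifted_average_diff_tendsto_0[of k \<omega>]] by blast
    then show "(\<lambda>j. Z \<omega> * ?A j \<omega>) \<longlonglongrightarrow> Z \<omega> * average_limit \<omega>"
      by (intro tendsto_mult tendsto_const)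
  qed
  have dom: "AE \<omega> in M. norm (Z \<omega> * ?A j \<omega>) \<le> B * C" for j
    by (intro AE_I2) (simp only: real_norm_def bnd abs_average_shift_le)
  show "integrable M (\<lambda>\<omega>. Z \<omega> * average_limit \<omega>)"
    by (rule integrable_dominated_convergence[where w = "\<lambda>_. B * C", OF _ _ _ lim dom]) auto
  have "(\<lambda>j. expectation (\<lambda>\<omega>. Z \<omega> * ?A j \<omega>)) \<longlonglongrightarrow> expectation (\<lambda>\<omega>. Z \<omega> * average_limit \<omega>)"
    by (rule integral_dominated_convergence[where w = "\<lambda>_. B * C", OF _ _ _ lim dom]) auto
  then show "expectation (\<lambda>\<omega>. Z \<omega> * f (g k \<omega>)) = expectation (\<lambda>\<omega>. Z \<omega> * average_limit \<omega>)"
    unfolding A_eq using LIMSEQ_unique tendsto_const by blast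
qed

end

end

section \<open>Identification of the limits of averages with integrals against the conditional
  law\<close>

locale exchangeable_kernel = exchangeable_sequence M g for M :: "'a measure" and g +
  fixes \<kappa> :: "'a \<Rightarrow> real measure"
  assumes cond_distr: "is_cond_distr M (tail_sigma M g) (g 0) \<kappa>"
begin

lemma prob_space_kernel: "\<omega> \<in> space M \<Longrightarrow> prob_space (\<kappa> \<omega>)"
  and sets_kernel_eq: "\<omega> \<in> space M \<Longrightarrow> sets (\<kappa> \<omega>) = sets borel"
  using cond_distr by (auto simp: is_cond_distr_def)

lemma space_tail_sigma [simp]: "space (tail_sigma M g) = space M"
  by (simp flip: tail_after_0)

lemma subalgebra_tail_sigma: "subalgebra M (tail_sigma M g)"
  unfolding tail_after_0[symmetric] by (rule subalgebra_tail_after)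

lemma kernel_tail_measurable: "\<kappa> \<in> measurable (tail_sigma M g) (subprob_algebra borel)"
proof (rule measurable_subprob_algebra)
  fix \<omega> assume "\<omega> \<in> space (tail_sigma M g)"
  then show "subprob_space (\<kappa> \<omega>)" "sets (\<kappa> \<omega>) = sets borel"
    using prob_space_kernel sets_kernel_eq by (auto intro: prob_space_imp_subprob_space)
next
  fix A :: "real set" assume "A \<in> sets borel"
  then have "(\<lambda>\<omega>. ennreal (measure (\<kappa> \<omega>) A)) \<in> borel_measurable (tail_sigma M g)"
    using cond_distr by (simp add: is_cond_distr_def)
  also have "?this \<longleftrightarrow> (\<lambda>\<omega>. emeasure (\<kappa> \<omega>) A) \<in> borel_measurable (tail_sigma M g)"
  proof (rule measurable_cong)
    fix \<omega> assume "\<omega> \<in> space (tail_sigma M g)"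
    then interpret \<kappa>: prob_space "\<kappa> \<omega>" using prob_space_kernel by simp
    show "ennreal (measure (\<kappa> \<omega>) A) = emeasure (\<kappa> \<omega>) A" by (simp add: \<kappa>.emeasure_eq_measure)
  qed
  finally show "(\<lambda>\<omega>. emeasure (\<kappa> \<omega>) A) \<in> borel_measurable (tail_sigma M g)" .
qed

lemma kernel_measurable [measurable]: "\<kappa> \<in> measurable M (subprob_algebra borel)"
  by (rule measurable_from_subalg[OF subalgebra_tail_sigma kernel_tail_measurable])

lemma abs_kernel_integral_le:
  assumes "\<omega> \<in> space M" "f \<in> borel_measurable borel" "\<And>x. \<bar>f x :: real\<bar> \<le> C"
  shows "integrable (\<kappa> \<omega>) f" "\<bar>\<integral>x. f x \<partial>\<kappa> \<omega>\<bar> \<le> C"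
proof -
  interpret \<kappa>: prob_space "\<kappa> \<omega>" by (rule prob_space_kernel) fact
  have [measurable]: "f \<in> borel_measurable (\<kappa> \<omega>)"
    using assms(2) measurable_cong_sets[OF sets_kernel_eq[OF assms(1)] refl] by blast
  show int: "integrable (\<kappa> \<omega>) f"
    by (rule \<kappa>.integrable_const_bound[of _ C]) (use assms(3) in auto)
  have "\<bar>\<integral>x. f x \<partial>\<kappa> \<omega>\<bar> \<le> (\<integral>x. \<bar>f x\<bar> \<partial>\<kappa> \<omega>)" by (rule integral_abs_bound)
  also have "\<dots> \<le> C" using int assms(3) by (intro \<kappa>.integral_le_const) auto
  finally show "\<bar>\<integral>x. f x \<partial>\<kappa> \<omega>\<bar> \<le> C" .
qed

text \<open>The defining property of \<kappa> concerns sets. It says that the law of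
  \<open>g 0\<close> under \<open>M\<close> restricted to \<open>A\<close> is the mixture of the
  measures \<open>\<kappa> \<omega>\<close> over \<open>A\<close>; integrating \<open>f\<close>
  against both descriptions gives the claim.\<close>

lemma set_integral_kernel:
  fixes f :: "real \<Rightarrow> real"
  assumes A: "A \<in> sets (tail_sigma M g)" and f[measurable]: "f \<in> borel_measurable borel" and fC: "\<And>x. \<bar>f x\<bar> \<le> C"
  shows "(\<integral>\<omega>\<in>A. f (g 0 \<omega>) \<partial>M) = (\<integral>\<omega>\<in>A. (\<integral>x. f x \<partial>\<kappa> \<omega>) \<partial>M)"
proof -
  have [measurable]: "A \<in> sets M" using A subalgebra_tail_sigma by (auto simp: subalgebra_def)
  define N where "N = density M (\<lambda>x. ennreal (indicator A x))"
  have [measurable_cong]: "sets N = sets M" by (simp add: N_def)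
  have space_N: "space N = space M" by (simp add: N_def)
  have fin: "finite_measure N"
  proof (rule finite_measureI)
    have "emeasure N (space N) = (\<integral>\<^sup>+\<omega>. ennreal (indicator A \<omega>) * indicator (space M) \<omega> \<partial>M)"
      unfolding space_N unfolding N_def by (rule emeasure_density) auto
    also have "\<dots> = (\<integral>\<^sup>+\<omega>. indicator A \<omega> \<partial>M)"
      by (intro nn_integral_cong) (simp add: ennreal_indicator)
    also have "\<dots> = emeasure M A" by simp
    finally show "emeasure N (space N) \<noteq> \<infinity>" by (simp add: emeasure_eq_measure)
  qed
  have "distr N borel (g 0) = N \<bind> \<kappa>"
  proof (rule measure_eqI)
    show "sets (distr N borel (g 0)) = sets (N \<bind> \<kappa>)"
      by (subst sets_bind[where N = borel]) (auto simp: space_N sets_kernel_eq not_empty)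
    fix B assume "B \<in> sets (distr N borel (g 0))"
    then have B[measurable]: "B \<in> sets borel" by simp
    have "emeasure (distr N borel (g 0)) B = emeasure N (g 0 -` B \<inter> space M)"
      by (subst emeasure_distr) (auto simp: space_N)
    also have "\<dots> = (\<integral>\<^sup>+x. indicator (A \<inter> (g 0 -` B \<inter> space M)) x \<partial>M)"
      unfolding N_def
      by (subst emeasure_density) (simp_all add: ennreal_indicator indicator_inter_arith[abs_def] del: nn_integral_indicator)
    also have "\<dots> = emeasure M (A \<inter> (g 0 -` B \<inter> space M))"
      by (rule nn_integral_indicator) measurable
    also have "\<dots> = ennreal (\<integral>\<omega>\<in>A. measure (\<kappa> \<omega>) B \<partial>M)"
      using cond_distr A B by (simp add: is_cond_distr_def emeasure_eq_measure)
    also have "\<dots> = (\<integral>\<^sup>+\<omega>. ennreal (indicator A \<omega> * measure (\<kappa> \<omega>) B) \<partial>M)"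
      unfolding set_lebesgue_integral_def
    proof (subst nn_integral_eq_integral)
      show "integrable M (\<lambda>\<omega>. indicator A \<omega> * measure (\<kappa> \<omega>) B)"
        by (rule integrable_const_bound[of _ 1])
           (auto split: split_indicator intro!: prob_space.prob_le_1 prob_space_kernel)
    qed (auto split: split_indicator)
    also have "\<dots> = (\<integral>\<^sup>+\<omega>. emeasure (\<kappa> \<omega>) B \<partial>N)"
      unfolding N_def
    proof (subst nn_integral_density)
      have "ennreal (indicator A \<omega> * measure (\<kappa> \<omega>) B) = ennreal (indicator A \<omega>) * emeasure (\<kappa> \<omega>) B"
        if "\<omega> \<in> space M" for \<omega>
      proof -
        interpret \<kappa>: prob_space "\<kappa> \<omega>" using that by (rule prob_space_kernel)
        show ?thesis by (simp add: \<kappa>.emeasure_eq_measure ennreal_mult)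
      qed
      then show "(\<integral>\<^sup>+\<omega>. ennreal (indicator A \<omega> * measure (\<kappa> \<omega>) B) \<partial>M)
          = (\<integral>\<^sup>+\<omega>. ennreal (indicator A \<omega>) * emeasure (\<kappa> \<omega>) B \<partial>M)"
        by (rule nn_integral_cong)
    qed measurable
    also have "\<dots> = emeasure (N \<bind> \<kappa>) B"
      by (rule emeasure_bind[symmetric, where N = borel]) (auto simp: space_N not_empty)
    finally show "emeasure (distr N borel (g 0)) B = emeasure (N \<bind> \<kappa>) B" .
  qed
  moreover have "(\<integral>x. f x \<partial>distr N borel (g 0)) = (\<integral>\<omega>\<in>A. f (g 0 \<omega>) \<partial>M)"
    unfolding set_lebesgue_integral_def N_def
    by (subst integral_distr) (auto simp: integral_density)
  moreover have "(\<integral>x. f x \<partial>(N \<bind> \<kappa>)) = (\<integral>\<omega>. (\<integral>x. f x \<partial>\<kappa> \<omega>) \<partial>N)"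
  proof (rule integral_bind[OF f, where B = C and B' = 1])
    show "AE x in N. emeasure (\<kappa> x) (space (\<kappa> x)) \<le> ennreal 1"
      by (rule AE_I2) (simp add: space_N prob_space.emeasure_space_1[OF prob_space_kernel])
  qed (use fC fin in \<open>auto\<close>)
  moreover have "(\<integral>\<omega>. (\<integral>x. f x \<partial>\<kappa> \<omega>) \<partial>N) = (\<integral>\<omega>\<in>A. (\<integral>x. f x \<partial>\<kappa> \<omega>) \<partial>M)"
    unfolding set_lebesgue_integral_def N_def by (subst integral_density) auto
  ultimately show ?thesis by simp
qed

text \<open>The limit of averages and the \<kappa>-integral are both versions of the conditional
  expectation of \<open>f (g 0)\<close> given the tail, the former by the case \<open>k = 0\<close>
  of \<open>expectation_average_limit\<close>. The case of general \<open>k\<close> then carries the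
  identification to every index. Conditional independence and the common conditional law are used in
  this form, with the past carried by \<open>Z\<close>.\<close>

theorem expectation_mult_kernel:
  fixes f :: "real \<Rightarrow> real"
  assumes Z: "Z \<in> borel_measurable (tail_after M g k)" "\<And>\<omega>. \<omega> \<in> space M \<Longrightarrow> \<bar>Z \<omega>\<bar> \<le> B"
    and f[measurable]: "f \<in> borel_measurable borel" and fC: "\<And>x. \<bar>f x\<bar> \<le> C"
  shows "expectation (\<lambda>\<omega>. Z \<omega> * f (g k \<omega>)) = expectation (\<lambda>\<omega>. Z \<omega> * (\<integral>x. f x \<partial>\<kappa> \<omega>))"
proof -
  let ?T = "tail_sigma M g"
  interpret T: finite_measure_subalgebra M ?T by standard (rule subalgebra_tail_sigma)
  have [measurable]: "Z \<in> borel_measurable M" by (rule tail_after_measurable_imp[OF Z(1)])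
  note lim_T = average_limit_measurable[OF f fC]
  have [measurable]: "average_limit f \<in> borel_measurable M"
    by (rule measurable_from_subalg[OF subalgebra_tail_sigma lim_T])
  have int: "integrable M (\<lambda>\<omega>. f (g 0 \<omega>))" by (rule integrable_const_bound[of _ C]) (use fC in auto)
  have "AE \<omega> in M. real_cond_exp M ?T (\<lambda>\<omega>. f (g 0 \<omega>)) \<omega> = average_limit f \<omega>"
  proof (rule T.real_cond_exp_charact[OF _ int _ lim_T])
    fix A assume "A \<in> sets ?T"
    then have "indicator A \<in> borel_measurable (tail_after M g 0)" by (simp add: tail_after_0)
    from expectation_average_limit(2)[OF f fC this, of 1]
    show "(\<integral>\<omega>\<in>A. f (g 0 \<omega>) \<partial>M) = (\<integral>\<omega>\<in>A. average_limit f \<omega> \<partial>M)"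
      by (simp add: set_lebesgue_integral_def)
  next
    show "integrable M (average_limit f)"
      using expectation_average_limit(1)[OF f fC, of "\<lambda>_. 1" 0 1] by simp
  qed
  moreover have "AE \<omega> in M. real_cond_exp M ?T (\<lambda>\<omega>. f (g 0 \<omega>)) \<omega> = (\<integral>x. f x \<partial>\<kappa> \<omega>)"
  proof (rule T.real_cond_exp_charact[OF _ int])
    show "integrable M (\<lambda>\<omega>. \<integral>x. f x \<partial>\<kappa> \<omega>)"
      by (rule integrable_const_bound[of _ C]) (use abs_kernel_integral_le(2)[OF _ f fC] in auto)
    show "(\<lambda>\<omega>. \<integral>x. f x \<partial>\<kappa> \<omega>) \<in> borel_measurable ?T"
      by (rule measurable_compose[OF kernel_tail_measurable]) measurable
  qed (rule set_integral_kernel[OF _ f fC])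
  ultimately have "AE \<omega> in M. Z \<omega> * average_limit f \<omega> = Z \<omega> * (\<integral>x. f x \<partial>\<kappa> \<omega>)"
    by eventually_elim simp
  then have "expectation (\<lambda>\<omega>. Z \<omega> * average_limit f \<omega>) = expectation (\<lambda>\<omega>. Z \<omega> * (\<integral>x. f x \<partial>\<kappa> \<omega>))"
    by (intro integral_cong_AE) auto
  then show ?thesis using expectation_average_limit(2)[OF f fC Z] by simp
qed

end

section \<open>Truncated moments of the conditional law\<close>

lemma nn_integral_linear_greaterThanLessThan:
  assumes "0 \<le> c"
  shows "(\<integral>\<^sup>+t. ennreal t * indicator {0<..<c} t \<partial>lborel) = ennreal (c\<^sup>2 / 2)"
proof -
  have "(\<integral>\<^sup>+t. ennreal t * indicator {0<..<c} t \<partial>lborel) = (\<integral>\<^sup>+t. ennreal t * indicator {0..c} t \<partial>lborel)"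
    by (rule nn_integral_cong_AE, use AE_lborel_singleton[of 0] AE_lborel_singleton[of c] in eventually_elim)
       (auto split: split_indicator)
  also have "\<dots> = ennreal (c\<^sup>2 / 2 - 0\<^sup>2 / 2)"
    by (rule nn_integral_FTC_Icc[of "\<lambda>t. t" 0 c "\<lambda>t. t\<^sup>2 / 2"])
       (use assms in \<open>auto intro!: derivative_eq_intros\<close>)
  finally show ?thesis by simp
qed

lemma nn_integral_inverse_cube_atLeast:
  assumes "0 < (c :: real)"
  shows "(\<integral>\<^sup>+t. ennreal (1 / t ^ 3) * indicator {c..} t \<partial>lborel) = ennreal (1 / (2 * c\<^sup>2))"
proof -
  have "(\<integral>\<^sup>+t. ennreal (1 / t ^ 3) * indicator {c..} t \<partial>lborel) = ennreal (0 - (- (1 / (2 * c\<^sup>2))))"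
  proof (rule nn_integral_FTC_atLeast)
    show "((\<lambda>t. - (1 / (2 * t\<^sup>2))) has_real_derivative 1 / t ^ 3) (at t)" if "c \<le> t" for t
      using that assms
      by (auto intro!: derivative_eq_intros simp: field_simps power2_eq_square power3_eq_cube)
    show "((\<lambda>t :: real. - (1 / (2 * t\<^sup>2))) \<longlongrightarrow> 0) at_top" by real_asymp
  qed (use assms in auto)
  then show ?thesis by simp
qed

section \<open>Truncated moments of a single distribution on the line\<close>

context real_distribution
begin

abbreviation second_moment_upto :: "real \<Rightarrow> real" where
  "second_moment_upto a \<equiv> (\<integral>x. (x * indicator {x. \<bar>x\<bar> \<le> a} x)\<^sup>2 \<partial>M)"

abbreviation mean_upto :: "real \<Rightarrow> real" where
  "mean_upto a \<equiv> (\<integral>x. x * indicator {x. \<bar>x\<bar> \<le> a} x \<partial>M)"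

abbreviation clipped_second_moment :: "real \<Rightarrow> real" where
  "clipped_second_moment a \<equiv> (\<integral>x. (min \<bar>x\<bar> a)\<^sup>2 \<partial>M)"

lemma sq_upto_le: "(x * indicator {x. \<bar>x\<bar> \<le> a} x)\<^sup>2 \<le> a\<^sup>2" for x a :: real
  by (auto simp: abs_le_square_iff[symmetric] split: split_indicator)

lemma integrable_upto [simp]:
  "integrable M (\<lambda>x. x * indicator {x. \<bar>x\<bar> \<le> a} x)"
  "integrable M (\<lambda>x. (x * indicator {x. \<bar>x\<bar> \<le> a} x)\<^sup>2)"
proof -
  show "integrable M (\<lambda>x. x * indicator {x. \<bar>x\<bar> \<le> a} x)"
    by (rule integrable_const_bound[of _ "\<bar>a\<bar>"]) (auto split: split_indicator)
  show "integrable M (\<lambda>x. (x * indicator {x. \<bar>x\<bar> \<le> a} x)\<^sup>2)"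
    by (rule integrable_const_bound[of _ "a\<^sup>2"]) (intro AE_I2, simp_all only: real_norm_def abs_power2 sq_upto_le, measurable)
qed

lemma integrable_clipped [simp]:
  assumes "0 \<le> a" shows "integrable M (\<lambda>x. (min \<bar>x\<bar> a)\<^sup>2)"
  by (rule integrable_const_bound[of _ "a\<^sup>2"]) (use assms in \<open>auto intro!: power_mono\<close>)

lemma clipped_second_moment_eq:
  assumes "0 \<le> a"
  shows "clipped_second_moment a = second_moment_upto a + a\<^sup>2 * prob {x. a < \<bar>x\<bar>}"
proof -
  have "clipped_second_moment a = (\<integral>x. (x * indicator {x. \<bar>x\<bar> \<le> a} x)\<^sup>2 + a\<^sup>2 * indicator {x. a < \<bar>x\<bar>} x \<partial>M)"
    by (intro Bochner_Integration.integral_cong refl) (auto simp: min_def split: split_indicator)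
  also have "\<dots> = second_moment_upto a + (\<integral>x. a\<^sup>2 * indicator {x. a < \<bar>x\<bar>} x \<partial>M)"
    by (intro Bochner_Integration.integral_add integrable_upto)
       (auto simp: emeasure_eq_measure intro!: integrable_mult_right integrable_real_indicator)
  finally show ?thesis by simp
qed

lemma mean_upto_sq_le: "(mean_upto a)\<^sup>2 \<le> second_moment_upto a"
  using variance_positive[of "\<lambda>x. x * indicator {x. \<bar>x\<bar> \<le> a} x"]
  by (subst (asm) variance_eq) simp_all

text \<open>Write the squared mean as the integral of mean times truncated variable
  \<open>y\<close>. Where |x| is at most \<open>A\<close>, the integrand is at most
  \<open>m\<^sup>2 / 4 + A\<^sup>2\<close>; elsewhere it is at most
  \<open>y\<^sup>2 / 2 + m\<^sup>2 / 2\<close>, and there the mass is at most 1/4. Hence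
  \<open>5 / 8 * m\<^sup>2\<close> is at most \<open>A\<^sup>2\<close> plus half the second moment.
  What matters is a coefficient of the second moment below 1, so that the variance retains a fixed
  share of it.\<close>

lemma mean_upto_sq_le_tight:
  assumes A: "0 \<le> A" "prob {x. A < \<bar>x\<bar>} \<le> 1 / 4"
  shows "(mean_upto a)\<^sup>2 \<le> 4 / 5 * second_moment_upto a + 2 * A\<^sup>2"
proof -
  let ?m = "mean_upto a"
  have "?m * ?m = (\<integral>x. ?m * (x * indicator {x. \<bar>x\<bar> \<le> a} x) \<partial>M)" by simp
  also have "\<dots> \<le> (\<integral>x. (?m\<^sup>2 / 4 + A\<^sup>2) + (x * indicator {x. \<bar>x\<bar> \<le> a} x)\<^sup>2 / 2 + ?m\<^sup>2 / 2 * indicator {x. A < \<bar>x\<bar>} x \<partial>M)"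
  proof (rule integral_mono)
    fix x
    let ?y = "x * indicator {x. \<bar>x\<bar> \<le> a} x"
    show "?m * ?y \<le> (?m\<^sup>2 / 4 + A\<^sup>2) + ?y\<^sup>2 / 2 + ?m\<^sup>2 / 2 * indicator {x. A < \<bar>x\<bar>} x"
    proof (cases "A < \<bar>x\<bar>")
      case True
      have "0 \<le> (?m - ?y)\<^sup>2" by simp
      then have "?m * ?y \<le> ?y\<^sup>2 / 2 + ?m\<^sup>2 / 2" by (simp add: power2_diff)
      moreover have "0 \<le> ?m\<^sup>2 / 4 + A\<^sup>2" by simp
      moreover have "indicator {x. A < \<bar>x\<bar>} x = (1 :: real)" using True by simp
      ultimately show ?thesis by (simp only: mult_1_right)
    next
      case False
      have "0 \<le> (?m / 2 - ?y)\<^sup>2" by simp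
      then have "?m * ?y \<le> ?m\<^sup>2 / 4 + ?y\<^sup>2" by (simp add: power2_diff power_divide)
      moreover have "?y\<^sup>2 \<le> A\<^sup>2"
        using False A by (auto simp: abs_le_square_iff[symmetric] split: split_indicator)
      ultimately have "?m * ?y \<le> ?m\<^sup>2 / 4 + A\<^sup>2" by linarith
      also have "\<dots> \<le> (?m\<^sup>2 / 4 + A\<^sup>2) + ?y\<^sup>2 / 2" by simp
      finally show ?thesis using False by simp
    qed
  qed (auto simp: emeasure_eq_measure intro!: integrable_mult_right integrable_real_indicator)
  also have "\<dots> = (?m\<^sup>2 / 4 + A\<^sup>2) + second_moment_upto a / 2 + ?m\<^sup>2 / 2 * prob {x. A < \<bar>x\<bar>}"
    by (subst Bochner_Integration.integral_add,
        auto simp: prob_space[simplified] emeasure_eq_measure intro!: integrable_mult_right integrable_real_indicator)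
  also have "\<dots> \<le> (?m\<^sup>2 / 4 + A\<^sup>2) + second_moment_upto a / 2 + ?m\<^sup>2 / 2 * (1 / 4)"
    by (intro add_left_mono mult_left_mono A) simp
  finally have "?m\<^sup>2 * 5 \<le> 8 * A\<^sup>2 + 4 * second_moment_upto a" by (simp add: power2_eq_square)
  moreover have "0 \<le> A\<^sup>2" by simp
  ultimately show ?thesis by linarith
qed

text \<open>For fixed \<open>x\<close> the levels \<open>t\<close> that count form the interval from
  0 to the smaller of \<open>m\<close> and |x| / \<epsilon>, and the integral of \<open>t\<close>
  over it is half its squared length. Nonnegative integrals let Tonelli's theorem apply with
  measurability alone.\<close>

lemma nn_integral_tail:
  assumes "0 < \<epsilon>" "0 < m"
  shows "(\<integral>\<^sup>+t. ennreal (t * prob {x. \<epsilon> * t < \<bar>x\<bar>}) * indicator {0<..<m} t \<partial>lborel)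
    = ennreal (clipped_second_moment (\<epsilon> * m) / (2 * \<epsilon>\<^sup>2))"
proof -
  interpret pair_sigma_finite M lborel ..
  have "(\<integral>\<^sup>+t. ennreal (t * prob {x. \<epsilon> * t < \<bar>x\<bar>}) * indicator {0<..<m} t \<partial>lborel)
      = (\<integral>\<^sup>+t. (\<integral>\<^sup>+x. ennreal t * indicator {0<..<m} t * indicator {x. \<epsilon> * t < \<bar>x\<bar>} x \<partial>M) \<partial>lborel)"
    by (intro nn_integral_cong, subst nn_integral_cmult)
       (auto simp: emeasure_eq_measure ennreal_mult split: split_indicator)
  also have "\<dots> = (\<integral>\<^sup>+x. (\<integral>\<^sup>+t. ennreal t * indicator {0<..<m} t * indicator {x. \<epsilon> * t < \<bar>x\<bar>} x \<partial>lborel) \<partial>M)"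
    by (rule Fubini') measurable
  also have "\<dots> = (\<integral>\<^sup>+x. ennreal ((min m (\<bar>x\<bar> / \<epsilon>))\<^sup>2 / 2) \<partial>M)"
  proof (rule nn_integral_cong)
    fix x
    have "(\<integral>\<^sup>+t. ennreal t * indicator {0<..<m} t * indicator {x. \<epsilon> * t < \<bar>x\<bar>} x \<partial>lborel)
        = (\<integral>\<^sup>+t. ennreal t * indicator {0<..<min m (\<bar>x\<bar> / \<epsilon>)} t \<partial>lborel)"
      using assms by (intro nn_integral_cong) (auto simp: field_simps split: split_indicator)
    then show "(\<integral>\<^sup>+t. ennreal t * indicator {0<..<m} t * indicator {x. \<epsilon> * t < \<bar>x\<bar>} x \<partial>lborel)
        = ennreal ((min m (\<bar>x\<bar> / \<epsilon>))\<^sup>2 / 2)"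
      using assms by (simp add: nn_integral_linear_greaterThanLessThan)
  qed
  also have "\<dots> = (\<integral>\<^sup>+x. ennreal ((min \<bar>x\<bar> (\<epsilon> * m))\<^sup>2 / (2 * \<epsilon>\<^sup>2)) \<partial>M)"
  proof (rule nn_integral_cong)
    fix x :: real
    have "min m (\<bar>x\<bar> / \<epsilon>) = min \<bar>x\<bar> (\<epsilon> * m) / \<epsilon>" using assms by (auto simp: min_def field_simps)
    then show "ennreal ((min m (\<bar>x\<bar> / \<epsilon>))\<^sup>2 / 2) = ennreal ((min \<bar>x\<bar> (\<epsilon> * m))\<^sup>2 / (2 * \<epsilon>\<^sup>2))"
      by (simp add: power_divide)
  qed
  also have "\<dots> = ennreal (clipped_second_moment (\<epsilon> * m) / (2 * \<epsilon>\<^sup>2))"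
    using assms by (subst nn_integral_eq_integral) auto
  finally show ?thesis .
qed

text \<open>For fixed \<open>x\<close> the truncation admits the levels with
  \<open>\<epsilon> * t\<close> at least |x|, so the integral of t^(-3) starts at the larger of
  \<open>m\<close> and |x| / \<epsilon>. The maximum in the denominator becomes the clipping minimum
  in the numerator.\<close>

lemma nn_integral_second_moment:
  assumes "0 < \<epsilon>" "0 < m"
  shows "(\<integral>\<^sup>+t. ennreal (second_moment_upto (\<epsilon> * t) / t ^ 3) * indicator {m<..} t \<partial>lborel)
    = ennreal (clipped_second_moment (\<epsilon> * m) / (2 * m\<^sup>2))"
proof -
  interpret pair_sigma_finite M lborel ..
  have "(\<integral>\<^sup>+t. ennreal (second_moment_upto (\<epsilon> * t) / t ^ 3) * indicator {m<..} t \<partial>lborel)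
      = (\<integral>\<^sup>+t. (\<integral>\<^sup>+x. ennreal (1 / t ^ 3) * indicator {m<..} t * ennreal ((x * indicator {x. \<bar>x\<bar> \<le> \<epsilon> * t} x)\<^sup>2) \<partial>M) \<partial>lborel)"
  proof (intro nn_integral_cong)
    fix t :: real
    have "(\<integral>\<^sup>+x. ennreal (1 / t ^ 3) * indicator {m<..} t * ennreal ((x * indicator {x. \<bar>x\<bar> \<le> \<epsilon> * t} x)\<^sup>2) \<partial>M)
        = ennreal (1 / t ^ 3) * indicator {m<..} t * ennreal (second_moment_upto (\<epsilon> * t))"
      by (subst nn_integral_cmult) (auto simp: nn_integral_eq_integral)
    also have "\<dots> = ennreal (second_moment_upto (\<epsilon> * t) / t ^ 3) * indicator {m<..} t"
      using assms by (auto simp: ennreal_mult[symmetric] split: split_indicator)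
    finally show "ennreal (second_moment_upto (\<epsilon> * t) / t ^ 3) * indicator {m<..} t
      = (\<integral>\<^sup>+x. ennreal (1 / t ^ 3) * indicator {m<..} t * ennreal ((x * indicator {x. \<bar>x\<bar> \<le> \<epsilon> * t} x)\<^sup>2) \<partial>M)" ..
  qed
  also have "\<dots> = (\<integral>\<^sup>+x. (\<integral>\<^sup>+t. ennreal (1 / t ^ 3) * indicator {m<..} t * ennreal ((x * indicator {x. \<bar>x\<bar> \<le> \<epsilon> * t} x)\<^sup>2) \<partial>lborel) \<partial>M)"
    by (rule Fubini') measurable
  also have "\<dots> = (\<integral>\<^sup>+x. ennreal ((min \<bar>x\<bar> (\<epsilon> * m))\<^sup>2 / (2 * m\<^sup>2)) \<partial>M)"
  proof (rule nn_integral_cong)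
    fix x :: real
    let ?c = "max m (\<bar>x\<bar> / \<epsilon>)"
    have c: "0 < ?c" using assms by (simp add: less_max_iff_disj)
    have "(\<integral>\<^sup>+t. ennreal (1 / t ^ 3) * indicator {m<..} t * ennreal ((x * indicator {x. \<bar>x\<bar> \<le> \<epsilon> * t} x)\<^sup>2) \<partial>lborel)
        = (\<integral>\<^sup>+t. ennreal (x\<^sup>2) * (ennreal (1 / t ^ 3) * indicator {?c..} t) \<partial>lborel)"
      by (rule nn_integral_cong_AE, use AE_lborel_singleton[of m] in eventually_elim)
         (use assms in \<open>auto simp: field_simps split: split_indicator\<close>)
    also have "\<dots> = ennreal (x\<^sup>2) * ennreal (1 / (2 * ?c\<^sup>2))"
      by (subst nn_integral_cmult) (simp_all add: nn_integral_inverse_cube_atLeast[OF c])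
    also have "\<dots> = ennreal (x\<^sup>2 / (2 * ?c\<^sup>2))"
      by (simp add: ennreal_mult[symmetric])
    also have "x\<^sup>2 / (2 * ?c\<^sup>2) = (min \<bar>x\<bar> (\<epsilon> * m))\<^sup>2 / (2 * m\<^sup>2)"
    proof (cases "\<bar>x\<bar> \<le> \<epsilon> * m")
      case True
      then have "?c = m" using assms by (simp add: max_def field_simps)
      with True show ?thesis by simp
    next
      case False
      then have "?c = \<bar>x\<bar> / \<epsilon>" "x \<noteq> 0" using assms by (auto simp: max_def field_simps)
      with False assms show ?thesis by (simp add: power_divide power_mult_distrib)
    qed
    finally show "(\<integral>\<^sup>+t. ennreal (1 / t ^ 3) * indicator {m<..} t * ennreal ((x * indicator {x. \<bar>x\<bar> \<le> \<epsilon> * t} x)\<^sup>2) \<partial>lborel)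
      = ennreal ((min \<bar>x\<bar> (\<epsilon> * m))\<^sup>2 / (2 * m\<^sup>2))" .
  qed
  also have "\<dots> = ennreal (clipped_second_moment (\<epsilon> * m) / (2 * m\<^sup>2))"
    using assms by (subst nn_integral_eq_integral) auto
  finally show ?thesis .
qed

end

section \<open>The random truncated quantities and their integrals over the level\<close>

context exchangeable_kernel
begin

lemma real_distribution_kernel: "\<omega> \<in> space M \<Longrightarrow> real_distribution (\<kappa> \<omega>)"
  by (simp add: real_distribution_def real_distribution_axioms_def prob_space_kernel sets_kernel_eq)

lemma kernel_fst_measurable: "(\<lambda>z. \<kappa> (fst z)) \<in> measurable (M \<Otimes>\<^sub>M borel) (subprob_algebra borel)"
  by measurable

text \<open>Joint measurability in outcome and level is needed because the integral conditions
  integrate over \<open>t\<close> at a fixed outcome and must again yield random variables. The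
  moving tail set is treated as a section of one measurable set of triples.\<close>

lemma Tq_measurable2 [measurable]: "(\<lambda>(\<omega>, t). Tq \<kappa> \<epsilon> t \<omega>) \<in> borel_measurable (M \<Otimes>\<^sub>M borel)"
proof -
  have "Sigma (space (M \<Otimes>\<^sub>M borel)) (\<lambda>z. {x. \<epsilon> * snd z < \<bar>x\<bar>})
      = {y \<in> space ((M \<Otimes>\<^sub>M (borel :: real measure)) \<Otimes>\<^sub>M (borel :: real measure)). \<epsilon> * snd (fst y) < \<bar>snd y\<bar>}"
    by (auto simp: space_pair_measure)
  also have "\<dots> \<in> sets ((M \<Otimes>\<^sub>M borel) \<Otimes>\<^sub>M borel)" by measurable
  finally have "(\<lambda>z. measure (\<kappa> (fst z)) {x. \<epsilon> * snd z < \<bar>x\<bar>}) \<in> borel_measurable (M \<Otimes>\<^sub>M (borel :: real measure))"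
    by (rule measure_measurable_subprob_algebra2[OF _ kernel_fst_measurable])
  then show ?thesis unfolding Tq_def case_prod_beta' by (intro borel_measurable_times) auto
qed

lemma kernel_integral_measurable2:
  fixes h :: "real \<Rightarrow> real \<Rightarrow> real"
  assumes [measurable]: "(\<lambda>(t, x). h t x) \<in> borel_measurable (borel \<Otimes>\<^sub>M borel)"
  shows "(\<lambda>(\<omega>, t). \<integral>x. h t x \<partial>\<kappa> \<omega>) \<in> borel_measurable (M \<Otimes>\<^sub>M borel)"
  unfolding case_prod_beta'
  by (rule lebesgue_integral_measurable_subprob_algebra2[OF _ kernel_fst_measurable]) measurable

lemma Sigq_measurable2 [measurable]: "(\<lambda>(\<omega>, t). Sigq \<kappa> \<epsilon> t \<omega>) \<in> borel_measurable (M \<Otimes>\<^sub>M borel)"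
  using kernel_integral_measurable2[of "\<lambda>t x. (x * indicator {x. \<bar>x\<bar> \<le> \<epsilon> * t} x)\<^sup>2"]
  unfolding Sigq_def case_prod_beta' by (intro borel_measurable_times) auto

lemma Vq_measurable2 [measurable]: "(\<lambda>(\<omega>, t). Vq \<kappa> \<epsilon> t \<omega>) \<in> borel_measurable (M \<Otimes>\<^sub>M borel)"
  using kernel_integral_measurable2[of "\<lambda>t x. (x * indicator {x. \<bar>x\<bar> \<le> \<epsilon> * t} x)\<^sup>2"]
    kernel_integral_measurable2[of "\<lambda>t x. x * indicator {x. \<bar>x\<bar> \<le> \<epsilon> * t} x"]
  unfolding Vq_def case_prod_beta' by (intro borel_measurable_times borel_measurable_diff borel_measurable_power) auto

lemma kernel_quantity_measurable [measurable]:
  "Tq \<kappa> \<epsilon> t \<in> borel_measurable M" "Sigq \<kappa> \<epsilon> t \<in> borel_measurable M"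
  "Vq \<kappa> \<epsilon> t \<in> borel_measurable M" "Rq \<kappa> \<epsilon> t \<in> borel_measurable M"
proof -
  have "(\<lambda>\<omega>. (\<omega>, t)) \<in> measurable M (M \<Otimes>\<^sub>M borel)" by measurable
  from measurable_compose[OF this Tq_measurable2] measurable_compose[OF this Sigq_measurable2]
    measurable_compose[OF this Vq_measurable2]
  show "Tq \<kappa> \<epsilon> t \<in> borel_measurable M" "Sigq \<kappa> \<epsilon> t \<in> borel_measurable M" "Vq \<kappa> \<epsilon> t \<in> borel_measurable M"
    by simp_all
  show "Rq \<kappa> \<epsilon> t \<in> borel_measurable M" unfolding Rq_def[abs_def] by measurable
qed

lemma interval_integral_measurable:
  assumes [measurable]: "(\<lambda>(\<omega>, t). f t \<omega> :: real) \<in> borel_measurable (M \<Otimes>\<^sub>M borel)"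
  shows "(\<lambda>\<omega>. interval_lebesgue_integral lborel a b (\<lambda>t. f t \<omega>)) \<in> borel_measurable M"
  unfolding interval_lebesgue_integral_def set_lebesgue_integral_def by measurable

lemma Rq_eq:
  assumes "\<omega> \<in> space M" "0 < \<epsilon>" "0 < t"
  shows "Rq \<kappa> \<epsilon> t \<omega> = Sigq \<kappa> \<epsilon> t \<omega> + \<epsilon>\<^sup>2 * Tq \<kappa> \<epsilon> t \<omega>"
proof -
  interpret \<kappa>: real_distribution "\<kappa> \<omega>" by (rule real_distribution_kernel) fact
  have "1 / t * (S + (\<epsilon> * t)\<^sup>2 * p) = 1 / t * S + \<epsilon>\<^sup>2 * (t * p)" for S p
    using assms by (simp add: field_simps power2_eq_square)
  then show ?thesis using assms
    by (simp only: Rq_def Sigq_def Tq_def \<kappa>.clipped_second_moment_eq[of "\<epsilon> * t"] zero_le_mult_iff less_imp_le simp_thms)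
qed

lemma kernel_quantity_nonneg:
  "0 \<le> t \<Longrightarrow> 0 \<le> Tq \<kappa> \<epsilon> t \<omega>" "0 \<le> t \<Longrightarrow> 0 \<le> Sigq \<kappa> \<epsilon> t \<omega>" "0 \<le> t \<Longrightarrow> 0 \<le> Rq \<kappa> \<epsilon> t \<omega>"
  by (simp_all add: Tq_def Sigq_def Rq_def)

lemma Vq_bounds:
  assumes "\<omega> \<in> space M" "0 \<le> t"
  shows "0 \<le> Vq \<kappa> \<epsilon> t \<omega>" "Vq \<kappa> \<epsilon> t \<omega> \<le> Sigq \<kappa> \<epsilon> t \<omega>"
proof -
  interpret \<kappa>: real_distribution "\<kappa> \<omega>" by (rule real_distribution_kernel) fact
  show "0 \<le> Vq \<kappa> \<epsilon> t \<omega>" using assms(2) \<kappa>.mean_upto_sq_le by (simp add: Vq_def)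
  show "Vq \<kappa> \<epsilon> t \<omega> \<le> Sigq \<kappa> \<epsilon> t \<omega>"
    unfolding Vq_def Sigq_def using assms(2) by (intro mult_left_mono) auto
qed

text \<open>A random level \<open>A\<close> for \<open>mean_upto_sq_le_tight\<close>, with the
  quarter required there. Taking the least natural number instead of a real quantile reduces
  measurability to countably many events; the level does not involve \<open>t\<close>, so its square
  divided by \<open>t\<close> vanishes.\<close>

definition tightness_level :: "'a \<Rightarrow> nat" where
  "tightness_level \<omega> = (LEAST n. measure (\<kappa> \<omega>) {x. real n < \<bar>x\<bar>} \<le> 1 / 4)"

lemma tightness_level:
  assumes "\<omega> \<in> space M"
  shows "measure (\<kappa> \<omega>) {x. real (tightness_level \<omega>) < \<bar>x\<bar>} \<le> 1 / 4"
proof -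
  interpret \<kappa>: real_distribution "\<kappa> \<omega>" by (rule real_distribution_kernel) fact
  have "(\<lambda>n. measure (\<kappa> \<omega>) {x. real n < \<bar>x\<bar>}) \<longlonglongrightarrow> measure (\<kappa> \<omega>) (\<Inter>n. {x. real n < \<bar>x\<bar>})"
    by (rule \<kappa>.finite_Lim_measure_decseq) (auto simp: decseq_def)
  also have "(\<Inter>n. {x. real n < \<bar>x\<bar>}) = {}"
  proof (rule equals0I)
    fix x :: real assume x: "x \<in> (\<Inter>n. {x. real n < \<bar>x\<bar>})"
    obtain n where "\<bar>x\<bar> \<le> real n" using real_arch_simple by blast
    with x show False by (auto simp: not_less[symmetric])
  qed
  finally have "\<forall>\<^sub>F n in sequentially. measure (\<kappa> \<omega>) {x. real n < \<bar>x\<bar>} < 1 / 4"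
    by (intro order_tendstoD) auto
  then obtain n where "measure (\<kappa> \<omega>) {x. real n < \<bar>x\<bar>} \<le> 1 / 4"
    by (auto simp: eventually_sequentially intro: less_imp_le)
  then show ?thesis unfolding tightness_level_def by (rule LeastI)
qed

lemma tightness_level_measurable [measurable]: "tightness_level \<in> measurable M (count_space UNIV)"
proof -
  have [measurable]: "(\<lambda>\<omega>. measure (\<kappa> \<omega>) {x. real n < \<bar>x\<bar>}) \<in> borel_measurable M" for n :: nat
    using cond_distr by (intro measurable_from_subalg[OF subalgebra_tail_sigma]) (auto simp: is_cond_distr_def)
  show ?thesis unfolding tightness_level_def[abs_def] by measurable
qed

text \<open>By \<open>mean_upto_sq_le_tight\<close> the truncated variance is at least a fifth of
  the second moment minus \<open>2 * A\<^sup>2\<close>; multiplying by five gives both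
  constants.\<close>

lemma Sigq_le_Vq:
  assumes "\<omega> \<in> space M" "0 < t"
  shows "Sigq \<kappa> \<epsilon> t \<omega> \<le> 5 * Vq \<kappa> \<epsilon> t \<omega> + 10 * (real (tightness_level \<omega>))\<^sup>2 / t"
proof -
  interpret \<kappa>: real_distribution "\<kappa> \<omega>" by (rule real_distribution_kernel) fact
  from \<kappa>.mean_upto_sq_le_tight[OF _ tightness_level[OF assms(1)], of "\<epsilon> * t"] assms(2) show ?thesis
    by (simp add: Sigq_def Vq_def field_simps)
qed

lemma integral_Tq:
  assumes "\<omega> \<in> space M" "0 < \<epsilon>" "0 < m"
  shows "(1 / m) * (LBINT t=0..m. Tq \<kappa> \<epsilon> t \<omega>) = Rq \<kappa> \<epsilon> m \<omega> / (2 * \<epsilon>\<^sup>2)"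
proof -
  interpret \<kappa>: real_distribution "\<kappa> \<omega>" by (rule real_distribution_kernel) fact
  have [measurable]: "(\<lambda>t. Tq \<kappa> \<epsilon> t \<omega>) \<in> borel_measurable borel"
    using measurable_compose[OF measurable_Pair1'[OF assms(1)] Tq_measurable2] by simp
  have "has_bochner_integral lborel (\<lambda>t. indicator {0<..<m} t * Tq \<kappa> \<epsilon> t \<omega>) (\<kappa>.clipped_second_moment (\<epsilon> * m) / (2 * \<epsilon>\<^sup>2))"
  proof (rule has_bochner_integral_nn_integral)
    show "(\<integral>\<^sup>+t. ennreal (indicator {0<..<m} t * Tq \<kappa> \<epsilon> t \<omega>) \<partial>lborel) = ennreal (\<kappa>.clipped_second_moment (\<epsilon> * m) / (2 * \<epsilon>\<^sup>2))"
      unfolding \<kappa>.nn_integral_tail[OF assms(2,3), symmetric] Tq_def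
      by (intro nn_integral_cong) (auto split: split_indicator)
  qed (auto simp: kernel_quantity_nonneg split: split_indicator)
  then have "(LBINT t=0..m. Tq \<kappa> \<epsilon> t \<omega>) = \<kappa>.clipped_second_moment (\<epsilon> * m) / (2 * \<epsilon>\<^sup>2)"
    using assms(3)
    by (simp add: interval_lebesgue_integral_def set_lebesgue_integral_def zero_ereal_def has_bochner_integral_integral_eq)
  then show ?thesis by (simp add: Rq_def)
qed

text \<open>Integrability is stated separately because it is what permits the comparison with the
  integral of \<open>Vq\<close>.\<close>

lemma integral_Sigq:
  assumes "\<omega> \<in> space M" "0 < \<epsilon>" "0 < m"
  shows "set_integrable lborel {m<..} (\<lambda>t. Sigq \<kappa> \<epsilon> t \<omega> / t\<^sup>2)"
    and "m * (LBINT t=ereal m..\<infinity>. Sigq \<kappa> \<epsilon> t \<omega> / t\<^sup>2) = Rq \<kappa> \<epsilon> m \<omega> / 2"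
proof -
  interpret \<kappa>: real_distribution "\<kappa> \<omega>" by (rule real_distribution_kernel) fact
  have [measurable]: "(\<lambda>t. Sigq \<kappa> \<epsilon> t \<omega>) \<in> borel_measurable borel"
    using measurable_compose[OF measurable_Pair1'[OF assms(1)] Sigq_measurable2] by simp
  have *: "has_bochner_integral lborel (\<lambda>t. indicator {m<..} t *\<^sub>R (Sigq \<kappa> \<epsilon> t \<omega> / t\<^sup>2)) (\<kappa>.clipped_second_moment (\<epsilon> * m) / (2 * m\<^sup>2))"
  proof (rule has_bochner_integral_nn_integral)
    show "(\<integral>\<^sup>+t. ennreal (indicator {m<..} t *\<^sub>R (Sigq \<kappa> \<epsilon> t \<omega> / t\<^sup>2)) \<partial>lborel) = ennreal (\<kappa>.clipped_second_moment (\<epsilon> * m) / (2 * m\<^sup>2))"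
      unfolding \<kappa>.nn_integral_second_moment[OF assms(2,3), symmetric] Sigq_def
      by (intro nn_integral_cong) (auto simp: power2_eq_square power3_eq_cube mult.assoc split: split_indicator)
  qed (use assms in \<open>auto simp: kernel_quantity_nonneg split: split_indicator\<close>)
  then show "set_integrable lborel {m<..} (\<lambda>t. Sigq \<kappa> \<epsilon> t \<omega> / t\<^sup>2)"
    by (simp add: set_integrable_def has_bochner_integral_iff)
  from * have "(LBINT t=ereal m..\<infinity>. Sigq \<kappa> \<epsilon> t \<omega> / t\<^sup>2) = \<kappa>.clipped_second_moment (\<epsilon> * m) / (2 * m\<^sup>2)"
    by (simp add: interval_lebesgue_integral_def set_lebesgue_integral_def has_bochner_integral_integral_eq)
  then show "m * (LBINT t=ereal m..\<infinity>. Sigq \<kappa> \<epsilon> t \<omega> / t\<^sup>2) = Rq \<kappa> \<epsilon> m \<omega> / 2"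
    using assms(3) by (simp add: Rq_def power2_eq_square)
qed

text \<open>The variance depends quadratically on the law, so Tonelli's theorem yields no closed
  form as it does for \<open>Sigq\<close>. Instead the pointwise comparisons of \<open>Vq\<close>
  with \<open>Sigq\<close> are integrated. The correction contributes \<open>10 * A\<^sup>2\<close>
  times the integral of t^(-3), which after multiplication by \<open>m\<close> is
  \<open>5 * A\<^sup>2 / m\<close>; everything doubles because the integral of \<open>Sigq\<close>
  gives half of \<open>Rq\<close>.\<close>

lemma integral_Vq_bounds:
  assumes \<omega>: "\<omega> \<in> space M" and "0 < \<epsilon>" "0 < m"
  defines "I \<equiv> m * (LBINT t=ereal m..\<infinity>. Vq \<kappa> \<epsilon> t \<omega> / t\<^sup>2)"
  shows "0 \<le> I" "I \<le> Rq \<kappa> \<epsilon> m \<omega> / 2"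
    and "Rq \<kappa> \<epsilon> m \<omega> \<le> 10 * I + 10 * (real (tightness_level \<omega>))\<^sup>2 / m"
proof -
  let ?S = "\<lambda>t. Sigq \<kappa> \<epsilon> t \<omega> / t\<^sup>2" and ?V = "\<lambda>t. Vq \<kappa> \<epsilon> t \<omega> / t\<^sup>2" and ?a = "(real (tightness_level \<omega>))\<^sup>2"
  have [measurable]: "(\<lambda>t. Vq \<kappa> \<epsilon> t \<omega>) \<in> borel_measurable borel"
    using measurable_compose[OF measurable_Pair1'[OF \<omega>] Vq_measurable2] by simp
  have LBINT: "(LBINT t=ereal m..\<infinity>. f t) = (LBINT t:{m<..}. f t)" for f :: "real \<Rightarrow> real"
    by (simp add: interval_lebesgue_integral_def)
  note S = integral_Sigq[OF assms(1-3), unfolded LBINT]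
  have V: "set_integrable lborel {m<..} ?V"
    using S(1)
  proof (rule set_integrable_bound)
    show "AE t in lborel. t \<in> {m<..} \<longrightarrow> norm (?V t) \<le> norm (?S t)"
      using \<open>0 < m\<close> Vq_bounds[OF \<omega>] by (auto intro!: AE_I2 divide_right_mono order_trans[OF _ abs_ge_self])
  qed (simp add: set_borel_measurable_def)
  have cube: "has_bochner_integral lborel (\<lambda>t. indicator {m<..} t *\<^sub>R (1 / t ^ 3)) (1 / (2 * m\<^sup>2))"
  proof (rule has_bochner_integral_nn_integral)
    have "(\<integral>\<^sup>+t. ennreal (indicator {m<..} t *\<^sub>R (1 / t ^ 3)) \<partial>lborel) = (\<integral>\<^sup>+t. ennreal (1 / t ^ 3) * indicator {m..} t \<partial>lborel)"
      by (rule nn_integral_cong_AE, use AE_lborel_singleton[of m] in eventually_elim) (auto split: split_indicator)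
    then show "(\<integral>\<^sup>+t. ennreal (indicator {m<..} t *\<^sub>R (1 / t ^ 3)) \<partial>lborel) = ennreal (1 / (2 * m\<^sup>2))"
      using \<open>0 < m\<close> by (simp add: nn_integral_inverse_cube_atLeast)
  qed (use assms in \<open>auto split: split_indicator\<close>)
  have "0 \<le> (LBINT t:{m<..}. ?V t)"
    using Vq_bounds(1)[OF \<omega>] \<open>0 < m\<close> unfolding set_lebesgue_integral_def
    by (intro Bochner_Integration.integral_nonneg) (auto split: split_indicator)
  then show "0 \<le> I" using \<open>0 < m\<close> by (simp add: I_def LBINT)
  have "(LBINT t:{m<..}. ?V t) \<le> (LBINT t:{m<..}. ?S t)"
    using Vq_bounds(2)[OF \<omega>] \<open>0 < m\<close> by (intro set_integral_mono V S) (auto intro!: divide_right_mono)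
  then show "I \<le> Rq \<kappa> \<epsilon> m \<omega> / 2"
    unfolding S(2)[symmetric] I_def LBINT using \<open>0 < m\<close> by (intro mult_left_mono) auto
  have cube_int: "set_integrable lborel {m<..} (\<lambda>t. 1 / t ^ 3)"
    using cube by (simp add: set_integrable_def has_bochner_integral_iff)
  have "(LBINT t:{m<..}. ?S t) \<le> (LBINT t:{m<..}. 5 * ?V t + 10 * ?a * (1 / t ^ 3))"
  proof (rule set_integral_mono)
    fix t assume "t \<in> {m<..}"
    then have "t > 0" using \<open>0 < m\<close> by simp
    then have "?S t \<le> (5 * Vq \<kappa> \<epsilon> t \<omega> + 10 * ?a / t) / t\<^sup>2"
      by (intro divide_right_mono Sigq_le_Vq \<omega>) auto
    then show "?S t \<le> 5 * ?V t + 10 * ?a * (1 / t ^ 3)"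
      using \<open>t > 0\<close> by (simp add: add_divide_distrib power2_eq_square power3_eq_cube)
  qed (intro S V cube_int set_integral_add set_integrable_mult_right; simp)+
  also have "\<dots> = 5 * (LBINT t:{m<..}. ?V t) + 10 * ?a * (1 / (2 * m\<^sup>2))"
  proof -
    have "(LBINT t:{m<..}. 1 / t ^ 3) = 1 / (2 * m\<^sup>2)"
      using cube by (simp add: set_lebesgue_integral_def has_bochner_integral_integral_eq)
    moreover have "set_integrable lborel {m<..} (\<lambda>t. 5 * ?V t)" "set_integrable lborel {m<..} (\<lambda>t. 10 * ?a * (1 / t ^ 3))"
      using V cube_int by (intro set_integrable_mult_right; simp)+
    ultimately show ?thesis
      by (simp only: set_integral_add(2) set_integral_mult_right)
  qed
  finally have "m * (LBINT t:{m<..}. ?S t) \<le> m * (5 * (LBINT t:{m<..}. ?V t) + 10 * ?a * (1 / (2 * m\<^sup>2)))"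
    using \<open>0 < m\<close> by (intro mult_left_mono) auto
  also have "\<dots> = 5 * I + 5 * ?a / m"
    using \<open>0 < m\<close> by (simp add: I_def LBINT field_simps power2_eq_square)
  finally show "Rq \<kappa> \<epsilon> m \<omega> \<le> 10 * I + 10 * ?a / m"
    unfolding S(2) by (simp add: field_simps)
qed

end

section \<open>Sufficiency: the conditional weak law\<close>

context exchangeable_kernel
begin

section \<open>Equivalence of the truncation conditions with the integral conditions\<close>

abbreviation conv_0 :: "(real \<Rightarrow> 'a \<Rightarrow> real) \<Rightarrow> bool" where
  "conv_0 X \<equiv> conv_in_prob M at_top X (\<lambda>_. 0)"

lemma eventually_pos: "(\<And>t. 0 < t \<Longrightarrow> P t) \<Longrightarrow> \<forall>\<^sub>F t :: real in at_top. P t"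
  using eventually_gt_at_top[of 0] by eventually_elim

lemma conv_Rq_iff:
  assumes "0 < \<epsilon>"
  shows "conv_0 (Rq \<kappa> \<epsilon>) \<longleftrightarrow> conv_0 (Tq \<kappa> \<epsilon>) \<and> conv_0 (Sigq \<kappa> \<epsilon>)"
proof (intro iffI conjI)
  assume R: "conv_0 (Rq \<kappa> \<epsilon>)"
  show "conv_0 (Tq \<kappa> \<epsilon>)"
  proof (rule conv_in_prob_zero_dominated[OF conv_in_prob_zero_cmult[OF R, of "1 / \<epsilon>\<^sup>2"]])
    show "\<forall>\<^sub>F t in at_top. \<forall>\<omega>\<in>space M. \<bar>Tq \<kappa> \<epsilon> t \<omega>\<bar> \<le> \<bar>1 / \<epsilon>\<^sup>2 * Rq \<kappa> \<epsilon> t \<omega>\<bar>"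
    proof (rule eventually_pos, intro ballI)
      fix t \<omega> assume "0 < (t :: real)" "\<omega> \<in> space M"
      then show "\<bar>Tq \<kappa> \<epsilon> t \<omega>\<bar> \<le> \<bar>1 / \<epsilon>\<^sup>2 * Rq \<kappa> \<epsilon> t \<omega>\<bar>"
        using assms kernel_quantity_nonneg[of t \<epsilon> \<omega>] by (simp add: Rq_eq field_simps)
    qed
  qed measurable
  show "conv_0 (Sigq \<kappa> \<epsilon>)"
  proof (rule conv_in_prob_zero_dominated[OF R])
    show "\<forall>\<^sub>F t in at_top. \<forall>\<omega>\<in>space M. \<bar>Sigq \<kappa> \<epsilon> t \<omega>\<bar> \<le> \<bar>Rq \<kappa> \<epsilon> t \<omega>\<bar>"
    proof (rule eventually_pos, intro ballI)
      fix t \<omega> assume "0 < (t :: real)" "\<omega> \<in> space M"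
      then show "\<bar>Sigq \<kappa> \<epsilon> t \<omega>\<bar> \<le> \<bar>Rq \<kappa> \<epsilon> t \<omega>\<bar>"
        using assms kernel_quantity_nonneg[of t \<epsilon> \<omega>] by (simp add: Rq_eq)
    qed
  qed measurable
next
  assume "conv_0 (Tq \<kappa> \<epsilon>) \<and> conv_0 (Sigq \<kappa> \<epsilon>)"
  then have "conv_0 (\<lambda>t \<omega>. Sigq \<kappa> \<epsilon> t \<omega> + \<epsilon>\<^sup>2 * Tq \<kappa> \<epsilon> t \<omega>)"
    by (intro conv_in_prob_zero_add conv_in_prob_zero_cmult) auto
  then show "conv_0 (Rq \<kappa> \<epsilon>)"
    by (rule conv_in_prob_zero_dominated) (use assms in \<open>auto intro!: eventually_pos simp: Rq_eq\<close>)
qed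

lemma conv_tightness_level: "conv_0 (\<lambda>t \<omega>. (real (tightness_level \<omega>))\<^sup>2 / t)"
  by (rule conv_in_prob_zero_pointwise)
     (auto intro!: tendsto_divide_0 tendsto_const filterlim_at_top_imp_at_infinity filterlim_ident)

lemma conv_Vq_iff: "conv_0 (Vq \<kappa> \<epsilon>) \<longleftrightarrow> conv_0 (Sigq \<kappa> \<epsilon>)"
proof
  assume "conv_0 (Sigq \<kappa> \<epsilon>)"
  then show "conv_0 (Vq \<kappa> \<epsilon>)"
    by (rule conv_in_prob_zero_dominated)
       (use Vq_bounds in \<open>auto intro!: eventually_pos order_trans[OF _ abs_ge_self]\<close>)
next
  assume "conv_0 (Vq \<kappa> \<epsilon>)"
  then have "conv_0 (\<lambda>t \<omega>. 5 * Vq \<kappa> \<epsilon> t \<omega> + 10 * ((real (tightness_level \<omega>))\<^sup>2 / t))"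
    by (intro conv_in_prob_zero_add conv_in_prob_zero_cmult conv_tightness_level)
  then show "conv_0 (Sigq \<kappa> \<epsilon>)"
    by (rule conv_in_prob_zero_dominated)
       (use Sigq_le_Vq kernel_quantity_nonneg(2) in \<open>auto intro!: eventually_pos order_trans[OF _ abs_ge_self]\<close>)
qed

text \<open>Proportionality is available for positive levels only, hence the measurability of both
  families at every level as hypotheses.\<close>

lemma conv_0_scaled_iff:
  assumes X: "\<And>t. X t \<in> borel_measurable M" and Y: "\<And>t. Y t \<in> borel_measurable M" and "c \<noteq> 0"
    and eq: "\<And>t \<omega>. 0 < t \<Longrightarrow> \<omega> \<in> space M \<Longrightarrow> X t \<omega> = c * Y t \<omega>"
  shows "conv_0 X \<longleftrightarrow> conv_0 Y"
proof
  assume "conv_0 X"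
  from conv_in_prob_zero_cmult[OF this, of "1 / c"] show "conv_0 Y"
    by (rule conv_in_prob_zero_dominated[OF _ Y]) (use eq \<open>c \<noteq> 0\<close> in \<open>auto intro!: eventually_pos simp: abs_mult\<close>)
next
  assume "conv_0 Y"
  from conv_in_prob_zero_cmult[OF this, of c] show "conv_0 X"
    by (rule conv_in_prob_zero_dominated[OF _ X]) (use eq in \<open>auto intro!: eventually_pos\<close>)
qed

lemma conv_integral_Tq_iff:
  assumes "0 < \<epsilon>"
  shows "conv_0 (\<lambda>m \<omega>. (1 / m) * (LBINT t=0..m. Tq \<kappa> \<epsilon> t \<omega>)) \<longleftrightarrow> conv_0 (Rq \<kappa> \<epsilon>)"
proof (rule conv_0_scaled_iff[where c = "1 / (2 * \<epsilon>\<^sup>2)"])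
  show "(\<lambda>\<omega>. (1 / m) * interval_lebesgue_integral lborel 0 (ereal m) (\<lambda>t. Tq \<kappa> \<epsilon> t \<omega>)) \<in> borel_measurable M" for m
    by (intro borel_measurable_times borel_measurable_const interval_integral_measurable) measurable
qed (use assms in \<open>simp_all only: integral_Tq, simp_all\<close>)

lemma conv_integral_Sigq_iff:
  assumes "0 < \<epsilon>"
  shows "conv_0 (\<lambda>m \<omega>. m * (LBINT t=ereal m..\<infinity>. Sigq \<kappa> \<epsilon> t \<omega> / t\<^sup>2)) \<longleftrightarrow> conv_0 (Rq \<kappa> \<epsilon>)"
proof (rule conv_0_scaled_iff[where c = "1 / 2"])
  show "(\<lambda>\<omega>. m * (LBINT t=ereal m..\<infinity>. Sigq \<kappa> \<epsilon> t \<omega> / t\<^sup>2)) \<in> borel_measurable M" for m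
    by (intro borel_measurable_times borel_measurable_const interval_integral_measurable) measurable
qed (use assms in \<open>simp_all only: integral_Sigq(2), simp_all\<close>)

lemma conv_integral_Vq_iff:
  assumes "0 < \<epsilon>"
  shows "conv_0 (\<lambda>m \<omega>. m * (LBINT t=ereal m..\<infinity>. Vq \<kappa> \<epsilon> t \<omega> / t\<^sup>2)) \<longleftrightarrow> conv_0 (Rq \<kappa> \<epsilon>)"
proof
  assume "conv_0 (\<lambda>m \<omega>. m * (LBINT t=ereal m..\<infinity>. Vq \<kappa> \<epsilon> t \<omega> / t\<^sup>2))"
  then have "conv_0 (\<lambda>m \<omega>. 10 * (m * (LBINT t=ereal m..\<infinity>. Vq \<kappa> \<epsilon> t \<omega> / t\<^sup>2)) + 10 * ((real (tightness_level \<omega>))\<^sup>2 / m))"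
    by (intro conv_in_prob_zero_add conv_in_prob_zero_cmult conv_tightness_level)
  then show "conv_0 (Rq \<kappa> \<epsilon>)"
  proof (rule conv_in_prob_zero_dominated)
    show "\<forall>\<^sub>F m in at_top. \<forall>\<omega>\<in>space M. \<bar>Rq \<kappa> \<epsilon> m \<omega>\<bar>
        \<le> \<bar>10 * (m * (LBINT t=ereal m..\<infinity>. Vq \<kappa> \<epsilon> t \<omega> / t\<^sup>2)) + 10 * ((real (tightness_level \<omega>))\<^sup>2 / m)\<bar>"
    proof (rule eventually_pos, intro ballI)
      fix m \<omega> assume "0 < (m :: real)" "\<omega> \<in> space M"
      with integral_Vq_bounds(3)[OF this(2) assms this(1)] kernel_quantity_nonneg(3)[of m \<epsilon> \<omega>]
      show "\<bar>Rq \<kappa> \<epsilon> m \<omega>\<bar> \<le> \<bar>10 * (m * (LBINT t=ereal m..\<infinity>. Vq \<kappa> \<epsilon> t \<omega> / t\<^sup>2)) + 10 * ((real (tightness_level \<omega>))\<^sup>2 / m)\<bar>"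
        by simp
    qed
  qed measurable
next
  assume "conv_0 (Rq \<kappa> \<epsilon>)"
  then show "conv_0 (\<lambda>m \<omega>. m * (LBINT t=ereal m..\<infinity>. Vq \<kappa> \<epsilon> t \<omega> / t\<^sup>2))"
  proof (rule conv_in_prob_zero_dominated)
    show "(\<lambda>\<omega>. m * (LBINT t=ereal m..\<infinity>. Vq \<kappa> \<epsilon> t \<omega> / t\<^sup>2)) \<in> borel_measurable M" for m
      by (intro borel_measurable_times borel_measurable_const interval_integral_measurable) measurable
    show "\<forall>\<^sub>F m in at_top. \<forall>\<omega>\<in>space M. \<bar>m * (LBINT t=ereal m..\<infinity>. Vq \<kappa> \<epsilon> t \<omega> / t\<^sup>2)\<bar> \<le> \<bar>Rq \<kappa> \<epsilon> m \<omega>\<bar>"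
    proof (rule eventually_pos, intro ballI)
      fix m \<omega> assume "0 < (m :: real)" "\<omega> \<in> space M"
      with integral_Vq_bounds(1,2)[OF this(2) assms this(1)] kernel_quantity_nonneg(3)[of m \<epsilon> \<omega>]
      show "\<bar>m * (LBINT t=ereal m..\<infinity>. Vq \<kappa> \<epsilon> t \<omega> / t\<^sup>2)\<bar> \<le> \<bar>Rq \<kappa> \<epsilon> m \<omega>\<bar>"
        by linarith
    qed
  qed
qed

lemma cond_i_iff_conv_in_prob:
  assumes "\<And>N. D N \<in> borel_measurable M"
  shows "cond_i M g D \<longleftrightarrow> conv_in_prob M sequentially (\<lambda>N \<omega>. (\<Sum>n<N. g n \<omega>) / real N - D N \<omega>) (\<lambda>_. 0)"
  unfolding cond_i_def conv_in_prob_def using assms by simp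

text \<open>The expectation of a conditional probability is the unconditional one. Since conditional
  probabilities are nonnegative and at most 1, tending to zero in probability and in mean are the
  same for them.\<close>

lemma cond_i'_iff_cond_i:
  assumes [measurable]: "\<And>N. D N \<in> borel_measurable M"
  shows "cond_i' M g D \<longleftrightarrow> cond_i M g D"
proof -
  interpret T: finite_measure_subalgebra M "tail_sigma M g" by standard (rule subalgebra_tail_sigma)
  have "conv_in_prob M sequentially
       (\<lambda>N. real_cond_exp M (tail_sigma M g)
          (indicator {\<omega>\<in>space M. \<epsilon> < \<bar>(\<Sum>n<N. g n \<omega>) / real N - D N \<omega>\<bar>})) (\<lambda>_. 0)
    \<longleftrightarrow> (\<lambda>N. prob {\<omega>\<in>space M. \<epsilon> < \<bar>(\<Sum>n<N. g n \<omega>) / real N - D N \<omega>\<bar>}) \<longlonglongrightarrow> 0"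
    (is "conv_in_prob M sequentially (\<lambda>N. ?E (?A N)) (\<lambda>_. 0) \<longleftrightarrow> _") for \<epsilon>
  proof -
    have [measurable]: "?A N \<in> sets M" for N by measurable
    have int: "integrable M (indicator (?A N) :: _ \<Rightarrow> real)" for N
      by (simp add: emeasure_eq_measure)
    have E: "expectation (?E (?A N)) = prob (?A N)" for N
      using T.real_cond_exp_int(2)[OF int] by simp
    have pos: "AE \<omega> in M. 0 \<le> ?E (?A N) \<omega>" for N
      by (rule T.real_cond_exp_ge_c[OF int]) simp
    have le1: "AE \<omega> in M. ?E (?A N) \<omega> \<le> 1" for N
      by (rule T.real_cond_exp_le_c[OF int]) (simp add: indicator_le_1)
    have bnd: "AE \<omega> in M. \<bar>?E (?A N) \<omega>\<bar> \<le> 1" for N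
      using pos[of N] le1[of N] by eventually_elim simp
    show ?thesis
    proof
      assume "conv_in_prob M sequentially (\<lambda>N. ?E (?A N)) (\<lambda>_. 0)"
      from expectation_tendsto_zero_if_conv_in_prob[OF this bnd] show "(\<lambda>N. prob (?A N)) \<longlonglongrightarrow> 0"
        unfolding E .
    next
      assume lim: "(\<lambda>N. prob (?A N)) \<longlonglongrightarrow> 0"
      show "conv_in_prob M sequentially (\<lambda>N. ?E (?A N)) (\<lambda>_. 0)"
        by (rule conv_in_prob_zero_expectation[OF T.real_cond_exp_int(1)[OF int] pos]) (unfold E, rule lim)
    qed
  qed
  then show ?thesis unfolding cond_i_def cond_i'_def by auto
qed

section \<open>Conditional variance and the weak law\<close>

lemma tail_measurable_imp: "X \<in> measurable (tail_sigma M g) N \<Longrightarrow> X \<in> measurable M N"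
  by (rule measurable_from_subalg[OF subalgebra_tail_sigma])

lemma kernel_integral_tail_measurable:
  fixes f :: "real \<Rightarrow> 'b :: {banach, second_countable_topology}"
  assumes "f \<in> borel_measurable borel"
  shows "(\<lambda>\<omega>. \<integral>x. f x \<partial>\<kappa> \<omega>) \<in> borel_measurable (tail_sigma M g)"
  by (rule measurable_compose[OF kernel_tail_measurable integral_measurable_subprob_algebra[OF assms]])

lemma measurable_tail_sigma_tail_after:
  "X \<in> measurable (tail_sigma M g) N \<Longrightarrow> X \<in> measurable (tail_after M g k) N"
  using sets_tail_after_mono[of 0 k M g]
  by (auto intro!: measurable_from_subalg[of "tail_after M g k" "tail_sigma M g"] simp: subalgebra_def tail_after_0)

text \<open>Given the tail, the centred summands are orthogonal; a tail event \<open>A\<close>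
  stands in for conditioning. Adding a term produces cross products of the previous sum with the new
  centred term, and these vanish by \<open>expectation_mult_kernel\<close>, whose weight may contain
  the past and the indicator of \<open>A\<close> together.\<close>

lemma conditional_variance_of_sum:
  fixes f :: "real \<Rightarrow> real"
  assumes A: "A \<in> sets (tail_sigma M g)"
    and f[measurable]: "f \<in> borel_measurable borel" and fC: "\<And>x. \<bar>f x\<bar> \<le> C"
  defines "m \<equiv> \<lambda>\<omega>. \<integral>x. f x \<partial>\<kappa> \<omega>"
  shows "expectation (\<lambda>\<omega>. indicator A \<omega> * (\<Sum>n<k. f (g n \<omega>) - m \<omega>)\<^sup>2)
    = real k * expectation (\<lambda>\<omega>. indicator A \<omega> * ((\<integral>x. (f x)\<^sup>2 \<partial>\<kappa> \<omega>) - (m \<omega>)\<^sup>2))"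
proof -
  have A_M[measurable]: "A \<in> sets M" using A subalgebra_tail_sigma by (auto simp: subalgebra_def)
  have m_T: "m \<in> borel_measurable (tail_sigma M g)"
    unfolding m_def by (rule kernel_integral_tail_measurable) fact
  have [measurable]: "m \<in> borel_measurable M" by (rule tail_measurable_imp) fact
  have f2C: "\<bar>(f x)\<^sup>2\<bar> \<le> C\<^sup>2" for x using fC[of x] by (simp add: abs_le_square_iff[symmetric])
  have mC: "\<bar>m \<omega>\<bar> \<le> C" if "\<omega> \<in> space M" for \<omega> unfolding m_def by (rule abs_kernel_integral_le(2)[OF that f fC])
  let ?S = "\<lambda>k \<omega>. \<Sum>n<k. f (g n \<omega>) - m \<omega>"
  have SC: "\<bar>?S k \<omega>\<bar> \<le> real k * (2 * C)" if "\<omega> \<in> space M" for k \<omega>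
  proof -
    have "\<bar>?S k \<omega>\<bar> \<le> (\<Sum>n<k. 2 * C)"
    proof (intro order_trans[OF sum_abs] sum_mono)
      fix n show "\<bar>f (g n \<omega>) - m \<omega>\<bar> \<le> 2 * C" using fC[of "g n \<omega>"] mC[OF that] by linarith
    qed
    then show ?thesis by simp
  qed
  have bounded_int: "integrable M X" if "X \<in> borel_measurable M" "\<And>\<omega>. \<omega> \<in> space M \<Longrightarrow> \<bar>X \<omega>\<bar> \<le> B"
    for X and B :: real
    by (rule integrable_const_bound[of _ B]) (use that in auto)
  have ind: "\<bar>indicator A \<omega> * x\<bar> \<le> \<bar>x\<bar>" for \<omega> and x :: real by (simp split: split_indicator)
  show ?thesis
  proof (induction k)
    case (Suc k)
    let ?Y = "\<lambda>\<omega>. f (g k \<omega>)"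
    have ind_T: "indicator A \<in> borel_measurable (tail_sigma M g)" using A by simp
    have Z: "(\<lambda>\<omega>. indicator A \<omega> * ?S k \<omega>) \<in> borel_measurable (tail_after M g k)"
    proof -
      note [measurable] = measurable_tail_sigma_tail_after[OF m_T, of k] measurable_tail_sigma_tail_after[OF ind_T, of k]
      have [measurable]: "n < k \<Longrightarrow> g n \<in> borel_measurable (tail_after M g k)" for n by (rule measurable_tail_after)
      show ?thesis by measurable
    qed
    have Zb: "\<bar>indicator A \<omega> * ?S k \<omega>\<bar> \<le> real k * (2 * C)" if "\<omega> \<in> space M" for \<omega>
      by (rule order_trans[OF ind SC[OF that]])
    have prod_bound: "\<bar>x * y\<bar> \<le> a * b" if "\<bar>x\<bar> \<le> a" "\<bar>y\<bar> \<le> b" for x y a b :: real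
      using that by (simp add: abs_mult) (intro mult_mono, auto)
    have int1: "integrable M (\<lambda>\<omega>. indicator A \<omega> * ?S k \<omega> * ?Y \<omega>)"
      "integrable M (\<lambda>\<omega>. indicator A \<omega> * ?S k \<omega> * m \<omega>)"
      by (rule bounded_int[of _ "real k * (2 * C) * C"], measurable, intro prod_bound Zb fC mC, assumption+)+
    have int2: "integrable M (\<lambda>\<omega>. indicator A \<omega> * m \<omega> * ?Y \<omega>)" "integrable M (\<lambda>\<omega>. indicator A \<omega> * m \<omega> * m \<omega>)"
      by (rule bounded_int[of _ "C * C"], measurable, intro prod_bound order_trans[OF ind] fC mC, assumption+)+
    have int3: "integrable M (\<lambda>\<omega>. indicator A \<omega> * (?Y \<omega>)\<^sup>2)"
      by (rule bounded_int[of _ "C\<^sup>2"]) (measurable, rule order_trans[OF ind f2C])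
    have int4: "integrable M (\<lambda>\<omega>. indicator A \<omega> * (?S k \<omega>)\<^sup>2)"
    proof (rule bounded_int[of _ "(real k * (2 * C)) * (real k * (2 * C))"])
      fix \<omega> assume "\<omega> \<in> space M"
      then have "\<bar>?S k \<omega> * ?S k \<omega>\<bar> \<le> (real k * (2 * C)) * (real k * (2 * C))"
        by (intro prod_bound SC)
      then show "\<bar>indicator A \<omega> * (?S k \<omega>)\<^sup>2\<bar> \<le> (real k * (2 * C)) * (real k * (2 * C))"
        unfolding power2_eq_square by (rule order_trans[OF ind])
    qed measurable
    have int5: "integrable M (\<lambda>\<omega>. indicator A \<omega> * (\<integral>x. (f x)\<^sup>2 \<partial>\<kappa> \<omega>))"
      by (rule bounded_int[of _ "C\<^sup>2"]) (measurable, rule order_trans[OF ind], rule abs_kernel_integral_le(2)[OF _ _ f2C], auto)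
    have e1: "expectation (\<lambda>\<omega>. indicator A \<omega> * ?S k \<omega> * ?Y \<omega>) = expectation (\<lambda>\<omega>. indicator A \<omega> * ?S k \<omega> * m \<omega>)"
      unfolding m_def by (rule expectation_mult_kernel[OF Z[unfolded m_def] Zb[unfolded m_def] f fC])
    have "(\<lambda>\<omega>. indicator A \<omega> * m \<omega>) \<in> borel_measurable (tail_after M g k)"
      using measurable_tail_sigma_tail_after[OF m_T, of k] measurable_tail_sigma_tail_after[OF ind_T, of k]
      by (intro borel_measurable_times)
    from expectation_mult_kernel[OF this _ f fC, of C]
    have e2: "expectation (\<lambda>\<omega>. indicator A \<omega> * m \<omega> * ?Y \<omega>) = expectation (\<lambda>\<omega>. indicator A \<omega> * m \<omega> * m \<omega>)"
      using order_trans[OF ind mC] unfolding m_def by simp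
    from expectation_mult_kernel[OF measurable_tail_sigma_tail_after[OF ind_T], of 1 "\<lambda>x. (f x)\<^sup>2" "C\<^sup>2"]
    have e3: "expectation (\<lambda>\<omega>. indicator A \<omega> * (?Y \<omega>)\<^sup>2) = expectation (\<lambda>\<omega>. indicator A \<omega> * (\<integral>x. (f x)\<^sup>2 \<partial>\<kappa> \<omega>))"
      using f2C by simp
    have "expectation (\<lambda>\<omega>. indicator A \<omega> * (?S (Suc k) \<omega>)\<^sup>2)
        = expectation (\<lambda>\<omega>. indicator A \<omega> * (?S k \<omega>)\<^sup>2
          + (2 * (indicator A \<omega> * ?S k \<omega> * ?Y \<omega>) - 2 * (indicator A \<omega> * ?S k \<omega> * m \<omega>)
          + (indicator A \<omega> * (?Y \<omega>)\<^sup>2 - 2 * (indicator A \<omega> * m \<omega> * ?Y \<omega>) + indicator A \<omega> * m \<omega> * m \<omega>)))"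
      by (intro Bochner_Integration.integral_cong refl) (simp add: power2_eq_square algebra_simps)
    also have "\<dots> = expectation (\<lambda>\<omega>. indicator A \<omega> * (?S k \<omega>)\<^sup>2)
        + (expectation (\<lambda>\<omega>. indicator A \<omega> * (\<integral>x. (f x)\<^sup>2 \<partial>\<kappa> \<omega>)) - expectation (\<lambda>\<omega>. indicator A \<omega> * m \<omega> * m \<omega>))"
      using int1 int2 int3 int4 e1 e2 e3 by simp
    also have "expectation (\<lambda>\<omega>. indicator A \<omega> * (\<integral>x. (f x)\<^sup>2 \<partial>\<kappa> \<omega>)) - expectation (\<lambda>\<omega>. indicator A \<omega> * m \<omega> * m \<omega>)
        = expectation (\<lambda>\<omega>. indicator A \<omega> * ((\<integral>x. (f x)\<^sup>2 \<partial>\<kappa> \<omega>) - (m \<omega>)\<^sup>2))"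
      using int5 int2 by (simp flip: Bochner_Integration.integral_diff) (simp add: power2_eq_square algebra_simps)
    finally show ?case using Suc.IH by (simp add: algebra_simps)
  qed simp
qed

lemma Delta_tail_measurable: "Delta \<kappa> t \<in> borel_measurable (tail_sigma M g)"
  unfolding Delta_def[abs_def] by (rule kernel_integral_tail_measurable) measurable

lemma Sigq_tail_measurable: "Sigq \<kappa> \<epsilon> t \<in> borel_measurable (tail_sigma M g)"
  unfolding Sigq_def[abs_def]
  by (intro borel_measurable_times borel_measurable_const kernel_integral_tail_measurable) measurable

lemma Tq_tail_measurable: "Tq \<kappa> \<epsilon> t \<in> borel_measurable (tail_sigma M g)"
  using cond_distr unfolding Tq_def[abs_def] is_cond_distr_def
  by (intro borel_measurable_times borel_measurable_const) auto

text \<open>Truncate at level \<open>N\<close> and apply Chebyshev's inequality conditionally, on the tail event where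
  the conditional quantities are at most \<open>\<delta>\<close>.\<close>

lemma weak_law_bound:
  fixes N :: nat
  assumes N: "0 < N" and "0 < \<delta>" "0 < \<eta>"
  shows "prob {\<omega>\<in>space M. \<eta> < \<bar>(\<Sum>n<N. g n \<omega>) / real N - Delta \<kappa> (real N) \<omega>\<bar>}
    \<le> prob {\<omega>\<in>space M. \<delta> < \<bar>Tq \<kappa> 1 (real N) \<omega> - 0\<bar>} + prob {\<omega>\<in>space M. \<delta> < \<bar>Sigq \<kappa> 1 (real N) \<omega> - 0\<bar>}
      + \<delta> + \<delta> / \<eta>\<^sup>2"
proof -
  let ?D = "Delta \<kappa> (real N)" and ?T = "Tq \<kappa> 1 (real N)" and ?S = "Sigq \<kappa> 1 (real N)"
  note [measurable] = tail_measurable_imp[OF Delta_tail_measurable]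
  \<comment> \<open>A tail event, so its indicator may be carried through the conditional identities
    for first and second moments; outside it \<open>?B1\<close> or \<open>?B2\<close>
    occurs.\<close>
  define A where "A = {\<omega>\<in>space M. ?T \<omega> \<le> \<delta> \<and> ?S \<omega> \<le> \<delta>}"
  have A: "A \<in> sets (tail_sigma M g)"
  proof -
    note [measurable] = Tq_tail_measurable Sigq_tail_measurable
    have "{\<omega>\<in>space (tail_sigma M g). ?T \<omega> \<le> \<delta> \<and> ?S \<omega> \<le> \<delta>} \<in> sets (tail_sigma M g)" by measurable
    then show ?thesis by (simp add: A_def)
  qed
  have A_M[measurable]: "A \<in> sets M" using A subalgebra_tail_sigma by (auto simp: subalgebra_def)
  define f where "f x = x * indicator {x. \<bar>x\<bar> \<le> real N} x" for x :: real
  have f[measurable]: "f \<in> borel_measurable borel" unfolding f_def by measurable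
  have fN: "\<bar>f x\<bar> \<le> real N" for x by (auto simp: f_def split: split_indicator)
  have D_eq: "?D \<omega> = (\<integral>x. f x \<partial>\<kappa> \<omega>)" for \<omega> by (simp add: Delta_def f_def)
  have DN: "\<bar>?D \<omega>\<bar> \<le> real N" if "\<omega> \<in> space M" for \<omega>
    unfolding D_eq by (rule abs_kernel_integral_le(2)[OF that f fN])
  let ?W = "\<lambda>\<omega>. \<Sum>n<N. f (g n \<omega>) - ?D \<omega>"
  let ?B1 = "{\<omega>\<in>space M. \<delta> < \<bar>?T \<omega> - 0\<bar>}" and ?B2 = "{\<omega>\<in>space M. \<delta> < \<bar>?S \<omega> - 0\<bar>}"
  \<comment> \<open>\<open>?B3\<close> is the event that truncation alters some summand,
    \<open>?B4\<close> the Chebyshev event for the truncated sum. Both are confined to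
    \<open>A\<close>, where the conditional quantities are under control.\<close>
  let ?B3 = "\<Union>n<N. A \<inter> {\<omega>\<in>space M. real N < \<bar>g n \<omega>\<bar>}"
  let ?B4 = "{\<omega>\<in>space M. (\<eta> * real N)\<^sup>2 \<le> indicator A \<omega> * (?W \<omega>)\<^sup>2}"
  have sub: "{\<omega>\<in>space M. \<eta> < \<bar>(\<Sum>n<N. g n \<omega>) / real N - ?D \<omega>\<bar>} \<subseteq> (?B1 \<union> ?B2) \<union> (?B3 \<union> ?B4)"
  proof
    fix \<omega> assume "\<omega> \<in> {\<omega>\<in>space M. \<eta> < \<bar>(\<Sum>n<N. g n \<omega>) / real N - ?D \<omega>\<bar>}"
    then have \<omega>: "\<omega> \<in> space M" "\<eta> < \<bar>(\<Sum>n<N. g n \<omega>) / real N - ?D \<omega>\<bar>" by auto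
    show "\<omega> \<in> (?B1 \<union> ?B2) \<union> (?B3 \<union> ?B4)"
    proof (cases "\<omega> \<in> ?B1 \<union> ?B2 \<or> \<omega> \<in> ?B3")
      case False
      then have "\<omega> \<in> A" using \<omega>(1) by (auto simp: A_def)
      with False \<omega>(1) have "\<bar>g n \<omega>\<bar> \<le> real N" if "n < N" for n using that by force
      then have "?W \<omega> = (\<Sum>n<N. g n \<omega> - ?D \<omega>)" by (intro sum.cong) (auto simp: f_def)
      also have "\<dots> = real N * ((\<Sum>n<N. g n \<omega>) / real N - ?D \<omega>)"
        using N by (simp add: sum_subtractf algebra_simps)
      finally have "\<bar>?W \<omega>\<bar> = real N * \<bar>(\<Sum>n<N. g n \<omega>) / real N - ?D \<omega>\<bar>" by (simp add: abs_mult)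
      also have "\<dots> \<ge> real N * \<eta>" using \<omega>(2) by (intro mult_left_mono) auto
      finally have "(\<eta> * real N)\<^sup>2 \<le> (?W \<omega>)\<^sup>2"
        using \<open>0 < \<eta>\<close> by (subst abs_le_square_iff[symmetric]) (simp add: abs_mult mult.commute)
      with \<omega>(1) \<open>\<omega> \<in> A\<close> show ?thesis by simp
    qed auto
  qed
  have "prob {\<omega>\<in>space M. \<eta> < \<bar>(\<Sum>n<N. g n \<omega>) / real N - ?D \<omega>\<bar>} \<le> prob ((?B1 \<union> ?B2) \<union> (?B3 \<union> ?B4))"
    by (rule finite_measure_mono[OF sub]) measurable
  also have "\<dots> \<le> (prob ?B1 + prob ?B2) + (prob ?B3 + prob ?B4)"
    by (intro order_trans[OF measure_Un_le] add_mono order_refl) measurable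
  finally have main: "prob {\<omega>\<in>space M. \<eta> < \<bar>(\<Sum>n<N. g n \<omega>) / real N - ?D \<omega>\<bar>}
      \<le> (prob ?B1 + prob ?B2) + (prob ?B3 + prob ?B4)" .
  have B3: "prob ?B3 \<le> \<delta>"
  proof -
    let ?h = "indicator {x. real N < \<bar>x\<bar>} :: real \<Rightarrow> real"
    have h_eq: "(\<integral>x. ?h x \<partial>\<kappa> \<omega>) = ?T \<omega> / real N" if "\<omega> \<in> space M" for \<omega>
    proof -
      interpret \<kappa>: real_distribution "\<kappa> \<omega>" by (rule real_distribution_kernel) fact
      show ?thesis using N by (simp add: Tq_def)
    qed
    \<comment> \<open>On \<open>A\<close> the conditional tail probability at level \<open>N\<close>
      is at most \<open>\<delta> / N\<close>; the union bound over \<open>N\<close> terms then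
      restores \<delta>.\<close>
    have "prob (A \<inter> {\<omega>\<in>space M. real N < \<bar>g n \<omega>\<bar>}) \<le> \<delta> / real N" for n
    proof -
      have "prob (A \<inter> {\<omega>\<in>space M. real N < \<bar>g n \<omega>\<bar>}) = expectation (indicator (A \<inter> {\<omega>\<in>space M. real N < \<bar>g n \<omega>\<bar>}))"
        by simp
      also have "\<dots> = expectation (\<lambda>\<omega>. indicator A \<omega> * ?h (g n \<omega>))"
        by (intro Bochner_Integration.integral_cong refl) (auto split: split_indicator)
      also have "\<dots> = expectation (\<lambda>\<omega>. indicator A \<omega> * (\<integral>x. ?h x \<partial>\<kappa> \<omega>))"
        by (rule expectation_mult_kernel[where B = 1 and C = 1])
           (use A in \<open>auto intro!: measurable_tail_sigma_tail_after split: split_indicator\<close>)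
      also have "\<dots> \<le> expectation (\<lambda>\<omega>. \<delta> / real N)"
      proof (rule Bochner_Integration.integral_mono)
        show "integrable M (\<lambda>\<omega>. indicator A \<omega> * (\<integral>x. ?h x \<partial>\<kappa> \<omega>))"
        proof (rule integrable_const_bound[of _ 1])
          have "\<bar>\<integral>x. ?h x \<partial>\<kappa> \<omega>\<bar> \<le> 1" if "\<omega> \<in> space M" for \<omega>
            by (rule abs_kernel_integral_le(2)[OF that]) (auto split: split_indicator)
          then show "AE \<omega> in M. norm (indicator A \<omega> * (\<integral>x. ?h x \<partial>\<kappa> \<omega>)) \<le> 1"
            by (auto split: split_indicator)
        qed measurable
        fix \<omega> assume "\<omega> \<in> space M"
        then show "indicator A \<omega> * (\<integral>x. ?h x \<partial>\<kappa> \<omega>) \<le> \<delta> / real N"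
          using \<open>0 < \<delta>\<close> N unfolding h_eq[OF \<open>\<omega> \<in> space M\<close>]
          by (auto simp: A_def divide_right_mono split: split_indicator)
      qed simp
      finally show ?thesis by (simp add: prob_space)
    qed
    then have "(\<Sum>n<N. prob (A \<inter> {\<omega>\<in>space M. real N < \<bar>g n \<omega>\<bar>})) \<le> (\<Sum>n<N. \<delta> / real N)"
      by (intro sum_mono)
    also have "\<dots> = \<delta>" using N by simp
    finally show ?thesis
      by (intro order_trans[OF finite_measure_subadditive_finite]) auto
  qed
  have B4: "prob ?B4 \<le> \<delta> / \<eta>\<^sup>2"
  proof -
    have W_bound: "(?W \<omega>)\<^sup>2 \<le> (real N * (2 * real N))\<^sup>2" if "\<omega> \<in> space M" for \<omega>
    proof -
      have "\<bar>?W \<omega>\<bar> \<le> (\<Sum>n<N. 2 * real N)"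
      proof (intro order_trans[OF sum_abs] sum_mono)
        fix n show "\<bar>f (g n \<omega>) - ?D \<omega>\<bar> \<le> 2 * real N" using fN[of "g n \<omega>"] DN[OF that] by linarith
      qed
      then show ?thesis by (subst abs_le_square_iff[symmetric]) simp
    qed
    have int: "integrable M (\<lambda>\<omega>. indicator A \<omega> * (?W \<omega>)\<^sup>2)"
      by (rule integrable_const_bound[of _ "(real N * (2 * real N))\<^sup>2"])
         (auto intro!: AE_I2 W_bound split: split_indicator)
    have "prob ?B4 \<le> expectation (\<lambda>\<omega>. indicator A \<omega> * (?W \<omega>)\<^sup>2) / (\<eta> * real N)\<^sup>2"
      by (rule integral_Markov_inequality_measure[OF int, where A = "{}"]) (use N \<open>0 < \<eta>\<close> in auto)
    also have "expectation (\<lambda>\<omega>. indicator A \<omega> * (?W \<omega>)\<^sup>2)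
        = real N * expectation (\<lambda>\<omega>. indicator A \<omega> * ((\<integral>x. (f x)\<^sup>2 \<partial>\<kappa> \<omega>) - (?D \<omega>)\<^sup>2))"
      unfolding D_eq by (rule conditional_variance_of_sum[OF A f fN])
    \<comment> \<open>Dropping the squared mean leaves \<open>N\<close> times \<open>Sigq\<close>,
      at most \<open>N * \<delta>\<close> on \<open>A\<close>. Together with the \<open>N\<close>
      summands this gives \<open>N\<^sup>2 * \<delta>\<close>, and the Chebyshev denominator cancels
      the square.\<close>
    also have "expectation (\<lambda>\<omega>. indicator A \<omega> * ((\<integral>x. (f x)\<^sup>2 \<partial>\<kappa> \<omega>) - (?D \<omega>)\<^sup>2)) \<le> expectation (\<lambda>\<omega>. real N * \<delta>)"
    proof (rule integral_mono')
      fix \<omega> assume \<omega>: "\<omega> \<in> space M"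
      have "(\<integral>x. (f x)\<^sup>2 \<partial>\<kappa> \<omega>) = real N * ?S \<omega>" using N by (simp add: Sigq_def f_def)
      then show "indicator A \<omega> * ((\<integral>x. (f x)\<^sup>2 \<partial>\<kappa> \<omega>) - (?D \<omega>)\<^sup>2) \<le> real N * \<delta>"
        using N \<open>0 < \<delta>\<close> mult_left_mono[of "?S \<omega>" \<delta> "real N"]
        by (auto simp: A_def intro: order_trans[of _ "real N * ?S \<omega>"] split: split_indicator)
    qed (use N \<open>0 < \<delta>\<close> in auto)
    finally show ?thesis
      using N \<open>0 < \<eta>\<close> by (simp add: prob_space field_simps power2_eq_square)
  qed
  show ?thesis using main B3 B4 by linarith
qed

theorem cond_i_Delta:
  assumes T: "conv_0 (Tq \<kappa> 1)" and S: "conv_0 (Sigq \<kappa> 1)"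
  shows "cond_i M g (\<lambda>N. Delta \<kappa> (real N))"
  unfolding cond_i_def
proof (intro allI impI tendstoI)
  fix \<eta> e :: real assume "0 < \<eta>" "0 < e"
  \<comment> \<open>Chosen so that
    \<open>\<delta> + \<delta> / \<eta>\<^sup>2 = \<delta> * c\<close> is a quarter of
    \<open>e\<close>; two further quarters go to the exceptional events for \<open>Tq\<close> and
    \<open>Sigq\<close>.\<close>
  define c where "c = 1 + 1 / \<eta>\<^sup>2"
  have "0 < c" by (simp add: c_def add_pos_nonneg)
  define \<delta> where "\<delta> = e / (4 * c)"
  have \<delta>: "0 < \<delta>" using \<open>0 < e\<close> \<open>0 < c\<close> by (simp add: \<delta>_def)
  have "\<delta> + \<delta> / \<eta>\<^sup>2 = \<delta> * c" by (simp add: c_def algebra_simps)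
  also have "\<dots> = e / 4" using \<open>0 < c\<close> by (simp add: \<delta>_def)
  finally have \<delta>_eq: "\<delta> + \<delta> / \<eta>\<^sup>2 = e / 4" .
  have lim: "\<forall>\<^sub>F N in sequentially. prob {\<omega>\<in>space M. \<delta> < \<bar>X (real N) \<omega> - 0\<bar>} < e / 4"
    if "conv_0 X" for X
  proof -
    have "((\<lambda>t. prob {\<omega>\<in>space M. \<delta> < \<bar>X t \<omega> - 0\<bar>}) \<longlongrightarrow> 0) at_top"
      using that \<delta> unfolding conv_in_prob_def by blast
    from filterlim_compose[OF this filterlim_real_sequentially] show ?thesis
      using \<open>0 < e\<close> by (intro order_tendstoD) auto
  qed
  show "\<forall>\<^sub>F N in sequentially. dist (prob {\<omega>\<in>space M. \<eta> < \<bar>(\<Sum>n<N. g n \<omega>) / real N - Delta \<kappa> (real N) \<omega>\<bar>}) 0 < e"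
    using lim[OF T] lim[OF S] eventually_gt_at_top[of 0]
  proof eventually_elim
    case (elim N)
    with weak_law_bound[OF elim(3) \<delta> \<open>0 < \<eta>\<close>] \<delta>_eq \<open>0 < e\<close> show ?case
      by (simp add: dist_real_def)
  qed
qed

end

section \<open>Necessity: characteristic functions\<close>

lemma one_minus_cos_le: "1 - cos v \<le> 2 * min 1 (v\<^sup>2)" for v :: real
proof -
  have "1 - cos v = 2 * (sin (v / 2))\<^sup>2"
    using cos_double_sin[of "v / 2"] by simp
  moreover have "(sin (v / 2))\<^sup>2 \<le> (v / 2)\<^sup>2"
    using abs_sin_x_le_abs_x[of "v / 2"] by (simp only: abs_le_square_iff)
  moreover have "(v / 2)\<^sup>2 \<le> v\<^sup>2" by (simp add: power_divide)
  moreover have "(sin (v / 2))\<^sup>2 \<le> 1" using abs_sin_le_one[of "v / 2"] by (simp add: abs_square_le_1)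
  ultimately show ?thesis by simp
qed

text \<open>Up to 2 the Maclaurin bound gives \<open>1 - z\<^sup>2 / 6 + z ^ 4 / 120\<close>, and
  \<open>z\<^sup>2 \<le> 4\<close> absorbs the last term into \<open>z\<^sup>2 / 30\<close>, leaving
  more than \<open>z\<^sup>2 / 10\<close>. Beyond 2 the quotient is at most 1/2.\<close>

lemma sin_div_le:
  fixes z :: real
  assumes "0 < z"
  shows "sin z / z \<le> 1 - min 1 (z\<^sup>2) / 10"
proof (cases "z \<le> 2")
  case True
  have "\<bar>sin z - (\<Sum>m<5. sin_coeff m * z ^ m)\<bar> \<le> inverse (fact 5) * \<bar>z\<bar> ^ 5"
    by (rule Maclaurin_sin_bound)
  moreover have "(\<Sum>m<5. sin_coeff m * z ^ m) = z - z ^ 3 / 6"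
  proof -
    have "{..<5 :: nat} = {0, 1, 2, 3, 4}" by auto
    moreover have "sin_coeff 0 = 0" "sin_coeff 1 = 1" "sin_coeff 2 = 0" "sin_coeff 3 = - 1 / 6" "sin_coeff 4 = 0"
      by (simp_all add: sin_coeff_def fact_numeral)
    ultimately show ?thesis by simp
  qed
  moreover have "inverse (fact 5) * \<bar>z\<bar> ^ 5 = z ^ 5 / 120"
    using assms by (simp add: fact_numeral)
  ultimately have "sin z \<le> z - z ^ 3 / 6 + z ^ 5 / 120" by linarith
  then have "sin z / z \<le> (z - z ^ 3 / 6 + z ^ 5 / 120) / z"
    using assms by (intro divide_right_mono) auto
  also have "\<dots> = 1 - z\<^sup>2 / 6 + z\<^sup>2 * z\<^sup>2 / 120"
    using assms by (simp add: field_simps numeral_eq_Suc)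
  also have "z\<^sup>2 * z\<^sup>2 \<le> z\<^sup>2 * 4"
    using True assms power_mono[of z 2 2] by (intro mult_left_mono) auto
  finally show ?thesis using min.cobounded2[of 1 "z\<^sup>2"] zero_le_power2[of z] by linarith
next
  case False
  have "sin z / z \<le> 1 / 2" using False by (intro frac_le) auto
  then show ?thesis using min.cobounded1[of 1 "z\<^sup>2"] by linarith
qed

text \<open>The average over frequencies is taken as a probability measure on the Borel sets, so
  that the product and boundedness results for probability spaces apply to it.\<close>

definition unit_uniform :: "real measure" where
  "unit_uniform = density lborel (\<lambda>x. ennreal (indicator {0..1} x))"

lemma sets_unit_uniform [simp, measurable_cong]: "sets unit_uniform = sets borel"
  by (simp add: unit_uniform_def)

lemma space_unit_uniform [simp]: "space unit_uniform = UNIV"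
  by (simp add: unit_uniform_def)

lemma prob_space_unit_uniform: "prob_space unit_uniform"
proof (rule prob_spaceI)
  have "emeasure unit_uniform (space unit_uniform) = (\<integral>\<^sup>+x. indicator {0..1 :: real} x \<partial>lborel)"
    unfolding unit_uniform_def
    by (subst emeasure_density) (simp_all add: ennreal_indicator del: nn_integral_indicator)
  also have "\<dots> = emeasure lborel {0..1 :: real}" by (rule nn_integral_indicator) simp
  also have "\<dots> = 1" by simp
  finally show "emeasure unit_uniform (space unit_uniform) = 1" .
qed

lemma AE_unit_uniform: "AE x in unit_uniform. x \<in> {0..1}"
  unfolding unit_uniform_def by (subst AE_density) (auto split: split_indicator)

text \<open>The average is \<open>1 - sin z / z\<close>, which is even in \<open>z\<close>;
  \<open>sin_div_le\<close> at the absolute value supplies the tenth.\<close>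

lemma integral_unit_uniform_one_minus_cos:
  "min 1 (z\<^sup>2) / 10 \<le> (\<integral>\<theta>. 1 - cos (\<theta> * z) \<partial>unit_uniform)"
proof (cases "z = 0")
  case False
  have "(\<integral>\<theta>. 1 - cos (\<theta> * z) \<partial>unit_uniform) = (\<integral>\<theta>. (1 - cos (\<theta> * z)) * indicator {0..1} \<theta> \<partial>lborel)"
    unfolding unit_uniform_def by (subst integral_density) (auto simp: mult.commute)
  also have "\<dots> = (1 - sin (1 * z) / z) - (0 - sin (0 * z) / z)"
    by (rule integral_FTC_Icc_real) (use False in \<open>auto intro!: derivative_eq_intros continuous_intros\<close>)
  also have "\<dots> = 1 - sin \<bar>z\<bar> / \<bar>z\<bar>" using False by (simp add: abs_if)
  finally show ?thesis using sin_div_le[of "\<bar>z\<bar>"] False by simp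
qed simp

section \<open>Characteristic function and symmetrisation of a single distribution\<close>

context real_distribution
begin

text \<open>The analogue of \<open>Rq\<close> at \<epsilon> = 1 and t = N for the law of the
  difference of two independent copies.\<close>

definition sym_clip :: "nat \<Rightarrow> real" where
  "sym_clip N = (\<integral>p. (min \<bar>fst p - snd p\<bar> (real N))\<^sup>2 \<partial>(M \<Otimes>\<^sub>M M)) / real N"

lemma pair_prob_space_self: "pair_prob_space M M"
  by (simp add: pair_prob_space_def pair_sigma_finite_def prob_space_axioms sigma_finite_measure_axioms)

lemma integrable_pair_clip [simp]:
  "integrable (M \<Otimes>\<^sub>M M) (\<lambda>p. (min \<bar>fst p - snd p\<bar> (real N))\<^sup>2)"
proof -
  interpret P: pair_prob_space M M by (rule pair_prob_space_self)
  show ?thesis by (rule P.integrable_const_bound[of _ "(real N)\<^sup>2"]) (auto intro!: power_mono)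
qed

lemma integral_pair_product:
  fixes a :: "real \<Rightarrow> real"
  assumes [measurable]: "a \<in> borel_measurable borel" and a: "\<And>x. \<bar>a x\<bar> \<le> 1"
  shows "integrable (M \<Otimes>\<^sub>M M) (\<lambda>p. a (fst p) * a (snd p))"
    and "(\<integral>p. a (fst p) * a (snd p) \<partial>(M \<Otimes>\<^sub>M M)) = (\<integral>x. a x \<partial>M)\<^sup>2"
proof -
  interpret P: pair_prob_space M M by (rule pair_prob_space_self)
  show int: "integrable (M \<Otimes>\<^sub>M M) (\<lambda>p. a (fst p) * a (snd p))"
    by (rule P.integrable_const_bound[of _ 1]) (auto simp: abs_mult intro!: mult_le_one a)
  have "(\<integral>p. a (fst p) * a (snd p) \<partial>(M \<Otimes>\<^sub>M M)) = (\<integral>x. (\<integral>y. a x * a y \<partial>M) \<partial>M)"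
    using P.integral_fst'[OF int] by simp
  then show "(\<integral>p. a (fst p) * a (snd p) \<partial>(M \<Otimes>\<^sub>M M)) = (\<integral>x. a x \<partial>M)\<^sup>2"
    by (simp add: power2_eq_square)
qed

text \<open>The squared modulus is the characteristic function of the difference of two independent
  copies; this law is symmetric, so only the cosine remains.\<close>

lemma one_minus_cmod_char_sq:
  "1 - (cmod (char M u))\<^sup>2 = (\<integral>p. 1 - cos (u * (fst p - snd p)) \<partial>(M \<Otimes>\<^sub>M M))"
proof -
  interpret P: pair_prob_space M M by (rule pair_prob_space_self)
  have int: "integrable M (\<lambda>x. iexp (u * x))"
    by (rule integrable_const_bound[of _ 1]) auto
  have "Re (char M u) = (\<integral>x. cos (u * x) \<partial>M)"
    unfolding char_def using integral_Re[OF int] by (simp add: Re_exp)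
  moreover have "Im (char M u) = (\<integral>x. sin (u * x) \<partial>M)"
    unfolding char_def using integral_Im[OF int] by (simp add: Im_exp)
  ultimately have "(cmod (char M u))\<^sup>2 = (\<integral>p. cos (u * fst p) * cos (u * snd p) \<partial>(M \<Otimes>\<^sub>M M))
      + (\<integral>p. sin (u * fst p) * sin (u * snd p) \<partial>(M \<Otimes>\<^sub>M M))"
    by (simp add: cmod_power2 integral_pair_product(2)[of "\<lambda>x. cos (u * x)"] integral_pair_product(2)[of "\<lambda>x. sin (u * x)"])
  also have "\<dots> = (\<integral>p. cos (u * (fst p - snd p)) \<partial>(M \<Otimes>\<^sub>M M))"
    by (subst Bochner_Integration.integral_add[symmetric])
       (auto simp: integral_pair_product(1)[of "\<lambda>x. cos (u * x)"] integral_pair_product(1)[of "\<lambda>x. sin (u * x)"]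
         right_diff_distrib cos_diff)
  finally have "1 - (cmod (char M u))\<^sup>2 = 1 - (\<integral>p. cos (u * (fst p - snd p)) \<partial>(M \<Otimes>\<^sub>M M))" by simp
  also have "\<dots> = (\<integral>p. 1 - cos (u * (fst p - snd p)) \<partial>(M \<Otimes>\<^sub>M M))"
  proof (subst Bochner_Integration.integral_diff)
    show "integrable (M \<Otimes>\<^sub>M M) (\<lambda>p. cos (u * (fst p - snd p)))"
      by (rule P.integrable_const_bound[of _ 1]) auto
  qed (auto simp: P.prob_space)
  finally show ?thesis .
qed

lemma one_minus_cmod_char_sq_le:
  assumes "0 < N" "0 \<le> \<theta>" "\<theta> \<le> 1"
  shows "real N * (1 - (cmod (char M (\<theta> / real N)))\<^sup>2) \<le> 2 * sym_clip N"
proof -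
  interpret P: pair_prob_space M M by (rule pair_prob_space_self)
  have "(\<integral>p. 1 - cos (\<theta> / real N * (fst p - snd p)) \<partial>(M \<Otimes>\<^sub>M M))
      \<le> (\<integral>p. 2 / (real N)\<^sup>2 * (min \<bar>fst p - snd p\<bar> (real N))\<^sup>2 \<partial>(M \<Otimes>\<^sub>M M))"
  proof (rule Bochner_Integration.integral_mono)
    show "integrable (M \<Otimes>\<^sub>M M) (\<lambda>p. 1 - cos (\<theta> / real N * (fst p - snd p)))"
      by (rule P.integrable_const_bound[of _ 2]) (auto intro!: AE_I2 simp: abs_le_iff)
    fix p :: "real \<times> real"
    let ?d = "fst p - snd p"
    have "min 1 ((\<theta> / real N * ?d)\<^sup>2) \<le> (min \<bar>?d\<bar> (real N))\<^sup>2 / (real N)\<^sup>2"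
    proof (cases "\<bar>?d\<bar> \<le> real N")
      case True
      have "(\<theta> * ?d)\<^sup>2 \<le> ?d\<^sup>2"
        using assms by (subst abs_le_square_iff[symmetric]) (simp add: abs_mult mult_left_le_one_le)
      then have "(\<theta> * ?d)\<^sup>2 / (real N)\<^sup>2 \<le> ?d\<^sup>2 / (real N)\<^sup>2" by (rule divide_right_mono) simp
      with True show ?thesis by (simp add: power_divide min.coboundedI2)
    next
      case False
      then show ?thesis using assms by simp
    qed
    with one_minus_cos_le[of "\<theta> / real N * ?d"]
    show "1 - cos (\<theta> / real N * ?d) \<le> 2 / (real N)\<^sup>2 * (min \<bar>?d\<bar> (real N))\<^sup>2"
      by simp
  qed simp
  then have "real N * (1 - (cmod (char M (\<theta> / real N)))\<^sup>2)
      \<le> real N * (\<integral>p. 2 / (real N)\<^sup>2 * (min \<bar>fst p - snd p\<bar> (real N))\<^sup>2 \<partial>(M \<Otimes>\<^sub>M M))"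
    unfolding one_minus_cmod_char_sq using assms by (intro mult_left_mono) auto
  also have "\<dots> = 2 * sym_clip N"
    using assms by (simp add: sym_clip_def power2_eq_square)
  finally show ?thesis .
qed

lemma sym_clip_nonneg: "0 \<le> sym_clip N"
  by (simp add: sym_clip_def)

text \<open>Here \<open>c\<^sup>N \<le> exp (- s)\<close> with \<open>s = N (1 - c\<^sup>2) / 2\<close>, and \<open>s \<le> sym_clip N\<close> turns the lower bound
  \<open>s / (1 + s)\<close> into one that is linear in \<open>s\<close> and can be averaged over \<open>\<theta>\<close>.\<close>

lemma one_minus_cmod_char_power_ge:
  assumes "0 < N" "0 \<le> \<theta>" "\<theta> \<le> 1"
  shows "real N * (1 - (cmod (char M (\<theta> / real N)))\<^sup>2) / (2 * (1 + sym_clip N))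
    \<le> 1 - (cmod (char M (\<theta> / real N))) ^ N"
proof -
  define c where "c = cmod (char M (\<theta> / real N))"
  define s where "s = real N * (1 - c\<^sup>2) / 2"
  have c: "0 \<le> c" "c \<le> 1" by (auto simp: c_def cmod_char_le_1)
  then have "c\<^sup>2 \<le> 1" by (simp add: power_le_one)
  then have s0: "0 \<le> s" by (simp add: s_def)
  have sK: "s \<le> sym_clip N"
    using one_minus_cmod_char_sq_le[OF assms] by (simp add: s_def c_def)
  have "c\<^sup>2 \<le> exp (c\<^sup>2 - 1)" using exp_ge_add_one_self[of "c\<^sup>2 - 1"] by simp
  also have "\<dots> = (exp ((c\<^sup>2 - 1) / 2))\<^sup>2" by (simp add: power2_eq_square flip: exp_add)
  finally have "c \<le> exp ((c\<^sup>2 - 1) / 2)" by (rule power2_le_imp_le) simp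
  then have "c ^ N \<le> exp ((c\<^sup>2 - 1) / 2) ^ N" using c by (intro power_mono)
  also have "\<dots> = exp (- s)" by (simp add: s_def field_simps flip: exp_of_nat_mult)
  also have "\<dots> \<le> 1 / (1 + s)"
    using exp_ge_add_one_self[of s] s0 by (simp add: exp_minus field_simps)
  finally have "s / (1 + s) \<le> 1 - c ^ N" using s0 by (simp add: field_simps)
  moreover have "s / (1 + sym_clip N) \<le> s / (1 + s)"
    using s0 sK by (intro divide_left_mono) auto
  ultimately show ?thesis by (simp add: s_def c_def)
qed

text \<open>At a single frequency \<open>1 - cos\<close> vanishes on a whole lattice of differences
  and cannot control their size. After exchanging the integrals, the average over frequencies is
  bounded below by a tenth of the clipped square for each difference.\<close>

lemma integral_one_minus_cmod_char_sq_ge: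
  assumes "0 < N"
  shows "sym_clip N / 10 \<le> (\<integral>\<theta>. real N * (1 - (cmod (char M (\<theta> / real N)))\<^sup>2) \<partial>unit_uniform)"
proof -
  interpret P: pair_prob_space M M by (rule pair_prob_space_self)
  interpret U: prob_space unit_uniform by (rule prob_space_unit_uniform)
  interpret UP: pair_prob_space unit_uniform "M \<Otimes>\<^sub>M M"
    by (simp add: pair_prob_space_def pair_sigma_finite_def P.prob_space_axioms U.prob_space_axioms
      U.sigma_finite_measure_axioms P.sigma_finite_measure_axioms)
  let ?f = "\<lambda>\<theta> p. real N * (1 - cos (\<theta> / real N * (fst p - snd p)))"
  have f_bound: "\<bar>?f \<theta> p\<bar> \<le> real N * 2" for \<theta> and p :: "real \<times> real"
  proof -
    have "\<bar>1 - cos (\<theta> / real N * (fst p - snd p))\<bar> \<le> 2"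
      using cos_ge_minus_one[of "\<theta> / real N * (fst p - snd p)"] cos_le_one[of "\<theta> / real N * (fst p - snd p)"]
      unfolding abs_le_iff by linarith
    then show ?thesis unfolding abs_mult by (intro mult_mono) auto
  qed
  have int: "integrable (unit_uniform \<Otimes>\<^sub>M (M \<Otimes>\<^sub>M M)) (case_prod ?f)"
    by (rule UP.integrable_const_bound[of _ "real N * 2"]) (use f_bound in auto)
  have "sym_clip N / 10 = (\<integral>p. real N * (min \<bar>fst p - snd p\<bar> (real N))\<^sup>2 / (real N)\<^sup>2 / 10 \<partial>(M \<Otimes>\<^sub>M M))"
    using assms by (simp add: sym_clip_def power2_eq_square)
  also have "\<dots> \<le> (\<integral>p. (\<integral>\<theta>. ?f \<theta> p \<partial>unit_uniform) \<partial>(M \<Otimes>\<^sub>M M))"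
  proof (rule Bochner_Integration.integral_mono)
    show "integrable (M \<Otimes>\<^sub>M M) (\<lambda>p. \<integral>\<theta>. ?f \<theta> p \<partial>unit_uniform)"
      using UP.integrable_snd[OF int] by simp
    fix p :: "real \<times> real"
    let ?d = "fst p - snd p"
    have "(min \<bar>?d\<bar> (real N))\<^sup>2 / (real N)\<^sup>2 = min 1 ((?d / real N)\<^sup>2)"
    proof (cases "\<bar>?d\<bar> \<le> real N")
      case True
      then have "(?d / real N)\<^sup>2 \<le> 1\<^sup>2"
        using assms by (subst abs_le_square_iff[symmetric]) simp
      with True show ?thesis by (simp add: power_divide)
    next
      case False
      then have "1\<^sup>2 \<le> (?d / real N)\<^sup>2"
        using assms by (subst abs_le_square_iff[symmetric]) simp
      with False assms show ?thesis by simp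
    qed
    also have "min 1 ((?d / real N)\<^sup>2) / 10 \<le> (\<integral>\<theta>. 1 - cos (\<theta> * (?d / real N)) \<partial>unit_uniform)"
      by (rule integral_unit_uniform_one_minus_cos)
    finally have "(min \<bar>?d\<bar> (real N))\<^sup>2 / (real N)\<^sup>2 / 10 \<le> (\<integral>\<theta>. 1 - cos (\<theta> * (?d / real N)) \<partial>unit_uniform)" by simp
    then have "real N * ((min \<bar>?d\<bar> (real N))\<^sup>2 / (real N)\<^sup>2 / 10) \<le> real N * (\<integral>\<theta>. 1 - cos (\<theta> * (?d / real N)) \<partial>unit_uniform)"
      by (intro mult_left_mono) auto
    then show "real N * (min \<bar>?d\<bar> (real N))\<^sup>2 / (real N)\<^sup>2 / 10 \<le> (\<integral>\<theta>. ?f \<theta> p \<partial>unit_uniform)"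
      by simp
  qed simp
  also have "\<dots> = (\<integral>\<theta>. (\<integral>p. ?f \<theta> p \<partial>(M \<Otimes>\<^sub>M M)) \<partial>unit_uniform)"
    by (rule UP.Fubini_integral[OF int])
  also have "\<dots> = (\<integral>\<theta>. real N * (1 - (cmod (char M (\<theta> / real N)))\<^sup>2) \<partial>unit_uniform)"
    unfolding one_minus_cmod_char_sq by simp
  finally show ?thesis .
qed

text \<open>The denominator \<open>1 + sym_clip N\<close> does not involve \<theta>, so the
  pointwise bound can be averaged. The constant 20 is the 10 of the averaged cosine bound times the
  2 in the pointwise denominator.\<close>

lemma integral_one_minus_cmod_char_power_ge:
  assumes "0 < N"
  shows "sym_clip N / (1 + sym_clip N) \<le> 20 * (\<integral>\<theta>. 1 - (cmod (char M (\<theta> / real N))) ^ N \<partial>unit_uniform)"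
proof -
  interpret U: prob_space unit_uniform by (rule prob_space_unit_uniform)
  let ?c = "\<lambda>\<theta>. cmod (char M (\<theta> / real N))"
  have c: "0 \<le> ?c \<theta>" "?c \<theta> \<le> 1" for \<theta> by (auto simp: cmod_char_le_1)
  have int: "integrable unit_uniform (\<lambda>\<theta>. 1 - ?c \<theta> ^ k)" for k
    by (rule U.integrable_const_bound[of _ 1]) (use c in \<open>auto simp: power_le_one\<close>)
  have "sym_clip N / 10 / (2 * (1 + sym_clip N))
      \<le> (\<integral>\<theta>. real N * (1 - (?c \<theta>)\<^sup>2) \<partial>unit_uniform) / (2 * (1 + sym_clip N))"
    using sym_clip_nonneg[of N] by (intro divide_right_mono integral_one_minus_cmod_char_sq_ge assms) auto
  also have "\<dots> = (\<integral>\<theta>. real N * (1 - (?c \<theta>)\<^sup>2) / (2 * (1 + sym_clip N)) \<partial>unit_uniform)"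
    by simp
  also have "\<dots> \<le> (\<integral>\<theta>. 1 - ?c \<theta> ^ N \<partial>unit_uniform)"
  proof (rule integral_mono_AE)
    show "AE \<theta> in unit_uniform. real N * (1 - (?c \<theta>)\<^sup>2) / (2 * (1 + sym_clip N)) \<le> 1 - ?c \<theta> ^ N"
      using AE_unit_uniform by eventually_elim (use one_minus_cmod_char_power_ge[OF assms] in auto)
  qed (use int in auto)
  finally have "20 * (sym_clip N / 10 / (2 * (1 + sym_clip N))) \<le> 20 * (\<integral>\<theta>. 1 - ?c \<theta> ^ N \<partial>unit_uniform)"
    by (intro mult_left_mono) auto
  also have "20 * (sym_clip N / 10 / (2 * (1 + sym_clip N))) = sym_clip N / (1 + sym_clip N)"
    using sym_clip_nonneg[of N] by (simp add: field_simps)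
  finally show ?thesis .
qed

text \<open>Restrict the second copy \<open>y\<close> to |y| at most \<open>A\<close>, which has
  mass at least 3/4. There |x| is at most |x - y| + \<open>A\<close>, so clipping and squaring give
  \<open>3 / 4\<close> of the left moment at most twice the symmetrised one plus
  \<open>2 * A\<^sup>2\<close>; 8/3 is rounded up to 3.\<close>

lemma clipped_second_moment_le_sym_clip:
  assumes N: "0 < N" and A: "0 \<le> A" "prob {x. A < \<bar>x\<bar>} \<le> 1 / 4"
  shows "clipped_second_moment (real N) / real N \<le> 3 * sym_clip N + 3 * A\<^sup>2 / real N"
proof -
  interpret P: pair_prob_space M M by (rule pair_prob_space_self)
  let ?R = "clipped_second_moment (real N)"
  have "prob {x. \<bar>x\<bar> \<le> A} = 1 - prob {x. A < \<bar>x\<bar>}"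
    using prob_compl[of "{x. A < \<bar>x\<bar>}"] by (simp add: Compl_eq_Diff_UNIV[symmetric] not_less Collect_neg_eq[symmetric])
  then have p: "3 / 4 \<le> prob {x. \<bar>x\<bar> \<le> A}" using A by linarith
  have int: "integrable (M \<Otimes>\<^sub>M M) (\<lambda>p. (min \<bar>fst p\<bar> (real N))\<^sup>2 * indicator {y. \<bar>y\<bar> \<le> A} (snd p))"
    by (rule P.integrable_const_bound[of _ "(real N)\<^sup>2"]) (auto intro!: AE_I2 power_mono split: split_indicator)
  have "0 \<le> ?R" by simp
  then have "3 / 4 * ?R \<le> prob {x. \<bar>x\<bar> \<le> A} * ?R" using p by (rule mult_right_mono[rotated])
  also have "\<dots> = (\<integral>x. (\<integral>y. (min \<bar>x\<bar> (real N))\<^sup>2 * indicator {y. \<bar>y\<bar> \<le> A} y \<partial>M) \<partial>M)"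
    by simp
  also have "\<dots> = (\<integral>p. (min \<bar>fst p\<bar> (real N))\<^sup>2 * indicator {y. \<bar>y\<bar> \<le> A} (snd p) \<partial>(M \<Otimes>\<^sub>M M))"
    using P.integral_fst'[OF int] by simp
  also have "\<dots> \<le> (\<integral>p. 2 * (min \<bar>fst p - snd p\<bar> (real N))\<^sup>2 + 2 * A\<^sup>2 \<partial>(M \<Otimes>\<^sub>M M))"
  proof (rule Bochner_Integration.integral_mono[OF int])
    fix p :: "real \<times> real"
    let ?x = "fst p" and ?y = "snd p"
    show "(min \<bar>?x\<bar> (real N))\<^sup>2 * indicator {y. \<bar>y\<bar> \<le> A} ?y \<le> 2 * (min \<bar>?x - ?y\<bar> (real N))\<^sup>2 + 2 * A\<^sup>2"
    proof (cases "\<bar>?y\<bar> \<le> A")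
      case True
      let ?m = "min \<bar>?x - ?y\<bar> (real N)"
      have "min \<bar>?x\<bar> (real N) \<le> ?m + A" using True A by (auto simp: min_def)
      then have "(min \<bar>?x\<bar> (real N))\<^sup>2 \<le> (?m + A)\<^sup>2" by (intro power_mono) auto
      also have "\<dots> \<le> 2 * ?m\<^sup>2 + 2 * A\<^sup>2"
        using sum_squares_bound[of ?m A] by (simp add: power2_sum)
      finally show ?thesis using True by simp
    qed simp
  qed simp
  also have "\<dots> = 2 * (real N * sym_clip N) + 2 * A\<^sup>2"
    using N by (simp add: sym_clip_def P.prob_space)
  finally have "3 / 4 * ?R \<le> 2 * (real N * sym_clip N) + 2 * A\<^sup>2" .
  moreover have "0 \<le> real N * sym_clip N" "0 \<le> A\<^sup>2" using sym_clip_nonneg[of N] by auto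
  ultimately have "?R \<le> 3 * (real N * sym_clip N) + 3 * A\<^sup>2" by linarith
  then have "?R \<le> real N * (3 * sym_clip N) + 3 * A\<^sup>2" by simp
  then have "?R / real N \<le> (real N * (3 * sym_clip N) + 3 * A\<^sup>2) / real N"
    by (rule divide_right_mono) simp
  then show ?thesis using N by (simp add: add_divide_distrib)
qed

end

section \<open>From correctors to the symmetrised conditional law\<close>

context exchangeable_kernel
begin

lemma cmod_kernel_integral_le:
  fixes f :: "real \<Rightarrow> complex"
  assumes "\<omega> \<in> space M" and f: "f \<in> borel_measurable borel" and fC: "\<And>x. cmod (f x) \<le> C"
  shows "integrable (\<kappa> \<omega>) f" "cmod (\<integral>x. f x \<partial>\<kappa> \<omega>) \<le> C"
proof -
  interpret \<kappa>: real_distribution "\<kappa> \<omega>" by (rule real_distribution_kernel) fact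
  have [measurable]: "f \<in> borel_measurable (\<kappa> \<omega>)" using f by simp
  show int: "integrable (\<kappa> \<omega>) f"
    by (rule \<kappa>.integrable_const_bound[of _ C]) (use fC in auto)
  have "cmod (\<integral>x. f x \<partial>\<kappa> \<omega>) \<le> (\<integral>x. cmod (f x) \<partial>\<kappa> \<omega>)" by (rule integral_norm_bound)
  also have "\<dots> \<le> C" using int fC by (intro \<kappa>.integral_le_const) auto
  finally show "cmod (\<integral>x. f x \<partial>\<kappa> \<omega>) \<le> C" .
qed

text \<open>Both factors are split into real and imaginary parts, each bounded by the modulus, so
  that the real version applies to the four products.\<close>

lemma complex_expectation_mult_kernel:
  fixes f :: "real \<Rightarrow> complex"
  assumes Z: "Z \<in> borel_measurable (tail_after M g k)" "\<And>\<omega>. \<omega> \<in> space M \<Longrightarrow> cmod (Z \<omega>) \<le> B"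
    and f[measurable]: "f \<in> borel_measurable borel" and fC: "\<And>x. cmod (f x) \<le> C"
  shows "(\<integral>\<omega>. Z \<omega> * f (g k \<omega>) \<partial>M) = (\<integral>\<omega>. Z \<omega> * (\<integral>x. f x \<partial>\<kappa> \<omega>) \<partial>M)"
proof -
  have [measurable]: "Z \<in> borel_measurable M" by (rule tail_after_measurable_imp[OF Z(1)])
  have B0: "0 \<le> B" if "\<omega> \<in> space M" for \<omega> using Z(2)[OF that] norm_ge_zero order_trans by blast
  have int: "integrable M (\<lambda>\<omega>. Z \<omega> * h \<omega>)"
    if "h \<in> borel_measurable M" "\<And>\<omega>. \<omega> \<in> space M \<Longrightarrow> cmod (h \<omega>) \<le> C" for h
  proof (rule integrable_const_bound[of _ "B * C"])
    show "AE \<omega> in M. norm (Z \<omega> * h \<omega>) \<le> B * C"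
      by (rule AE_I2) (auto simp: norm_mult intro!: mult_mono Z that B0)
  qed (use that in measurable)
  define m where "m \<omega> = (\<integral>x. f x \<partial>\<kappa> \<omega>)" for \<omega>
  have [measurable]: "m \<in> borel_measurable M"
    unfolding m_def[abs_def] by (rule tail_measurable_imp[OF kernel_integral_tail_measurable[OF f]])
  have mC: "cmod (m \<omega>) \<le> C" if "\<omega> \<in> space M" for \<omega>
    unfolding m_def by (rule cmod_kernel_integral_le[OF that f fC])
  have Re_m: "Re (m \<omega>) = (\<integral>x. Re (f x) \<partial>\<kappa> \<omega>)" and Im_m: "Im (m \<omega>) = (\<integral>x. Im (f x) \<partial>\<kappa> \<omega>)"
    if "\<omega> \<in> space M" for \<omega>
    unfolding m_def using cmod_kernel_integral_le(1)[OF that f fC] by simp_all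
  have prod_int: "integrable M (\<lambda>\<omega>. a \<omega> * b \<omega>)"
    if "a \<in> borel_measurable M" "b \<in> borel_measurable M"
      "\<And>\<omega>. \<omega> \<in> space M \<Longrightarrow> \<bar>a \<omega>\<bar> \<le> B" "\<And>\<omega>. \<omega> \<in> space M \<Longrightarrow> \<bar>b \<omega>\<bar> \<le> C" for a b :: "'a \<Rightarrow> real"
  proof (rule integrable_const_bound[of _ "B * C"])
    show "AE \<omega> in M. norm (a \<omega> * b \<omega>) \<le> B * C"
      by (rule AE_I2) (auto simp: abs_mult intro!: mult_mono that B0)
  qed (use that in measurable)
  have part: "expectation (\<lambda>\<omega>. p (Z \<omega>) * q (f (g k \<omega>))) = expectation (\<lambda>\<omega>. p (Z \<omega>) * q (m \<omega>))"
    if p: "p = Re \<or> p = Im" and q: "q = Re \<or> q = Im" for p q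
  proof -
    have "expectation (\<lambda>\<omega>. p (Z \<omega>) * q (f (g k \<omega>))) = expectation (\<lambda>\<omega>. p (Z \<omega>) * (\<integral>x. q (f x) \<partial>\<kappa> \<omega>))"
    proof (rule expectation_mult_kernel[where B = B and C = C])
      show "(\<lambda>\<omega>. p (Z \<omega>)) \<in> borel_measurable (tail_after M g k)"
        using p Z(1) by auto
      show "\<bar>p (Z \<omega>)\<bar> \<le> B" if "\<omega> \<in> space M" for \<omega>
        using p Z(2)[OF that] abs_Re_le_cmod[of "Z \<omega>"] abs_Im_le_cmod[of "Z \<omega>"] by auto
      show "\<bar>q (f x)\<bar> \<le> C" for x
        using q fC[of x] abs_Re_le_cmod[of "f x"] abs_Im_le_cmod[of "f x"] by auto
      show "(\<lambda>x. q (f x)) \<in> borel_measurable borel" using q by auto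
    qed
    also have "\<dots> = expectation (\<lambda>\<omega>. p (Z \<omega>) * q (m \<omega>))"
      using q Re_m Im_m by (intro Bochner_Integration.integral_cong refl) auto
    finally show ?thesis .
  qed
  have parts_int: "integrable M (\<lambda>\<omega>. p (Z \<omega>) * q (h \<omega>))"
    if p: "p = Re \<or> p = Im" and q: "q = Re \<or> q = Im" and [measurable]: "h \<in> borel_measurable M"
      and h: "\<And>\<omega>. \<omega> \<in> space M \<Longrightarrow> cmod (h \<omega>) \<le> C" for p q h
  proof (rule prod_int)
    show "\<bar>p (Z \<omega>)\<bar> \<le> B" if "\<omega> \<in> space M" for \<omega>
      using p Z(2)[OF that] abs_Re_le_cmod[of "Z \<omega>"] abs_Im_le_cmod[of "Z \<omega>"] by auto
    show "\<bar>q (h \<omega>)\<bar> \<le> C" if "\<omega> \<in> space M" for \<omega>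
      using q h[OF that] abs_Re_le_cmod[of "h \<omega>"] abs_Im_le_cmod[of "h \<omega>"] by auto
  qed (use p q in auto)
  have split: "Re (\<integral>\<omega>. Z \<omega> * h \<omega> \<partial>M) = expectation (\<lambda>\<omega>. Re (Z \<omega>) * Re (h \<omega>)) - expectation (\<lambda>\<omega>. Im (Z \<omega>) * Im (h \<omega>))"
    "Im (\<integral>\<omega>. Z \<omega> * h \<omega> \<partial>M) = expectation (\<lambda>\<omega>. Re (Z \<omega>) * Im (h \<omega>)) + expectation (\<lambda>\<omega>. Im (Z \<omega>) * Re (h \<omega>))"
    if h: "h \<in> borel_measurable M" "\<And>\<omega>. \<omega> \<in> space M \<Longrightarrow> cmod (h \<omega>) \<le> C" for h
    using int[OF h] parts_int[OF _ _ h]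
    by (simp_all flip: integral_Re integral_Im)
  have f_g: "(\<lambda>\<omega>. f (g k \<omega>)) \<in> borel_measurable M" by measurable
  have "(\<integral>\<omega>. Z \<omega> * f (g k \<omega>) \<partial>M) = (\<integral>\<omega>. Z \<omega> * m \<omega> \<partial>M)"
    using part by (intro complex_eqI) (simp_all add: split f_g fC mC)
  then show ?thesis by (simp add: m_def)
qed

text \<open>Integrating out the last variable leaves a factor that is tail measurable and of modulus
  at most 1. It is absorbed into \<open>Y\<close>, which is why the induction runs over arbitrary
  \<open>Y\<close>.\<close>

theorem expectation_prod_kernel:
  fixes f :: "real \<Rightarrow> complex"
  assumes Y: "Y \<in> borel_measurable (tail_sigma M g)" "\<And>\<omega>. \<omega> \<in> space M \<Longrightarrow> cmod (Y \<omega>) \<le> 1"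
    and f[measurable]: "f \<in> borel_measurable borel" and fC: "\<And>x. cmod (f x) \<le> 1"
  shows "(\<integral>\<omega>. Y \<omega> * (\<Prod>n<k. f (g n \<omega>)) \<partial>M) = (\<integral>\<omega>. Y \<omega> * (\<integral>x. f x \<partial>\<kappa> \<omega>) ^ k \<partial>M)"
  using Y
proof (induction k arbitrary: Y)
  case (Suc k)
  note Y_T = Suc.prems(1) and Y1 = Suc.prems(2)
  let ?m = "\<lambda>\<omega>. \<integral>x. f x \<partial>\<kappa> \<omega>"
  have "(\<integral>\<omega>. Y \<omega> * (\<Prod>n<Suc k. f (g n \<omega>)) \<partial>M) = (\<integral>\<omega>. (Y \<omega> * (\<Prod>n<k. f (g n \<omega>))) * f (g k \<omega>) \<partial>M)"
    by (simp add: mult.assoc)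
  also have "\<dots> = (\<integral>\<omega>. (Y \<omega> * (\<Prod>n<k. f (g n \<omega>))) * ?m \<omega> \<partial>M)"
  proof (rule complex_expectation_mult_kernel[OF _ _ f fC])
    have [measurable]: "n < k \<Longrightarrow> g n \<in> borel_measurable (tail_after M g k)" for n by (rule measurable_tail_after)
    note [measurable] = measurable_tail_sigma_tail_after[OF Y_T, of k]
    show "(\<lambda>\<omega>. Y \<omega> * (\<Prod>n<k. f (g n \<omega>))) \<in> borel_measurable (tail_after M g k)" by measurable
    fix \<omega> assume "\<omega> \<in> space M"
    then show "cmod (Y \<omega> * (\<Prod>n<k. f (g n \<omega>))) \<le> 1"
      unfolding norm_mult prod_norm[symmetric]
      by (intro mult_le_one Y1 prod_le_1 prod_nonneg) (auto simp: fC)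
  qed
  also have "\<dots> = (\<integral>\<omega>. (Y \<omega> * ?m \<omega>) * (\<Prod>n<k. f (g n \<omega>)) \<partial>M)"
    by (simp add: mult_ac)
  also have "\<dots> = (\<integral>\<omega>. (Y \<omega> * ?m \<omega>) * ?m \<omega> ^ k \<partial>M)"
  proof (rule Suc.IH)
    show "(\<lambda>\<omega>. Y \<omega> * ?m \<omega>) \<in> borel_measurable (tail_sigma M g)"
      by (intro borel_measurable_times Y_T kernel_integral_tail_measurable f)
    show "cmod (Y \<omega> * ?m \<omega>) \<le> 1" if "\<omega> \<in> space M" for \<omega>
      unfolding norm_mult by (intro mult_le_one Y1 cmod_kernel_integral_le(2)[OF that f fC] that) auto
  qed
  finally show ?case by (simp add: mult_ac)
qed simp

lemma char_kernel_measurable2 [measurable]: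
  "(\<lambda>(\<omega>, t). char (\<kappa> \<omega>) t) \<in> borel_measurable (M \<Otimes>\<^sub>M borel)"
  unfolding case_prod_beta' char_def
  by (rule lebesgue_integral_measurable_subprob_algebra2[OF _ kernel_fst_measurable]) measurable

text \<open>Since \<open>D\<close> is tail measurable, it enters the conditional characteristic
  function as a factor of modulus 1 and disappears on taking moduli. What remains is E cos(\<theta>
  X) at most the mean of the powered modulus, and \<open>1 - cos\<close> is bounded by the clipped
  square.\<close>

lemma expectation_one_minus_cmod_char_le:
  assumes D: "D \<in> borel_measurable (tail_sigma M g)" and N: "0 < N" and \<theta>: "0 \<le> \<theta>" "\<theta> \<le> 1"
  shows "expectation (\<lambda>\<omega>. 1 - cmod (char (\<kappa> \<omega>) (\<theta> / real N)) ^ N)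
    \<le> 2 * expectation (\<lambda>\<omega>. min 1 (((\<Sum>n<N. g n \<omega>) / real N - D \<omega>)\<^sup>2))"
proof -
  let ?X = "\<lambda>\<omega>. (\<Sum>n<N. g n \<omega>) / real N - D \<omega>" and ?c = "\<lambda>\<omega>. char (\<kappa> \<omega>) (\<theta> / real N)"
  have [measurable]: "D \<in> borel_measurable M" by (rule tail_measurable_imp[OF D])
  have c_T: "?c \<in> borel_measurable (tail_sigma M g)"
    unfolding char_def by (rule kernel_integral_tail_measurable) measurable
  have [measurable]: "?c \<in> borel_measurable M" by (rule tail_measurable_imp[OF c_T])
  have c1: "cmod (?c \<omega>) \<le> 1" if "\<omega> \<in> space M" for \<omega>
    by (rule real_distribution.cmod_char_le_1[OF real_distribution_kernel[OF that]])
  have c1': "cmod (?c \<omega>) ^ N \<le> 1" if "\<omega> \<in> space M" for \<omega> using c1[OF that] by (simp add: power_le_one)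
  have iexp_X: "iexp (\<theta> * ?X \<omega>) = iexp (- \<theta> * D \<omega>) * (\<Prod>n<N. iexp (\<theta> / real N * g n \<omega>))" for \<omega>
    by (simp add: exp_sum[symmetric] exp_add[symmetric] algebra_simps sum_distrib_left sum_divide_distrib)
  have int_X: "integrable M (\<lambda>\<omega>. iexp (\<theta> * ?X \<omega>))"
    by (rule integrable_const_bound[of _ 1]) auto
  have int_c: "integrable M (\<lambda>\<omega>. cmod (?c \<omega>) ^ N)"
    by (rule integrable_const_bound[of _ 1]) (use c1' in auto)
  have "(\<integral>\<omega>. iexp (\<theta> * ?X \<omega>) \<partial>M) = (\<integral>\<omega>. iexp (- \<theta> * D \<omega>) * ?c \<omega> ^ N \<partial>M)"
    unfolding iexp_X char_def
    by (rule expectation_prod_kernel) (use D in \<open>auto intro!: borel_measurable_exp\<close>)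
  then have "cmod (\<integral>\<omega>. iexp (\<theta> * ?X \<omega>) \<partial>M) \<le> (\<integral>\<omega>. cmod (iexp (- \<theta> * D \<omega>) * ?c \<omega> ^ N) \<partial>M)"
    by simp
  also have "\<dots> = expectation (\<lambda>\<omega>. cmod (?c \<omega>) ^ N)" by (simp add: norm_mult norm_power)
  finally have "Re (\<integral>\<omega>. iexp (\<theta> * ?X \<omega>) \<partial>M) \<le> expectation (\<lambda>\<omega>. cmod (?c \<omega>) ^ N)"
    using complex_Re_le_cmod order_trans by blast
  then have "expectation (\<lambda>\<omega>. cos (\<theta> * ?X \<omega>)) \<le> expectation (\<lambda>\<omega>. cmod (?c \<omega>) ^ N)"
    using integral_Re[OF int_X] by (simp add: Re_exp)
  then have "expectation (\<lambda>\<omega>. 1 - cmod (?c \<omega>) ^ N) \<le> 1 - expectation (\<lambda>\<omega>. cos (\<theta> * ?X \<omega>))"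
    using int_c by (simp add: prob_space)
  also have "\<dots> = expectation (\<lambda>\<omega>. 1 - cos (\<theta> * ?X \<omega>))"
    by (subst Bochner_Integration.integral_diff) (auto simp: prob_space intro!: integrable_const_bound[of _ 1])
  also have "\<dots> \<le> expectation (\<lambda>\<omega>. 2 * min 1 ((?X \<omega>)\<^sup>2))"
  proof (rule Bochner_Integration.integral_mono)
    show "integrable M (\<lambda>\<omega>. 1 - cos (\<theta> * ?X \<omega>))"
      by (intro Bochner_Integration.integrable_diff integrable_const integrable_const_bound[of _ 1]) auto
    show "integrable M (\<lambda>\<omega>. 2 * min 1 ((?X \<omega>)\<^sup>2))"
      by (rule integrable_const_bound[of _ 2]) auto
    fix \<omega>
    have "(\<theta> * ?X \<omega>)\<^sup>2 \<le> (?X \<omega>)\<^sup>2"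
      using \<theta> by (subst abs_le_square_iff[symmetric]) (simp only: abs_mult, simp add: mult_left_le_one_le)
    then show "1 - cos (\<theta> * ?X \<omega>) \<le> 2 * min 1 ((?X \<omega>)\<^sup>2)"
      by (intro order_trans[OF one_minus_cos_le] mult_left_mono min.mono) auto
  qed
  finally show ?thesis by simp
qed

definition kernel_sym_clip :: "nat \<Rightarrow> 'a \<Rightarrow> real" where
  "kernel_sym_clip N \<omega> = real_distribution.sym_clip (\<kappa> \<omega>) N"

lemma kernel_sym_clip_measurable [measurable]: "kernel_sym_clip N \<in> borel_measurable M"
proof -
  have "(\<lambda>\<omega>. \<kappa> \<omega> \<Otimes>\<^sub>M \<kappa> \<omega>) \<in> measurable M (subprob_algebra (borel \<Otimes>\<^sub>M borel))"
    by (rule measurable_pair_measure) measurable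
  moreover have "(\<lambda>p. (min \<bar>fst p - snd p\<bar> (real N))\<^sup>2) \<in> borel_measurable (borel \<Otimes>\<^sub>M (borel :: real measure))"
    by measurable
  ultimately have "(\<lambda>\<omega>. (\<integral>p. (min \<bar>fst p - snd p\<bar> (real N))\<^sup>2 \<partial>(\<kappa> \<omega> \<Otimes>\<^sub>M \<kappa> \<omega>)) / real N) \<in> borel_measurable M"
    by (intro borel_measurable_divide borel_measurable_const measurable_compose[OF _ integral_measurable_subprob_algebra])
  also have "?this \<longleftrightarrow> ?thesis"
    by (rule measurable_cong) (simp add: kernel_sym_clip_def real_distribution.sym_clip_def real_distribution_kernel)
  finally show ?thesis .
qed

lemma kernel_sym_clip_nonneg: "\<omega> \<in> space M \<Longrightarrow> 0 \<le> kernel_sym_clip N \<omega>"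
  by (simp add: kernel_sym_clip_def real_distribution.sym_clip_nonneg real_distribution_kernel)

lemma kernel_sym_clip_ratio_bounds:
  assumes "\<omega> \<in> space M"
  shows "0 \<le> kernel_sym_clip N \<omega> / (1 + kernel_sym_clip N \<omega>)" "kernel_sym_clip N \<omega> / (1 + kernel_sym_clip N \<omega>) \<le> 1"
  using kernel_sym_clip_nonneg[OF assms, of N] by (auto simp: divide_le_eq)

lemma integrable_kernel_sym_clip_ratio: "integrable M (\<lambda>\<omega>. kernel_sym_clip N \<omega> / (1 + kernel_sym_clip N \<omega>))"
  by (rule integrable_const_bound[of _ 1]) (auto intro!: AE_I2 simp: abs_of_nonneg kernel_sym_clip_ratio_bounds simp del: abs_divide)

text \<open>The bound on the characteristic function holds for each \<theta> only after averaging
  over outcomes, while the bound on \<open>sym_clip\<close> holds for each outcome only after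
  averaging over \<theta>; Fubini's theorem joins them. The constant is 20 times 2.\<close>

lemma expectation_kernel_sym_clip_le:
  assumes D: "D \<in> borel_measurable (tail_sigma M g)" and N: "0 < N"
  shows "expectation (\<lambda>\<omega>. kernel_sym_clip N \<omega> / (1 + kernel_sym_clip N \<omega>))
    \<le> 40 * expectation (\<lambda>\<omega>. min 1 (((\<Sum>n<N. g n \<omega>) / real N - D \<omega>)\<^sup>2))"
proof -
  interpret U: prob_space unit_uniform by (rule prob_space_unit_uniform)
  interpret MU: pair_prob_space M unit_uniform
    by (simp add: pair_prob_space_def pair_sigma_finite_def prob_space_axioms U.prob_space_axioms
      U.sigma_finite_measure_axioms sigma_finite_measure_axioms)
  let ?e = "expectation (\<lambda>\<omega>. min 1 (((\<Sum>n<N. g n \<omega>) / real N - D \<omega>)\<^sup>2))"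
  let ?h = "\<lambda>\<omega> \<theta>. 1 - cmod (char (\<kappa> \<omega>) (\<theta> / real N)) ^ N"
  have h_meas: "(\<lambda>(\<omega>, \<theta>). ?h \<omega> \<theta>) \<in> borel_measurable (M \<Otimes>\<^sub>M unit_uniform)"
  proof -
    have "(\<lambda>z. (fst z, snd z / real N)) \<in> measurable (M \<Otimes>\<^sub>M unit_uniform) (M \<Otimes>\<^sub>M borel)" by measurable
    from measurable_compose[OF this char_kernel_measurable2]
    have [measurable]: "(\<lambda>z. char (\<kappa> (fst z)) (snd z / real N)) \<in> borel_measurable (M \<Otimes>\<^sub>M unit_uniform)" by simp
    show ?thesis unfolding case_prod_beta' by measurable
  qed
  have h_bound: "\<bar>?h \<omega> \<theta>\<bar> \<le> 1" if "\<omega> \<in> space M" for \<omega> \<theta>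
    using real_distribution.cmod_char_le_1[OF real_distribution_kernel[OF that]] by (simp add: power_le_one)
  have int: "integrable (M \<Otimes>\<^sub>M unit_uniform) (case_prod ?h)"
    by (rule MU.integrable_const_bound[of _ 1]) (use h_meas h_bound in \<open>auto intro!: AE_I2 simp: space_pair_measure\<close>)
  have "expectation (\<lambda>\<omega>. kernel_sym_clip N \<omega> / (1 + kernel_sym_clip N \<omega>)) \<le> expectation (\<lambda>\<omega>. 20 * (\<integral>\<theta>. ?h \<omega> \<theta> \<partial>unit_uniform))"
  proof (rule Bochner_Integration.integral_mono[OF integrable_kernel_sym_clip_ratio])
    show "integrable M (\<lambda>\<omega>. 20 * (\<integral>\<theta>. ?h \<omega> \<theta> \<partial>unit_uniform))"
      using MU.integrable_fst[OF int] by simp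
    fix \<omega> assume "\<omega> \<in> space M"
    then interpret \<kappa>: real_distribution "\<kappa> \<omega>" by (rule real_distribution_kernel)
    show "kernel_sym_clip N \<omega> / (1 + kernel_sym_clip N \<omega>) \<le> 20 * (\<integral>\<theta>. ?h \<omega> \<theta> \<partial>unit_uniform)"
      unfolding kernel_sym_clip_def by (rule \<kappa>.integral_one_minus_cmod_char_power_ge[OF N])
  qed
  also have "\<dots> = 20 * (\<integral>\<theta>. expectation (\<lambda>\<omega>. ?h \<omega> \<theta>) \<partial>unit_uniform)"
    using MU.Fubini_integral[OF int] by simp
  also have "(\<integral>\<theta>. expectation (\<lambda>\<omega>. ?h \<omega> \<theta>) \<partial>unit_uniform) \<le> (\<integral>\<theta>. 2 * ?e \<partial>unit_uniform)"
  proof (rule integral_mono_AE)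
    show "integrable unit_uniform (\<lambda>\<theta>. expectation (\<lambda>\<omega>. ?h \<omega> \<theta>))"
      using MU.integrable_snd[OF int] by simp
    show "AE \<theta> in unit_uniform. expectation (\<lambda>\<omega>. ?h \<omega> \<theta>) \<le> 2 * ?e"
      using AE_unit_uniform by eventually_elim (use expectation_one_minus_cmod_char_le[OF D N] in auto)
  qed simp
  finally show ?thesis by (simp add: U.prob_space[simplified])
qed

lemma conv_kernel_sym_clip:
  assumes D: "\<And>N. D N \<in> borel_measurable (tail_sigma M g)" and "cond_i M g D"
  shows "conv_in_prob M sequentially kernel_sym_clip (\<lambda>_. 0)"
proof -
  let ?X = "\<lambda>N \<omega>. (\<Sum>n<N. g n \<omega>) / real N - D N \<omega>"
  have [measurable]: "D N \<in> borel_measurable M" for N by (rule tail_measurable_imp[OF D])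
  have X: "conv_in_prob M sequentially ?X (\<lambda>_. 0)"
    using assms(2) by (subst (asm) cond_i_iff_conv_in_prob) auto
  \<comment> \<open>The clipped square is bounded by 1 and by the absolute value, so convergence in
    probability becomes convergence of expectations with no moment assumption on the
    averages.\<close>
  have "conv_in_prob M sequentially (\<lambda>N \<omega>. min 1 ((?X N \<omega>)\<^sup>2)) (\<lambda>_. 0)"
  proof (rule conv_in_prob_zero_dominated[OF X])
    have "\<bar>min 1 (x\<^sup>2)\<bar> \<le> \<bar>x\<bar>" for x :: real
    proof (cases "\<bar>x\<bar> \<le> 1")
      case True
      then have "\<bar>x\<bar> * \<bar>x\<bar> \<le> \<bar>x\<bar> * 1" by (intro mult_left_mono) auto
      then show ?thesis by (simp add: power2_eq_square)
    qed simp
    then show "\<forall>\<^sub>F N in sequentially. \<forall>\<omega>\<in>space M. \<bar>min 1 ((?X N \<omega>)\<^sup>2)\<bar> \<le> \<bar>?X N \<omega>\<bar>"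
      by (intro always_eventually allI ballI)
  qed measurable
  then have "(\<lambda>N. expectation (\<lambda>\<omega>. min 1 ((?X N \<omega>)\<^sup>2))) \<longlonglongrightarrow> 0"
    by (rule expectation_tendsto_zero_if_conv_in_prob) simp
  then have lim40: "(\<lambda>N. 40 * expectation (\<lambda>\<omega>. min 1 ((?X N \<omega>)\<^sup>2))) \<longlonglongrightarrow> 0"
    by (rule tendsto_mult_right_zero)
  have KK: "conv_in_prob M sequentially (\<lambda>N \<omega>. kernel_sym_clip N \<omega> / (1 + kernel_sym_clip N \<omega>)) (\<lambda>_. 0)"
  proof (rule conv_in_prob_zero_expectation[OF integrable_kernel_sym_clip_ratio])
    show "AE \<omega> in M. 0 \<le> kernel_sym_clip N \<omega> / (1 + kernel_sym_clip N \<omega>)" for N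
      by (rule AE_I2) (rule kernel_sym_clip_ratio_bounds)
    show "(\<lambda>N. expectation (\<lambda>\<omega>. kernel_sym_clip N \<omega> / (1 + kernel_sym_clip N \<omega>))) \<longlonglongrightarrow> 0"
    proof (rule tendsto_sandwich[OF _ _ tendsto_const lim40])
      show "\<forall>\<^sub>F N in sequentially. 0 \<le> expectation (\<lambda>\<omega>. kernel_sym_clip N \<omega> / (1 + kernel_sym_clip N \<omega>))"
        by (intro always_eventually allI Bochner_Integration.integral_nonneg) (use kernel_sym_clip_nonneg in auto)
      show "\<forall>\<^sub>F N in sequentially. expectation (\<lambda>\<omega>. kernel_sym_clip N \<omega> / (1 + kernel_sym_clip N \<omega>))
          \<le> 40 * expectation (\<lambda>\<omega>. min 1 ((?X N \<omega>)\<^sup>2))"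
        using eventually_gt_at_top[of 0] by eventually_elim (rule expectation_kernel_sym_clip_le[OF D])
    qed
  qed
  show ?thesis unfolding conv_in_prob_def
  proof (intro conjI allI impI)
    fix \<epsilon> :: real assume "0 < \<epsilon>"
    \<comment> \<open>The map from k to k / (1 + k) is strictly increasing on the nonnegative reals,
      so the deviation events of the ratio and of \<open>kernel_sym_clip\<close> are the same after
      changing the threshold.\<close>
    have set_eq: "{\<omega>\<in>space M. \<epsilon> < \<bar>kernel_sym_clip N \<omega> - 0\<bar>} = {\<omega>\<in>space M. \<epsilon> / (1 + \<epsilon>) < \<bar>kernel_sym_clip N \<omega> / (1 + kernel_sym_clip N \<omega>) - 0\<bar>}" for N
    proof -
      have "\<epsilon> / (1 + \<epsilon>) < k / (1 + k) \<longleftrightarrow> \<epsilon> < k" if "0 \<le> k" for k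
        using that \<open>0 < \<epsilon>\<close> by (simp add: field_simps)
      then show ?thesis using kernel_sym_clip_nonneg kernel_sym_clip_ratio_bounds(1) by auto
    qed
    have "0 < \<epsilon> / (1 + \<epsilon>)" using \<open>0 < \<epsilon>\<close> by simp
    then show "(\<lambda>N. prob {\<omega>\<in>space M. \<epsilon> < \<bar>kernel_sym_clip N \<omega> - 0\<bar>}) \<longlonglongrightarrow> 0"
      using KK unfolding conv_in_prob_def set_eq by blast
  qed measurable
qed

text \<open>The characteristic function argument covers integer levels with \<epsilon> = 1. Rounding
  \<open>\<epsilon> * t\<close> up to an integer reaches all real levels and all \<epsilon>, because
  the clipped second moment is monotone in the clipping level.\<close>

lemma conv_Rq_if_cond_i:
  assumes D: "\<And>N. D N \<in> borel_measurable (tail_sigma M g)" and "cond_i M g D" and \<epsilon>: "0 < \<epsilon>"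
  shows "conv_0 (Rq \<kappa> \<epsilon>)"
proof -
  let ?a = "\<lambda>\<omega>. (real (tightness_level \<omega>))\<^sup>2"
  have "conv_in_prob M sequentially (\<lambda>N \<omega>. 3 * kernel_sym_clip N \<omega> + 3 * (?a \<omega> / real N)) (\<lambda>_. 0)"
    by (intro conv_in_prob_zero_add conv_in_prob_zero_cmult conv_kernel_sym_clip[OF D assms(2)]
      conv_in_prob_zero_compose[OF conv_tightness_level filterlim_real_sequentially])
  then have along_nat: "conv_in_prob M sequentially (\<lambda>N. Rq \<kappa> 1 (real N)) (\<lambda>_. 0)"
  proof (rule conv_in_prob_zero_dominated)
    show "\<forall>\<^sub>F N in sequentially. \<forall>\<omega>\<in>space M. \<bar>Rq \<kappa> 1 (real N) \<omega>\<bar> \<le> \<bar>3 * kernel_sym_clip N \<omega> + 3 * (?a \<omega> / real N)\<bar>"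
      using eventually_gt_at_top[of 0]
    proof eventually_elim
      fix N :: nat assume N: "0 < N"
      show "\<forall>\<omega>\<in>space M. \<bar>Rq \<kappa> 1 (real N) \<omega>\<bar> \<le> \<bar>3 * kernel_sym_clip N \<omega> + 3 * (?a \<omega> / real N)\<bar>"
      proof
        fix \<omega> assume \<omega>: "\<omega> \<in> space M"
        then interpret \<kappa>: real_distribution "\<kappa> \<omega>" by (rule real_distribution_kernel)
        from \<kappa>.clipped_second_moment_le_sym_clip[OF N _ tightness_level[OF \<omega>]]
        have "Rq \<kappa> 1 (real N) \<omega> \<le> 3 * kernel_sym_clip N \<omega> + 3 * (?a \<omega> / real N)"
          by (simp add: Rq_def kernel_sym_clip_def)
        then show "\<bar>Rq \<kappa> 1 (real N) \<omega>\<bar> \<le> \<bar>3 * kernel_sym_clip N \<omega> + 3 * (?a \<omega> / real N)\<bar>"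
          using kernel_quantity_nonneg(3)[of "real N" 1 \<omega>] by simp
      qed
    qed
  qed measurable
  have "filterlim (\<lambda>t. nat \<lceil>\<epsilon> * t\<rceil>) sequentially at_top"
    using \<epsilon> by real_asymp
  from conv_in_prob_zero_cmult[OF conv_in_prob_zero_compose[OF along_nat this], of "2 * \<epsilon>"]
  show ?thesis
  proof (rule conv_in_prob_zero_dominated)
    show "\<forall>\<^sub>F t in at_top. \<forall>\<omega>\<in>space M. \<bar>Rq \<kappa> \<epsilon> t \<omega>\<bar> \<le> \<bar>2 * \<epsilon> * Rq \<kappa> 1 (real (nat \<lceil>\<epsilon> * t\<rceil>)) \<omega>\<bar>"
      using eventually_ge_at_top[of "1 / \<epsilon>"]
    proof eventually_elim
      fix t assume "1 / \<epsilon> \<le> t"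
      then have t: "1 \<le> \<epsilon> * t" using \<epsilon> by (simp add: field_simps)
      then have "0 < t" using \<epsilon> by (meson less_le_trans zero_less_mult_pos zero_less_one)
      define n where "n = real (nat \<lceil>\<epsilon> * t\<rceil>)"
      \<comment> \<open>Rounding up at most doubles a number that is at least 1; this is the 2 in
        the factor \<open>2 * \<epsilon>\<close>.\<close>
      have n: "\<epsilon> * t \<le> n" "n \<le> 2 * (\<epsilon> * t)" "0 < n" using t by (auto simp: n_def) linarith+
      show "\<forall>\<omega>\<in>space M. \<bar>Rq \<kappa> \<epsilon> t \<omega>\<bar> \<le> \<bar>2 * \<epsilon> * Rq \<kappa> 1 (real (nat \<lceil>\<epsilon> * t\<rceil>)) \<omega>\<bar>"
      proof
        fix \<omega> assume \<omega>: "\<omega> \<in> space M"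
        then interpret \<kappa>: real_distribution "\<kappa> \<omega>" by (rule real_distribution_kernel)
        have "\<kappa>.clipped_second_moment (\<epsilon> * t) \<le> \<kappa>.clipped_second_moment n"
          using n t by (intro Bochner_Integration.integral_mono power_mono) auto
        then have "Rq \<kappa> \<epsilon> t \<omega> \<le> 1 / t * \<kappa>.clipped_second_moment n"
          unfolding Rq_def using \<open>0 < t\<close> by (intro mult_left_mono) auto
        also have "\<dots> \<le> 2 * \<epsilon> / n * \<kappa>.clipped_second_moment n"
          using n \<open>0 < t\<close> by (intro mult_right_mono) (auto simp: field_simps)
        also have "\<dots> = 2 * \<epsilon> * Rq \<kappa> 1 n \<omega>" by (simp add: Rq_def)
        finally show "\<bar>Rq \<kappa> \<epsilon> t \<omega>\<bar> \<le> \<bar>2 * \<epsilon> * Rq \<kappa> 1 (real (nat \<lceil>\<epsilon> * t\<rceil>)) \<omega>\<bar>"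
          using kernel_quantity_nonneg(3)[of t \<epsilon> \<omega>] \<open>0 < t\<close> by (simp add: n_def)
      qed
    qed
  qed measurable
qed

text \<open>By Jensen's inequality the squared truncated mean divided by \<open>N\<close> is at most
  \<open>Sigq\<close> at level \<open>N\<close>, so a deviation by \<epsilon> forces
  \<open>Sigq\<close> above \<open>\<epsilon>\<^sup>2\<close>.\<close>

lemma Delta_div_sqrt:
  assumes "conv_0 (Sigq \<kappa> 1)"
  shows "conv_in_prob M sequentially (\<lambda>N \<omega>. Delta \<kappa> (real N) \<omega> / sqrt (real N)) (\<lambda>_. 0)"
  unfolding conv_in_prob_def
proof (intro conjI allI impI)
  have [measurable]: "Delta \<kappa> (real N) \<in> borel_measurable M" for N
    by (rule tail_measurable_imp[OF Delta_tail_measurable])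
  show "(\<lambda>\<omega>. Delta \<kappa> (real N) \<omega> / sqrt (real N)) \<in> borel_measurable M" for N by measurable
  fix \<epsilon> :: real assume "0 < \<epsilon>"
  have "conv_in_prob M sequentially (\<lambda>N. Sigq \<kappa> 1 (real N)) (\<lambda>_. 0)"
    by (rule conv_in_prob_zero_compose[OF assms filterlim_real_sequentially])
  then have lim: "(\<lambda>N. prob {\<omega>\<in>space M. \<epsilon>\<^sup>2 < \<bar>Sigq \<kappa> 1 (real N) \<omega> - 0\<bar>}) \<longlonglongrightarrow> 0"
    using \<open>0 < \<epsilon>\<close> unfolding conv_in_prob_def by simp
  show "(\<lambda>N. prob {\<omega>\<in>space M. \<epsilon> < \<bar>Delta \<kappa> (real N) \<omega> / sqrt (real N) - 0\<bar>}) \<longlonglongrightarrow> 0"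
  proof (rule tendsto_sandwich[OF _ _ tendsto_const lim])
    show "\<forall>\<^sub>F N in sequentially. prob {\<omega>\<in>space M. \<epsilon> < \<bar>Delta \<kappa> (real N) \<omega> / sqrt (real N) - 0\<bar>}
        \<le> prob {\<omega>\<in>space M. \<epsilon>\<^sup>2 < \<bar>Sigq \<kappa> 1 (real N) \<omega> - 0\<bar>}"
      using eventually_gt_at_top[of 0]
    proof eventually_elim
      fix N :: nat assume N: "0 < N"
      show "prob {\<omega>\<in>space M. \<epsilon> < \<bar>Delta \<kappa> (real N) \<omega> / sqrt (real N) - 0\<bar>}
        \<le> prob {\<omega>\<in>space M. \<epsilon>\<^sup>2 < \<bar>Sigq \<kappa> 1 (real N) \<omega> - 0\<bar>}"
      proof (rule finite_measure_mono)
        show "{\<omega>\<in>space M. \<epsilon> < \<bar>Delta \<kappa> (real N) \<omega> / sqrt (real N) - 0\<bar>}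
          \<subseteq> {\<omega>\<in>space M. \<epsilon>\<^sup>2 < \<bar>Sigq \<kappa> 1 (real N) \<omega> - 0\<bar>}"
        proof safe
          fix \<omega> assume \<omega>: "\<omega> \<in> space M" and *: "\<epsilon> < \<bar>Delta \<kappa> (real N) \<omega> / sqrt (real N) - 0\<bar>"
          interpret \<kappa>: real_distribution "\<kappa> \<omega>" by (rule real_distribution_kernel) fact
          have "\<epsilon>\<^sup>2 < \<bar>Delta \<kappa> (real N) \<omega> / sqrt (real N)\<bar>\<^sup>2"
            using * \<open>0 < \<epsilon>\<close> by (intro power_strict_mono) auto
          also have "\<dots> = (Delta \<kappa> (real N) \<omega>)\<^sup>2 / real N" by (simp add: power_divide)
          also have "\<dots> \<le> Sigq \<kappa> 1 (real N) \<omega>"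
            using \<kappa>.mean_upto_sq_le[of "real N"] N by (simp add: Delta_def Sigq_def divide_right_mono)
          finally show "\<epsilon>\<^sup>2 < \<bar>Sigq \<kappa> 1 (real N) \<omega> - 0\<bar>" by simp
        qed
      qed measurable
    qed
  qed simp
qed

text \<open>A corrector forces the truncation conditions, which make \<open>Delta\<close> a
  corrector as well. Both are close to the same average, so their difference tends to zero in
  probability, and dividing it by a square root of at least 1 only shrinks it.\<close>

lemma corrector_div_sqrt:
  assumes D: "\<And>N. D N \<in> borel_measurable (tail_sigma M g)" and i: "cond_i M g D"
  shows "conv_in_prob M sequentially (\<lambda>N \<omega>. D N \<omega> / sqrt (real N)) (\<lambda>_. 0)"
proof -
  have [measurable]: "D N \<in> borel_measurable M" "Delta \<kappa> (real N) \<in> borel_measurable M" for N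
    by (auto intro: tail_measurable_imp D Delta_tail_measurable)
  have TS: "conv_0 (Tq \<kappa> 1)" "conv_0 (Sigq \<kappa> 1)"
    using conv_Rq_if_cond_i[OF D i, of 1] conv_Rq_iff[of 1] by auto
  let ?A = "\<lambda>N \<omega>. (\<Sum>n<N. g n \<omega>) / real N"
  have "conv_in_prob M sequentially (\<lambda>N \<omega>. ?A N \<omega> - D N \<omega>) (\<lambda>_. 0)"
    "conv_in_prob M sequentially (\<lambda>N \<omega>. ?A N \<omega> - Delta \<kappa> (real N) \<omega>) (\<lambda>_. 0)"
    using i cond_i_Delta[OF TS] by (simp_all add: cond_i_iff_conv_in_prob)
  then have "conv_in_prob M sequentially (\<lambda>N \<omega>. (?A N \<omega> - Delta \<kappa> (real N) \<omega>) + (-1) * (?A N \<omega> - D N \<omega>)) (\<lambda>_. 0)"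
    by (intro conv_in_prob_zero_add conv_in_prob_zero_cmult)
  then have "conv_in_prob M sequentially (\<lambda>N \<omega>. (D N \<omega> - Delta \<kappa> (real N) \<omega>) / sqrt (real N)) (\<lambda>_. 0)"
  proof (rule conv_in_prob_zero_dominated)
    show "\<forall>\<^sub>F N in sequentially. \<forall>\<omega>\<in>space M. \<bar>(D N \<omega> - Delta \<kappa> (real N) \<omega>) / sqrt (real N)\<bar>
        \<le> \<bar>(?A N \<omega> - Delta \<kappa> (real N) \<omega>) + (-1) * (?A N \<omega> - D N \<omega>)\<bar>"
      using eventually_ge_at_top[of 1]
    proof eventually_elim
      fix N :: nat assume "1 \<le> N"
      then have "1 \<le> sqrt (real N)" by simp
      then have "\<bar>x / sqrt (real N)\<bar> \<le> \<bar>x\<bar>" for x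
        by (simp add: abs_divide divide_le_eq mult_right_le_one_le mult_le_cancel_left1)
      then show "\<forall>\<omega>\<in>space M. \<bar>(D N \<omega> - Delta \<kappa> (real N) \<omega>) / sqrt (real N)\<bar>
        \<le> \<bar>(?A N \<omega> - Delta \<kappa> (real N) \<omega>) + (-1) * (?A N \<omega> - D N \<omega>)\<bar>"
        by simp
    qed
  qed measurable
  from conv_in_prob_zero_add[OF this Delta_div_sqrt[OF TS(2)]] show ?thesis
    by (simp add: diff_divide_distrib)
qed

end

section \<open>Assembly of the equivalences\<close>

theorem theorem4p2:
  fixes M :: "'a measure" and g :: "nat \<Rightarrow> 'a \<Rightarrow> real" and \<kappa> :: "'a \<Rightarrow> real measure"
  assumes "prob_space M"
    and "\<And>n. g n \<in> borel_measurable M"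
    and "exchangeable M g"
    and "is_cond_distr M (tail_sigma M g) (g 0) \<kappa>"
  defines "Tst \<equiv> tail_sigma M g"
  defines "ci \<equiv> (\<exists>D. (\<forall>N. D N \<in> borel_measurable Tst) \<and> cond_i M g D)"
    and "ci' \<equiv> (\<exists>D. (\<forall>N. D N \<in> borel_measurable Tst) \<and> cond_i' M g D)"
    and "cii \<equiv> (\<forall>\<epsilon>>0. conv_in_prob M at_top (Tq \<kappa> \<epsilon>) (\<lambda>_. 0)
                        \<and> conv_in_prob M at_top (Sigq \<kappa> \<epsilon>) (\<lambda>_. 0))"
    and "cii' \<equiv> (\<forall>\<epsilon>>0. conv_in_prob M at_top (Tq \<kappa> \<epsilon>) (\<lambda>_. 0)
                        \<and> conv_in_prob M at_top (Vq \<kappa> \<epsilon>) (\<lambda>_. 0))"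
    and "cii'' \<equiv> (\<forall>\<epsilon>>0. conv_in_prob M at_top (Rq \<kappa> \<epsilon>) (\<lambda>_. 0))"
    and "ciii \<equiv> (\<forall>\<epsilon>>0. conv_in_prob M at_top
                   (\<lambda>m \<omega>. (1 / m) * (LBINT t=0..m. Tq \<kappa> \<epsilon> t \<omega>)) (\<lambda>_. 0))"
    and "ciii' \<equiv> (\<forall>\<epsilon>>0. conv_in_prob M at_top
                   (\<lambda>m \<omega>. m * (LBINT t=ereal m..\<infinity>. Sigq \<kappa> \<epsilon> t \<omega> / t\<^sup>2)) (\<lambda>_. 0))"
    and "ciii'' \<equiv> (\<forall>\<epsilon>>0. conv_in_prob M at_top
                   (\<lambda>m \<omega>. m * (LBINT t=ereal m..\<infinity>. Vq \<kappa> \<epsilon> t \<omega> / t\<^sup>2)) (\<lambda>_. 0))"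
  shows "(ci \<longleftrightarrow> ci') \<and> (ci \<longleftrightarrow> cii) \<and> (ci \<longleftrightarrow> cii') \<and> (ci \<longleftrightarrow> cii'')
         \<and> (ci \<longleftrightarrow> ciii) \<and> (ci \<longleftrightarrow> ciii') \<and> (ci \<longleftrightarrow> ciii'')
         \<and> (cii \<longrightarrow> cond_i M g (\<lambda>N. Delta \<kappa> (real N)) \<and> cond_i' M g (\<lambda>N. Delta \<kappa> (real N)))
         \<and> (\<forall>D. (\<forall>N. D N \<in> borel_measurable Tst) \<and> (cond_i M g D \<or> cond_i' M g D)
                \<longrightarrow> conv_in_prob M sequentially (\<lambda>N \<omega>. D N \<omega> / sqrt (real N)) (\<lambda>_. 0))"
proof -
  interpret prob_space M by fact
  interpret exchangeable_kernel M g \<kappa>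
    by standard (use assms(2-4) in auto)
  have i'_i: "cond_i' M g D \<longleftrightarrow> cond_i M g D" if "\<forall>N. D N \<in> borel_measurable Tst" for D
    using that unfolding Tst_def by (intro cond_i'_iff_cond_i tail_measurable_imp) auto
  have Delta_meas: "\<forall>N. Delta \<kappa> (real N) \<in> borel_measurable Tst"
    unfolding Tst_def using Delta_tail_measurable by blast
  have ci_ci': "ci \<longleftrightarrow> ci'" unfolding ci_def ci'_def using i'_i by blast
  have cii_cii'': "cii \<longleftrightarrow> cii''" unfolding cii_def cii''_def using conv_Rq_iff by blast
  have cii_cii': "cii \<longleftrightarrow> cii'" unfolding cii_def cii'_def using conv_Vq_iff by blast
  have ciii_cii'': "ciii \<longleftrightarrow> cii''" unfolding ciii_def cii''_def using conv_integral_Tq_iff by blast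
  have ciii'_cii'': "ciii' \<longleftrightarrow> cii''" unfolding ciii'_def cii''_def using conv_integral_Sigq_iff by blast
  have ciii''_cii'': "ciii'' \<longleftrightarrow> cii''" unfolding ciii''_def cii''_def using conv_integral_Vq_iff by blast
  have Delta: "cond_i M g (\<lambda>N. Delta \<kappa> (real N))" if cii
    using that cond_i_Delta unfolding cii_def by simp
  have ci_cii: "ci \<longleftrightarrow> cii"
  proof
    assume ci
    then show cii
      unfolding cii_cii'' unfolding ci_def cii''_def Tst_def using conv_Rq_if_cond_i by blast
  next
    assume cii
    then show ci
      unfolding ci_def using Delta Delta_meas by (intro exI[of _ "\<lambda>N. Delta \<kappa> (real N)"]) simp
  qed
  have "cond_i' M g (\<lambda>N. Delta \<kappa> (real N))" if cii
    using Delta[OF that] i'_i[OF Delta_meas] by simp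
  moreover have "conv_in_prob M sequentially (\<lambda>N \<omega>. D N \<omega> / sqrt (real N)) (\<lambda>_. 0)"
    if "\<forall>N. D N \<in> borel_measurable Tst" "cond_i M g D \<or> cond_i' M g D" for D
    using corrector_div_sqrt[of D] that i'_i[OF that(1)] unfolding Tst_def by blast
  ultimately show ?thesis
    using ci_ci' ci_cii cii_cii' cii_cii'' ciii_cii'' ciii'_cii'' ciii''_cii'' Delta by blast
qed

end
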